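(* Every holomorphic curve $\Sigma$ in $\mathbb{L}(\mathbb{H}^3)$ such that the metric $\mathbb{G}_\Sigma$ induced on $\Sigma$ by the neutral Kähler metric $\mathbb{G}$ is non-degenerate is maximal.
   Context: $\mathbb{L}(\mathbb{H}^3)$ denotes the space of oriented geodesics of hyperbolic 3-space $\mathbb{H}^3$. It is a complex surface identified with $\mathbb{P}^1\times\mathbb{P}^1-\overline{\Delta}$, where in holomorphic coordinates $(\mu_1,\mu_2)$ one has $\overline{\Delta}=\{\mu_1\bar\mu_2=-1\}$. (In the upper half-space model $\{(z,t): z\in\mathbb{C},\,t>0\}$ the oriented geodesic $(\mu_1,\mu_2)$ begins at the boundary point $z=-\mu_1$ and ends at $z=1/\bar\mu_2$.) Denote by $\mathbb{J}$ the complex structure. The neutral (signature $++--$) Kähler metric is $$\mathbb{G}=-i\left[\frac{d\mu_1\, d\bar\mu_2}{(1+\mu_1\bar\mu_2)^2}-\frac{d\bar\mu_1\, d\mu_2}{(1+\bar\mu_1\mu_2)^2}\right]$$ (symmetric products). A surface $\Sigma\subset\mathbb{L}(\mathbb{H}^3)$ (smooth, immersed, real 2-dimensional) is a holomorphic curve if $\mathbb{J}$ preserves $T_\gamma\Sigma$ for every $\gamma\in\Sigma$. A surface is maximal if it is stationary for the area functional of the metric induced by $\mathbb{G}$ under compactly supported variations (equivalently, its mean curvature vector vanishes). *)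

theory Defs
  imports "HOL-Analysis.Analysis"
begin

section \<open>Smooth maps between Euclidean spaces\<close>

text \<open>Intended for open \<open>U\<close>.\<close>

fun Ck_on :: "nat \<Rightarrow> ('a::euclidean_space \<Rightarrow> 'b::real_normed_vector) \<Rightarrow> 'a set \<Rightarrow> bool" where
  "Ck_on 0 f U \<longleftrightarrow> continuous_on U f"
| "Ck_on (Suc k) f U \<longleftrightarrow>
     (\<forall>u\<in>U. f differentiable (at u)) \<and> (\<forall>v. Ck_on k (\<lambda>u. frechet_derivative f (at u) v) U)"

definition smooth_on :: "('a::euclidean_space \<Rightarrow> 'b::real_normed_vector) \<Rightarrow> 'a set \<Rightarrow> bool" where
  "smooth_on f U \<longleftrightarrow> (\<forall>k. Ck_on k f U)"

section \<open>The space of oriented geodesics of hyperbolic 3-space\<close>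

datatype psphere = Fin complex | Infty

fun to_complex :: "psphere \<Rightarrow> complex" where
  "to_complex (Fin a) = a"
| "to_complex Infty = 0"

fun recip :: "psphere \<Rightarrow> psphere" where
  "recip (Fin a) = (if a = 0 then Infty else Fin (1 / a))"
| "recip Infty = Fin 0"

text \<open>The geodesic with coordinates \<open>(\<mu>1, \<mu>2)\<close> runs from the boundary point \<open>- \<mu>1\<close> to the
  boundary point \<open>1 / cnj \<mu>2\<close>.\<close>

fun start_point :: "psphere \<Rightarrow> psphere" where
  "start_point (Fin a) = Fin (- a)"
| "start_point Infty = Infty"

fun end_point :: "psphere \<Rightarrow> psphere" where
  "end_point (Fin b) = recip (Fin (cnj b))"
| "end_point Infty = Fin 0"

definition LH3 :: "(psphere \<times> psphere) set" where
  "LH3 = {(p, q). start_point p \<noteq> end_point q}"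

lemma Fin_Fin_in_LH3_iff: "(Fin a, Fin b) \<in> LH3 \<longleftrightarrow> a * cnj b \<noteq> - 1"
proof (cases "b = 0")
  case False
  then have "- a = 1 / cnj b \<longleftrightarrow> a * cnj b = - 1"
    by (simp add: field_simps) (metis add.inverse_inverse)
  with False show ?thesis by (simp add: LH3_def)
qed (simp add: LH3_def)

lemma Infty_in_LH3_iff:
  "(Infty, q) \<in> LH3 \<longleftrightarrow> q \<noteq> Fin 0" "(p, Infty) \<in> LH3 \<longleftrightarrow> p \<noteq> Fin 0"
  by (cases q; auto simp: LH3_def) (cases p; auto simp: LH3_def)

text \<open>Two holomorphic charts cover all of \<open>LH3\<close>, although four are needed for the product of two
  projective lines: \<open>Mu\<close> is \<open>(\<mu>1, \<mu>2)\<close> and \<open>Mu_Recip\<close> is \<open>(1 / \<mu>1, 1 / \<mu>2)\<close>; the points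
  \<open>(0, \<infinity>)\<close> and \<open>(\<infinity>, 0)\<close> lie on the removed antidiagonal. The topology and the smooth
  and complex structures of \<open>LH3\<close> are those defined by these charts.\<close>

datatype coord_chart = Mu | Mu_Recip

fun chart_dom :: "coord_chart \<Rightarrow> (psphere \<times> psphere) set" where
  "chart_dom Mu = {(p, q) \<in> LH3. p \<noteq> Infty \<and> q \<noteq> Infty}"
| "chart_dom Mu_Recip = {(p, q) \<in> LH3. p \<noteq> Fin 0 \<and> q \<noteq> Fin 0}"

fun coord :: "coord_chart \<Rightarrow> psphere \<times> psphere \<Rightarrow> complex \<times> complex" where
  "coord Mu (p, q) = (to_complex p, to_complex q)"
| "coord Mu_Recip (p, q) = (to_complex (recip p), to_complex (recip q))"

text \<open>The tangent space at each point is identified with \<open>complex \<times> complex\<close> by means of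
  the following choice of a chart around that point.\<close>

definition chart_at :: "psphere \<times> psphere \<Rightarrow> coord_chart" where
  "chart_at P = (if P \<in> chart_dom Mu then Mu else Mu_Recip)"

lemma chart_at: "P \<in> LH3 \<Longrightarrow> P \<in> chart_dom (chart_at P)"
  by (cases P) (auto simp: chart_at_def Infty_in_LH3_iff)

definition cplx_J :: "complex \<times> complex \<Rightarrow> complex \<times> complex" where
  "cplx_J v = (\<i> * fst v, \<i> * snd v)"

text \<open>The symmetric product of one-forms is
  \<open>\<alpha> \<beta> = (\<alpha> \<otimes> \<beta> + \<beta> \<otimes> \<alpha>) / 2\<close>. The complex number whose real part is taken is real.\<close>

definition metric_form ::
  "complex \<times> complex \<Rightarrow> complex \<times> complex \<Rightarrow> complex \<times> complex \<Rightarrow> real" where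
  "metric_form \<mu> v w =
     (let \<mu>1 = fst \<mu>; \<mu>2 = snd \<mu>; v1 = fst v; v2 = snd v; w1 = fst w; w2 = snd w in
      Re (- \<i> * ((v1 * cnj w2 + cnj v2 * w1) / 2 / (1 + \<mu>1 * cnj \<mu>2)\<^sup>2
               - (cnj v1 * w2 + v2 * cnj w1) / 2 / (1 + cnj \<mu>1 * \<mu>2)\<^sup>2)))"

text \<open>On the overlap of the two charts the metric has the same coordinate expression in both.
  The same formula therefore extends it to all of \<open>LH3\<close>, and the definition of
  \<open>neutral_metric\<close> does not depend on the choice made in \<open>chart_at\<close>.\<close>

lemma metric_form_recip:
  assumes "a \<noteq> 0" "b \<noteq> 0" "a * cnj b \<noteq> - 1"
  shows "metric_form (1 / a, 1 / b) (- v1 / a\<^sup>2, - v2 / b\<^sup>2) (- w1 / a\<^sup>2, - w2 / b\<^sup>2)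
       = metric_form (a, b) (v1, v2) (w1, w2)"
proof -
  have *: "(- x / a\<^sup>2 * cnj (- y / b\<^sup>2) + cnj (- x' / b\<^sup>2) * (- y' / a\<^sup>2)) / 2
              / (1 + 1 / a * cnj (1 / b))\<^sup>2
         = (x * cnj y + cnj x' * y') / 2 / (1 + a * cnj b)\<^sup>2" for x x' y y'
  proof -
    have "1 + a * cnj b \<noteq> 0"
      using assms(3) by (metis add.commute add_eq_0_iff)
    moreover have "1 + 1 / a * cnj (1 / b) = (1 + a * cnj b) / (a * cnj b)"
      using assms(1,2) by (simp add: field_simps)
    ultimately show ?thesis
      using assms(1,2) by (simp add: power_divide field_simps)
  qed
  have conj: "metric_form m v w =
      Re (- \<i> * (z - cnj z))" if "z = (fst v * cnj (snd w) + cnj (snd v) * fst w) / 2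
        / (1 + fst m * cnj (snd m))\<^sup>2" for m v w z
    unfolding metric_form_def Let_def that by simp
  show ?thesis
    unfolding conj[OF refl] fst_conv snd_conv * ..
qed

definition neutral_metric ::
  "psphere \<times> psphere \<Rightarrow> complex \<times> complex \<Rightarrow> complex \<times> complex \<Rightarrow> real" where
  "neutral_metric P = metric_form (coord (chart_at P) P)"

definition smooth_map_LH3 :: "'a::euclidean_space set \<Rightarrow> ('a \<Rightarrow> psphere \<times> psphere) \<Rightarrow> bool" where
  "smooth_map_LH3 U f \<longleftrightarrow> f ` U \<subseteq> LH3 \<and>
     (\<forall>c. open {u \<in> U. f u \<in> chart_dom c} \<and>
          smooth_on (\<lambda>u. coord c (f u)) {u \<in> U. f u \<in> chart_dom c})"

text \<open>In the next definition the chart is fixed by the base point \<open>u\<close> and does not vary with \<open>u'\<close>.\<close>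

definition differential ::
  "('a::euclidean_space \<Rightarrow> psphere \<times> psphere) \<Rightarrow> 'a \<Rightarrow> 'a \<Rightarrow> complex \<times> complex" where
  "differential f u = frechet_derivative (\<lambda>u'. coord (chart_at (f u)) (f u')) (at u)"

section \<open>Immersed surfaces\<close>

text \<open>An abstract surface is a set \<open>S\<close> with its subspace topology and an atlas \<open>A\<close> of charts
  \<open>(D, x)\<close>, where \<open>x\<close> maps the relatively open set \<open>D\<close> into the plane.\<close>

type_synonym 'm chart = "'m set \<times> ('m \<Rightarrow> real ^ 2)"

definition smooth_surface ::
  "'m::{t2_space, second_countable_topology} set \<Rightarrow> 'm chart set \<Rightarrow> bool" where
  "smooth_surface S A \<longleftrightarrow>
     (\<forall>(D, x) \<in> A. openin (top_of_set S) D \<and> open (x ` D) \<and>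
                   homeomorphism D (x ` D) x (inv_into D x)) \<and>
     (\<Union>(D, x) \<in> A. D) = S \<and>
     (\<forall>(D, x) \<in> A. \<forall>(E, y) \<in> A. smooth_on (y \<circ> inv_into D x) (x ` (D \<inter> E)))"

definition immersed_surface ::
  "'m::{t2_space, second_countable_topology} set \<Rightarrow> 'm chart set
     \<Rightarrow> ('m \<Rightarrow> psphere \<times> psphere) \<Rightarrow> bool" where
  "immersed_surface S A F \<longleftrightarrow> smooth_surface S A \<and>
     (\<forall>(D, x) \<in> A. smooth_map_LH3 (x ` D) (F \<circ> inv_into D x) \<and>
                   (\<forall>u \<in> x ` D. inj (differential (F \<circ> inv_into D x) u)))"

definition tangent_plane ::
  "'m chart \<Rightarrow> ('m \<Rightarrow> psphere \<times> psphere) \<Rightarrow> 'm \<Rightarrow> (complex \<times> complex) set" where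
  "tangent_plane = (\<lambda>(D, x) F p. range (differential (F \<circ> inv_into D x) (x p)))"

definition holomorphic_curve ::
  "'m::{t2_space, second_countable_topology} set \<Rightarrow> 'm chart set
     \<Rightarrow> ('m \<Rightarrow> psphere \<times> psphere) \<Rightarrow> bool" where
  "holomorphic_curve S A F \<longleftrightarrow> immersed_surface S A F \<and>
     (\<forall>c \<in> A. \<forall>p \<in> fst c. cplx_J ` tangent_plane c F p = tangent_plane c F p)"

definition nondegenerate_metric ::
  "'m chart set \<Rightarrow> ('m \<Rightarrow> psphere \<times> psphere) \<Rightarrow> bool" where
  "nondegenerate_metric A F \<longleftrightarrow>
     (\<forall>c \<in> A. \<forall>p \<in> fst c. \<forall>v \<in> tangent_plane c F p.
        (\<forall>w \<in> tangent_plane c F p. neutral_metric (F p) v w = 0) \<longrightarrow> v = 0)"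

section \<open>Area and maximality\<close>

definition gram_matrix :: "(real ^ 2 \<Rightarrow> psphere \<times> psphere) \<Rightarrow> real ^ 2 \<Rightarrow> real ^ 2 ^ 2" where
  "gram_matrix f u =
     (\<chi> i j. neutral_metric (f u) (differential f u (axis i 1)) (differential f u (axis j 1)))"

definition area_density :: "(real ^ 2 \<Rightarrow> psphere \<times> psphere) \<Rightarrow> real ^ 2 \<Rightarrow> real" where
  "area_density f u = sqrt \<bar>det (gram_matrix f u)\<bar>"

text \<open>The absolute value in the density is needed because the induced metric may be negative
  definite or Lorentzian.

  The area of a compact subset \<open>K\<close> of the surface is computed by cutting \<open>K\<close> into finitely many
  Borel pieces \<open>B c\<close>, each in the domain of a chart \<open>c\<close>; by the change of variables formula
  it does not depend on the pieces and the charts.\<close>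

definition has_area ::
  "'m::{t2_space, second_countable_topology} chart set \<Rightarrow> ('m \<Rightarrow> psphere \<times> psphere)
     \<Rightarrow> 'm set \<Rightarrow> ennreal \<Rightarrow> bool" where
  "has_area A F K a \<longleftrightarrow>
     (\<exists>C B. finite C \<and> C \<subseteq> A \<and> disjoint_family_on B C \<and> (\<Union>c\<in>C. B c) = K \<and>
        (\<forall>c\<in>C. B c \<in> sets borel \<and> B c \<subseteq> fst c) \<and>
        a = (\<Sum>(D, x)\<in>C. \<integral>\<^sup>+u\<in>x ` B (D, x).
               ennreal (area_density (F \<circ> inv_into D x) u) \<partial>lborel))"

definition surface_area ::
  "'m::{t2_space, second_countable_topology} chart set \<Rightarrow> ('m \<Rightarrow> psphere \<times> psphere)
     \<Rightarrow> 'm set \<Rightarrow> real" where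
  "surface_area A F K = enn2real (THE a. has_area A F K a)"

definition compact_variation ::
  "'m::{t2_space, second_countable_topology} set \<Rightarrow> 'm chart set \<Rightarrow> ('m \<Rightarrow> psphere \<times> psphere)
     \<Rightarrow> 'm set \<Rightarrow> real \<Rightarrow> (real \<Rightarrow> 'm \<Rightarrow> psphere \<times> psphere) \<Rightarrow> bool" where
  "compact_variation S A F K \<epsilon> H \<longleftrightarrow>
     compact K \<and> K \<subseteq> S \<and> 0 < \<epsilon> \<and>
     (\<forall>(D, x) \<in> A. smooth_map_LH3 ({-\<epsilon><..<\<epsilon>} \<times> x ` D) (\<lambda>(t, u). H t (inv_into D x u))) \<and>
     (\<forall>p \<in> S. H 0 p = F p) \<and>
     (\<forall>t \<in> {-\<epsilon><..<\<epsilon>}. \<forall>p \<in> S - K. H t p = F p)"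

definition maximal_surface ::
  "'m::{t2_space, second_countable_topology} set \<Rightarrow> 'm chart set
     \<Rightarrow> ('m \<Rightarrow> psphere \<times> psphere) \<Rightarrow> bool" where
  "maximal_surface S A F \<longleftrightarrow>
     (\<forall>K \<epsilon> H. compact_variation S A F K \<epsilon> H \<longrightarrow>
        ((\<lambda>t. surface_area A (H t) K) has_real_derivative 0) (at 0))"

end

theory Submission
  imports Defs
begin

text \<open>In coordinates write \<open>Z(v, w) = v\<^sub>1 \<cdot> cnj w\<^sub>2 / (1 + \<mu>\<^sub>1 \<cdot> cnj \<mu>\<^sub>2)\<^sup>2\<close>. The metric is the
  imaginary part of \<open>Z(v, w) + Z(w, v)\<close>. Since \<open>Z(\<J> v, w) = \<i> Z(v, w)\<close> and
  \<open>Z(v, \<J> w) = -\<i> Z(v, w)\<close>, the form \<open>\<omega>(v, w) = \<G>(\<J> v, w)\<close> is the real part of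
  \<open>Z(v, w) - Z(w, v)\<close>. In the variables \<open>a = \<mu>\<^sub>1\<close> and \<open>b = cnj \<mu>\<^sub>2\<close> this is the real part of
  \<open>da \<and> db / (1 + ab)\<^sup>2\<close>, which is closed (\<open>omega_closed\<close>).

  The theorem is Wirtinger's argument in indefinite signature. For two vectors spanning a plane,
  \<open>det (gram) = \<omega>(v, w)\<^sup>2 - N(v, w)\<close>, where \<open>N \<ge> 0\<close> is a multiple of
  \<open>\<bar>v\<^sub>1 w\<^sub>2 - v\<^sub>2 w\<^sub>1\<bar>\<^sup>2\<close> (\<open>det_gram_matrix\<close>). On a complex plane \<open>N\<close> vanishes
  (\<open>defect_complex_plane\<close>), so along a variation of a holomorphic curve \<open>N\<close> has a minimum at time
  \<open>0\<close> and does not contribute to first order. Non-degeneracy makes \<open>\<omega>\<close> nonzero on the tangent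
  planes, and the area density and \<open>\<plusminus>\<omega>\<close> have the same derivative at time \<open>0\<close>. By
  closedness, the derivative of the pull-back of \<open>\<omega>\<close> is \<open>d\<alpha>\<close>, where \<open>\<alpha>\<close> is the contraction of
  \<open>\<omega>\<close> with the velocity of the variation, a one-form supported in the compact set \<open>K\<close>.

  It remains to see that \<open>\<plusminus>d\<alpha>\<close> has integral \<open>0\<close>, the sign being that of \<open>\<omega>\<close> in each chart
  and hence locally constant. A partition of unity near \<open>K\<close> writes \<open>\<alpha>\<close> as a finite sum of forms,
  each supported in a disc of one chart, where the integral of a derivative of a compactly supported
  function vanishes. The change of variables formula shows that areas and the integrals of the
  summands do not depend on the pieces into which \<open>K\<close> is cut.\<close>

section \<open>Continuously differentiable functions\<close>

abbreviation ddir :: "('a::euclidean_space \<Rightarrow> 'b::real_normed_vector) \<Rightarrow> 'a \<Rightarrow> 'a \<Rightarrow> 'b" where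
  "ddir f u v \<equiv> frechet_derivative f (at u) v"

lemma ddir_eq: "(f has_derivative f') (at u) \<Longrightarrow> ddir f u v = f' v"
  using frechet_derivative_at[of f f' u] by simp

lemma ddir_cong:
  assumes "open U" "u \<in> U" "\<And>x. x \<in> U \<Longrightarrow> f x = g x"
  shows "frechet_derivative f (at u) = frechet_derivative g (at u)"
proof -
  have "(f has_derivative D) (at u) \<longleftrightarrow> (g has_derivative D) (at u)" for D
    using has_derivative_transform_within_open[of f D u UNIV U g]
      has_derivative_transform_within_open[of g D u UNIV U f] assms by auto
  then show ?thesis unfolding frechet_derivative_def by simp
qed

lemma differentiable_cong_open:
  assumes "open U" "u \<in> U" "\<And>x. x \<in> U \<Longrightarrow> f x = g x"
  shows "f differentiable at u \<longleftrightarrow> g differentiable at u"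
proof -
  have "(f has_derivative D) (at u) \<longleftrightarrow> (g has_derivative D) (at u)" for D
    using has_derivative_transform_within_open[of f D u UNIV U g]
      has_derivative_transform_within_open[of g D u UNIV U f] assms by auto
  then show ?thesis unfolding differentiable_def by simp
qed

lemma Ck_on_cong:
  assumes "open U" "\<And>u. u \<in> U \<Longrightarrow> f u = g u"
  shows "Ck_on k f U \<longleftrightarrow> Ck_on k g U"
  using assms(2)
proof (induction k arbitrary: f g)
  case 0
  then show ?case by (simp cong: continuous_on_cong)
next
  case (Suc k)
  have "Ck_on k (\<lambda>u. ddir f u v) U \<longleftrightarrow> Ck_on k (\<lambda>u. ddir g u v) U" for v
  proof (rule Suc.IH)
    fix u assume "u \<in> U"
    from ddir_cong[OF assms(1) this, of f g] Suc.prems show "ddir f u v = ddir g u v" by simp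
  qed
  moreover have "f differentiable at u \<longleftrightarrow> g differentiable at u" if "u \<in> U" for u
    using differentiable_cong_open[OF assms(1) that, of f g] Suc.prems by blast
  ultimately show ?case by simp
qed

lemma Ck_on_subset: "Ck_on k f U \<Longrightarrow> V \<subseteq> U \<Longrightarrow> Ck_on k f V"
proof (induction k arbitrary: f)
  case 0
  then show ?case using continuous_on_subset by auto
next
  case (Suc k)
  have "Ck_on k (\<lambda>u. ddir f u v) V" for v
    using Suc.prems by (intro Suc.IH) simp_all
  with Suc.prems show ?case by auto
qed

lemma Ck_on_local:
  assumes "\<And>u. u \<in> U \<Longrightarrow> \<exists>V. open V \<and> u \<in> V \<and> Ck_on k f V"
  shows "Ck_on k f U"
  using assms
proof (induction k arbitrary: f)
  case 0
  have "isCont f u" if "u \<in> U" for u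
    using 0[OF that] continuous_on_eq_continuous_at[of _ f] unfolding Ck_on.simps by blast
  then show ?case by (simp add: continuous_at_imp_continuous_on)
next
  case (Suc k)
  have "f differentiable at u" if "u \<in> U" for u
    using Suc.prems[OF that] unfolding Ck_on.simps by blast
  moreover have "Ck_on k (\<lambda>u. ddir f u v) U" for v
  proof (rule Suc.IH)
    fix u assume "u \<in> U"
    from Suc.prems[OF this] obtain V where "open V" "u \<in> V" "Ck_on (Suc k) f V" by blast
    then show "\<exists>V. open V \<and> u \<in> V \<and> Ck_on k (\<lambda>u. ddir f u v) V"
      by (intro exI[of _ V]) simp
  qed
  ultimately show ?case by simp
qed

lemma Ck_on_SucD: "Ck_on (Suc k) f U \<Longrightarrow> Ck_on k f U"
proof (induction k arbitrary: f)
  case 0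
  then show ?case
    by (simp add: continuous_at_imp_continuous_on differentiable_imp_continuous_within)
next
  case (Suc k)
  have "Ck_on k (\<lambda>u. ddir f u v) U" for v
    by (rule Suc.IH) (use Suc.prems in \<open>simp only: Ck_on.simps(2)[of "Suc k"]\<close>)
  moreover have "\<forall>u\<in>U. f differentiable at u" using Suc.prems by simp
  ultimately show ?case unfolding Ck_on.simps(2)[of k] by blast
qed

lemma Ck_on_differentiable: "Ck_on (Suc k) f U \<Longrightarrow> u \<in> U \<Longrightarrow> f differentiable at u"
  by simp

lemma Ck_on_has_derivative:
  "Ck_on (Suc k) f U \<Longrightarrow> u \<in> U \<Longrightarrow> (f has_derivative frechet_derivative f (at u)) (at u)"
  by (simp add: frechet_derivative_works)

lemma Ck_on_ddir: "Ck_on (Suc k) f U \<Longrightarrow> Ck_on k (\<lambda>u. ddir f u v) U"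
  by simp

lemma Ck_on_continuous: "Ck_on k f U \<Longrightarrow> continuous_on U f"
proof (induction k)
  case (Suc k)
  then show ?case using Ck_on_SucD by blast
qed simp

lemma ddir_bounded_linear:
  assumes "bounded_linear L" "f differentiable at u"
  shows "ddir (\<lambda>u. L (f u)) u v = L (ddir f u v)"
  using bounded_linear.has_derivative[OF assms(1) assms(2)[unfolded frechet_derivative_works]]
  by (rule ddir_eq)

lemma Ck_on_bounded_linear:
  assumes "open U" "bounded_linear L" "Ck_on k f U"
  shows "Ck_on k (\<lambda>u. L (f u)) U"
  using assms(3)
proof (induction k arbitrary: f)
  case 0
  then show ?case using bounded_linear.continuous_on[OF assms(2)] by simp
next
  case (Suc k)
  have "(\<lambda>u. L (f u)) differentiable at u" if "u \<in> U" for u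
    using bounded_linear.has_derivative[OF assms(2) Ck_on_has_derivative[OF Suc.prems that]]
    by (rule differentiableI)
  moreover have "Ck_on k (\<lambda>u. ddir (\<lambda>u. L (f u)) u v) U" for v
    using Suc.IH[of "\<lambda>u. ddir f u v"] Suc.prems
    by (subst Ck_on_cong[OF assms(1), where g = "\<lambda>u. L (ddir f u v)"])
      (auto simp: ddir_bounded_linear[OF assms(2)])
  ultimately show ?case by simp
qed

lemma C1I:
  assumes "\<And>u. u \<in> U \<Longrightarrow> (f has_derivative f' u) (at u)" "\<And>v. continuous_on U (\<lambda>u. f' u v)"
  shows "Ck_on (Suc 0) f U"
proof -
  have "continuous_on U (\<lambda>u. ddir f u v)" for v
    by (rule continuous_on_eq[OF assms(2)[of v]]) (rule ddir_eq[OF assms(1), symmetric])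
  moreover have "f differentiable at u" if "u \<in> U" for u
    using assms(1)[OF that] by (rule differentiableI)
  ultimately show ?thesis by simp
qed

lemma C1_mult:
  fixes f g :: "'a::euclidean_space \<Rightarrow> 'b::real_normed_algebra"
  assumes f: "Ck_on (Suc 0) f U" and g: "Ck_on (Suc 0) g U"
  shows "Ck_on (Suc 0) (\<lambda>u. f u * g u) U"
proof (rule C1I)
  show "((\<lambda>u. f u * g u) has_derivative (\<lambda>v. f u * ddir g u v + ddir f u v * g u)) (at u)" if "u \<in> U" for u
    by (rule has_derivative_mult[OF Ck_on_has_derivative[OF f that] Ck_on_has_derivative[OF g that]])
  show "continuous_on U (\<lambda>u. f u * ddir g u v + ddir f u v * g u)" for v
    using Ck_on_continuous[OF f] Ck_on_continuous[OF g] f g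
    by (intro continuous_on_add continuous_on_mult) simp_all
qed

lemma C1_add:
  assumes f: "Ck_on (Suc 0) f U" and g: "Ck_on (Suc 0) g U"
  shows "Ck_on (Suc 0) (\<lambda>u. f u + g u) U"
proof (rule C1I)
  show "((\<lambda>u. f u + g u) has_derivative (\<lambda>v. ddir f u v + ddir g u v)) (at u)" if "u \<in> U" for u
    by (rule has_derivative_add[OF Ck_on_has_derivative[OF f that] Ck_on_has_derivative[OF g that]])
  show "continuous_on U (\<lambda>u. ddir f u v + ddir g u v)" for v
    using f g by (intro continuous_on_add) simp_all
qed

lemma C1_diff:
  assumes f: "Ck_on (Suc 0) f U" and g: "Ck_on (Suc 0) g U"
  shows "Ck_on (Suc 0) (\<lambda>u. f u - g u) U"
proof (rule C1I)
  show "((\<lambda>u. f u - g u) has_derivative (\<lambda>v. ddir f u v - ddir g u v)) (at u)" if "u \<in> U" for u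
    by (rule has_derivative_diff[OF Ck_on_has_derivative[OF f that] Ck_on_has_derivative[OF g that]])
  show "continuous_on U (\<lambda>u. ddir f u v - ddir g u v)" for v
    using f g by (intro continuous_on_diff) simp_all
qed

lemma C1_const: "Ck_on (Suc 0) (\<lambda>u. c) U"
  by simp

lemma C1_inverse:
  fixes f :: "'a::euclidean_space \<Rightarrow> 'b::real_normed_field"
  assumes f: "Ck_on (Suc 0) f U" and nz: "\<And>u. u \<in> U \<Longrightarrow> f u \<noteq> 0"
  shows "Ck_on (Suc 0) (\<lambda>u. inverse (f u)) U"
proof (rule C1I)
  show "((\<lambda>u. inverse (f u)) has_derivative (\<lambda>v. - (inverse (f u) * ddir f u v * inverse (f u)))) (at u)"
    if "u \<in> U" for u
    by (rule Deriv.has_derivative_inverse[OF nz[OF that] Ck_on_has_derivative[OF f that]])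
  show "continuous_on U (\<lambda>u. - (inverse (f u) * ddir f u v * inverse (f u)))" for v
    using Ck_on_continuous[OF f] f nz
    by (intro continuous_on_minus continuous_on_mult continuous_on_inverse) simp_all
qed

lemma C1_sum:
  "(\<And>i. i \<in> I \<Longrightarrow> Ck_on (Suc 0) (f i) U) \<Longrightarrow> Ck_on (Suc 0) (\<lambda>u. \<Sum>i\<in>I. f i u) U"
proof (induction I rule: infinite_finite_induct)
  case (insert i I)
  have "Ck_on (Suc 0) (\<lambda>u. f i u + (\<Sum>i\<in>I. f i u)) U"
    by (rule C1_add) (use insert in blast)+
  with insert.hyps show ?case by simp
qed simp_all

lemma ddir_mult:
  fixes f g :: "'a::euclidean_space \<Rightarrow> 'b::real_normed_algebra"
  assumes "f differentiable at u" "g differentiable at u"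
  shows "ddir (\<lambda>u. f u * g u) u v = f u * ddir g u v + ddir f u v * g u"
  using has_derivative_mult[OF assms[unfolded frechet_derivative_works]] by (rule ddir_eq)

lemma ddir_diff:
  assumes "f differentiable at u" "g differentiable at u"
  shows "ddir (\<lambda>u. f u - g u) u v = ddir f u v - ddir g u v"
  using has_derivative_diff[OF assms[unfolded frechet_derivative_works]] by (rule ddir_eq)

lemma ddir_sum:
  assumes "\<And>i. i \<in> I \<Longrightarrow> f i differentiable at u"
  shows "ddir (\<lambda>u. \<Sum>i\<in>I. f i u) u v = (\<Sum>i\<in>I. ddir (f i) u v)"
  using has_derivative_sum[of I f "\<lambda>i. frechet_derivative (f i) (at u)"] assms
  by (intro ddir_eq) (auto simp: frechet_derivative_works)

text \<open>Both mixed second derivatives are limits of the same second difference quotient over a small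
  parallelogram. Two applications of the mean value theorem turn the quotient into a mixed derivative
  at a nearby point; the order in which the two sides are used decides which one.\<close>

lemma mixed_difference_mvt:
  fixes f :: "'a::euclidean_space \<Rightarrow> real"
  assumes "Ck_on 2 f U" "0 < s"
    and U: "\<And>\<sigma> \<tau>. 0 \<le> \<sigma> \<Longrightarrow> \<sigma> \<le> s \<Longrightarrow> 0 \<le> \<tau> \<Longrightarrow> \<tau> \<le> s \<Longrightarrow> z + \<sigma> *\<^sub>R p + \<tau> *\<^sub>R q \<in> U"
  obtains \<sigma> \<tau> where "0 < \<sigma>" "\<sigma> < s" "0 < \<tau>" "\<tau> < s"
    "f (z + s *\<^sub>R p + s *\<^sub>R q) - f (z + s *\<^sub>R p) - f (z + s *\<^sub>R q) + f z
       = s * s * ddir (\<lambda>x. ddir f x p) (z + \<sigma> *\<^sub>R p + \<tau> *\<^sub>R q) q"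
proof -
  have f: "Ck_on (Suc (Suc 0)) f U" using assms(1) by (simp add: numeral_2_eq_2)
  have d1: "((\<lambda>\<sigma>. f (w + \<sigma> *\<^sub>R p)) has_real_derivative ddir f (w + \<sigma> *\<^sub>R p) p) (at \<sigma>)"
    if "w + \<sigma> *\<^sub>R p \<in> U" for w \<sigma>
  proof -
    have D: "(f has_derivative frechet_derivative f (at (w + \<sigma> *\<^sub>R p))) (at (w + \<sigma> *\<^sub>R p))"
      using Ck_on_has_derivative[OF f that] .
    have "((\<lambda>\<sigma>. f (w + \<sigma> *\<^sub>R p)) has_derivative
        (\<lambda>h. frechet_derivative f (at (w + \<sigma> *\<^sub>R p)) (h *\<^sub>R p))) (at \<sigma>)"
      by (rule has_derivative_compose[where g=f and f="\<lambda>\<sigma>. w + \<sigma> *\<^sub>R p", OF _ D]) (auto intro!: derivative_eq_intros)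
    then show ?thesis
      unfolding has_field_derivative_def
      by (simp add: linear_cmul[OF has_derivative_linear[OF D]] mult_commute_abs)
  qed
  have d2: "((\<lambda>\<tau>. ddir f (w + \<tau> *\<^sub>R q) p) has_real_derivative ddir (\<lambda>x. ddir f x p) (w + \<tau> *\<^sub>R q) q) (at \<tau>)"
    if "w + \<tau> *\<^sub>R q \<in> U" for w \<tau>
  proof -
    have D: "((\<lambda>x. ddir f x p) has_derivative frechet_derivative (\<lambda>x. ddir f x p) (at (w + \<tau> *\<^sub>R q))) (at (w + \<tau> *\<^sub>R q))"
      using Ck_on_has_derivative[OF Ck_on_ddir[OF f] that] .
    have "((\<lambda>\<tau>. ddir f (w + \<tau> *\<^sub>R q) p) has_derivative
        (\<lambda>h. frechet_derivative (\<lambda>x. ddir f x p) (at (w + \<tau> *\<^sub>R q)) (h *\<^sub>R q))) (at \<tau>)"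
      by (rule has_derivative_compose[where g="\<lambda>x. ddir f x p" and f="\<lambda>\<sigma>. w + \<sigma> *\<^sub>R q", OF _ D]) (auto intro!: derivative_eq_intros)
    then show ?thesis
      unfolding has_field_derivative_def
      by (simp add: linear_cmul[OF has_derivative_linear[OF D]] mult_commute_abs)
  qed
  have "\<exists>\<sigma>>0. \<sigma> < s \<and> (f (z + s *\<^sub>R q + s *\<^sub>R p) - f (z + s *\<^sub>R p)) - (f (z + s *\<^sub>R q + 0 *\<^sub>R p) - f (z + 0 *\<^sub>R p))
     = (s - 0) * (ddir f (z + s *\<^sub>R q + \<sigma> *\<^sub>R p) p - ddir f (z + \<sigma> *\<^sub>R p) p)"
  proof (rule MVT2[OF \<open>0 < s\<close>, where f = "\<lambda>\<sigma>. f (z + s *\<^sub>R q + \<sigma> *\<^sub>R p) - f (z + \<sigma> *\<^sub>R p)"])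
    fix x assume "0 \<le> x" "x \<le> s"
    then have "z + x *\<^sub>R p + s *\<^sub>R q \<in> U" "z + x *\<^sub>R p + 0 *\<^sub>R q \<in> U"
      using \<open>0 < s\<close> by (intro U; simp)+
    then have "z + s *\<^sub>R q + x *\<^sub>R p \<in> U" "z + x *\<^sub>R p \<in> U"
      by (simp_all add: add.assoc add.commute[of "x *\<^sub>R p"])
    then show "((\<lambda>\<sigma>. f (z + s *\<^sub>R q + \<sigma> *\<^sub>R p) - f (z + \<sigma> *\<^sub>R p)) has_real_derivative
      ddir f (z + s *\<^sub>R q + x *\<^sub>R p) p - ddir f (z + x *\<^sub>R p) p) (at x)"
      by (intro DERIV_diff d1)
  qed
  then obtain \<sigma> where \<sigma>: "0 < \<sigma>" "\<sigma> < s" and 1: "f (z + s *\<^sub>R p + s *\<^sub>R q) - f (z + s *\<^sub>R p) - f (z + s *\<^sub>R q) + f z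
     = s * (ddir f (z + s *\<^sub>R q + \<sigma> *\<^sub>R p) p - ddir f (z + \<sigma> *\<^sub>R p) p)" by (auto simp: add_ac)
  have "\<exists>\<tau>>0. \<tau> < s \<and> ddir f (z + \<sigma> *\<^sub>R p + s *\<^sub>R q) p - ddir f (z + \<sigma> *\<^sub>R p + 0 *\<^sub>R q) p
     = (s - 0) * ddir (\<lambda>x. ddir f x p) (z + \<sigma> *\<^sub>R p + \<tau> *\<^sub>R q) q"
    by (rule MVT2[OF \<open>0 < s\<close>]) (use U[of \<sigma>] \<sigma> in \<open>auto intro!: d2\<close>)
  then obtain \<tau> where "0 < \<tau>" "\<tau> < s" "ddir f (z + \<sigma> *\<^sub>R p + s *\<^sub>R q) p - ddir f (z + \<sigma> *\<^sub>R p) p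
     = s * ddir (\<lambda>x. ddir f x p) (z + \<sigma> *\<^sub>R p + \<tau> *\<^sub>R q) q" by auto
  with \<sigma> 1 show thesis by (intro that[of \<sigma> \<tau>]) (auto simp: add_ac)
qed

lemma symmetric_second_derivative_real:
  fixes f :: "'a::euclidean_space \<Rightarrow> real"
  assumes "Ck_on 2 f U" "open U" "z \<in> U"
  shows "ddir (\<lambda>x. ddir f x p) z q = ddir (\<lambda>x. ddir f x q) z p"
proof -
  obtain e where e: "0 < e" "ball z e \<subseteq> U" using assms openE by blast
  define n where "n = norm p + norm q + 1"
  have n: "0 < n" unfolding n_def by (simp add: add_nonneg_pos)
  define s where "s k = e / n * inverse (real (Suc (Suc k)))" for k
  have s1: "0 < s k" for k using e n by (simp add: s_def)
  have s2: "s k * n < e" for k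
  proof -
    have "inverse (real (Suc (Suc k))) < 1" by (simp add: field_simps)
    then have "e * inverse (real (Suc (Suc k))) < e * 1" by (intro mult_strict_left_mono e)
    then show ?thesis using n by (simp add: s_def)
  qed
  note s = s1 s2
  have s0: "s \<longlonglongrightarrow> 0"
    unfolding s_def by (intro tendsto_mult_right_zero LIMSEQ_Suc LIMSEQ_inverse_real_of_nat)
  have dist: "dist z (z + \<sigma> *\<^sub>R p + \<tau> *\<^sub>R q) \<le> s k * n" if "0 \<le> \<sigma>" "\<sigma> \<le> s k" "0 \<le> \<tau>" "\<tau> \<le> s k" for \<sigma> \<tau> k
  proof -
    have "dist z (z + \<sigma> *\<^sub>R p + \<tau> *\<^sub>R q) = norm (\<sigma> *\<^sub>R p + \<tau> *\<^sub>R q)"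
      by (metis add.assoc add_diff_cancel_left' dist_commute dist_norm)
    also have "\<dots> \<le> \<sigma> * norm p + \<tau> * norm q" using norm_triangle_ineq[of "\<sigma> *\<^sub>R p" "\<tau> *\<^sub>R q"] that by simp
    also have "\<dots> \<le> s k * norm p + s k * norm q" using that by (intro add_mono mult_right_mono) auto
    also have "\<dots> \<le> s k * n" using s[of k] by (simp add: n_def algebra_simps)
    finally show ?thesis .
  qed
  have U: "z + \<sigma> *\<^sub>R p + \<tau> *\<^sub>R q \<in> U" if "0 \<le> \<sigma>" "\<sigma> \<le> s k" "0 \<le> \<tau>" "\<tau> \<le> s k" for \<sigma> \<tau> k
    using dist[OF that] s(2)[of k] e(2) by (auto simp: subset_eq)
  have U': "z + \<sigma> *\<^sub>R q + \<tau> *\<^sub>R p \<in> U" if "0 \<le> \<sigma>" "\<sigma> \<le> s k" "0 \<le> \<tau>" "\<tau> \<le> s k" for \<sigma> \<tau> k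
    using U[of \<tau> k \<sigma>] that by (simp add: add_ac)
  have "\<exists>\<xi> \<xi>'. dist z \<xi> \<le> s k * n \<and> dist z \<xi>' \<le> s k * n \<and>
      ddir (\<lambda>x. ddir f x p) \<xi> q = ddir (\<lambda>x. ddir f x q) \<xi>' p" for k
  proof -
    obtain \<sigma> \<tau> where 1: "0 < \<sigma>" "\<sigma> < s k" "0 < \<tau>" "\<tau> < s k"
      "f (z + s k *\<^sub>R p + s k *\<^sub>R q) - f (z + s k *\<^sub>R p) - f (z + s k *\<^sub>R q) + f z
       = s k * s k * ddir (\<lambda>x. ddir f x p) (z + \<sigma> *\<^sub>R p + \<tau> *\<^sub>R q) q"
      by (rule mixed_difference_mvt[OF assms(1) s(1)[of k] U[of _ k]])
    obtain \<sigma>' \<tau>' where 2: "0 < \<sigma>'" "\<sigma>' < s k" "0 < \<tau>'" "\<tau>' < s k"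
      "f (z + s k *\<^sub>R q + s k *\<^sub>R p) - f (z + s k *\<^sub>R q) - f (z + s k *\<^sub>R p) + f z
       = s k * s k * ddir (\<lambda>x. ddir f x q) (z + \<sigma>' *\<^sub>R q + \<tau>' *\<^sub>R p) p"
      by (rule mixed_difference_mvt[OF assms(1) s(1)[of k] U'[of _ k]])
    have e1: "z + s k *\<^sub>R q + s k *\<^sub>R p = z + s k *\<^sub>R p + s k *\<^sub>R q"
      and e2: "z + \<sigma>' *\<^sub>R q + \<tau>' *\<^sub>R p = z + \<tau>' *\<^sub>R p + \<sigma>' *\<^sub>R q"
      by (simp_all add: add_ac)
    have "s k * s k * ddir (\<lambda>x. ddir f x p) (z + \<sigma> *\<^sub>R p + \<tau> *\<^sub>R q) q
       = s k * s k * ddir (\<lambda>x. ddir f x q) (z + \<tau>' *\<^sub>R p + \<sigma>' *\<^sub>R q) p"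
      using 1(5) 2(5) unfolding e1 e2 by linarith
    then have "ddir (\<lambda>x. ddir f x p) (z + \<sigma> *\<^sub>R p + \<tau> *\<^sub>R q) q
       = ddir (\<lambda>x. ddir f x q) (z + \<tau>' *\<^sub>R p + \<sigma>' *\<^sub>R q) p" using s(1)[of k] by simp
    moreover have "dist z (z + \<sigma> *\<^sub>R p + \<tau> *\<^sub>R q) \<le> s k * n" "dist z (z + \<tau>' *\<^sub>R p + \<sigma>' *\<^sub>R q) \<le> s k * n"
      using 1(1-4) 2(1-4) by (auto intro!: dist)
    ultimately show ?thesis by blast
  qed
  then obtain \<xi> \<xi>' where \<xi>: "\<And>k. dist z (\<xi> k) \<le> s k * n" "\<And>k. dist z (\<xi>' k) \<le> s k * n"
      "\<And>k. ddir (\<lambda>x. ddir f x p) (\<xi> k) q = ddir (\<lambda>x. ddir f x q) (\<xi>' k) p" by metis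
  have sn: "(\<lambda>k. s k * n) \<longlonglongrightarrow> 0" using tendsto_mult_left_zero[OF s0] .
  have lim: "x \<longlonglongrightarrow> z" if "\<And>k. dist z (x k) \<le> s k * n" for x
  proof (rule metric_tendsto_imp_tendsto[OF sn])
    have "dist (x k) z \<le> dist (s k * n) 0" for k
      using that[of k] s1[of k] n by (simp add: dist_commute)
    then show "\<forall>\<^sub>F k in sequentially. dist (x k) z \<le> dist (s k * n) 0" by simp
  qed
  have c: "isCont (\<lambda>x. ddir (\<lambda>x. ddir f x p) x q) z" for p q
    using assms by (auto simp: numeral_2_eq_2 continuous_on_eq_continuous_at)
  have "(\<lambda>k. ddir (\<lambda>x. ddir f x p) (\<xi> k) q) \<longlonglongrightarrow> ddir (\<lambda>x. ddir f x p) z q"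
    by (rule isCont_tendsto_compose[OF c lim[OF \<xi>(1)]])
  moreover have "(\<lambda>k. ddir (\<lambda>x. ddir f x p) (\<xi> k) q) \<longlonglongrightarrow> ddir (\<lambda>x. ddir f x q) z p"
    unfolding \<xi>(3) by (rule isCont_tendsto_compose[OF c lim[OF \<xi>(2)]])
  ultimately show ?thesis by (rule LIMSEQ_unique)
qed

lemma symmetric_second_derivative:
  fixes f :: "'a::euclidean_space \<Rightarrow> 'b::euclidean_space"
  assumes f: "Ck_on 2 f U" and U: "open U" "z \<in> U"
  shows "ddir (\<lambda>x. ddir f x p) z q = ddir (\<lambda>x. ddir f x q) z p"
proof (rule euclidean_eqI)
  fix b :: 'b assume "b \<in> Basis"
  have L: "bounded_linear (\<lambda>x. x \<bullet> b)" by (rule bounded_linear_inner_left)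
  have f': "Ck_on (Suc (Suc 0)) f U" using f by (simp add: numeral_2_eq_2)
  have *: "ddir (\<lambda>x. ddir (\<lambda>x. f x \<bullet> b) x p) z q = ddir (\<lambda>x. ddir f x p) z q \<bullet> b" for p q
  proof -
    have "frechet_derivative (\<lambda>x. ddir (\<lambda>x. f x \<bullet> b) x p) (at z) = frechet_derivative (\<lambda>x. ddir f x p \<bullet> b) (at z)"
      by (rule ddir_cong[OF U]) (use f' in \<open>simp add: ddir_bounded_linear[OF L]\<close>)
    moreover have "(\<lambda>x. ddir f x p) differentiable at z" using f' U by simp
    ultimately show ?thesis by (simp add: ddir_bounded_linear[OF L])
  qed
  have "Ck_on 2 (\<lambda>x. f x \<bullet> b) U" by (rule Ck_on_bounded_linear[OF U(1) L f])
  from symmetric_second_derivative_real[OF this U]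
  show "ddir (\<lambda>x. ddir f x p) z q \<bullet> b = ddir (\<lambda>x. ddir f x q) z p \<bullet> b" unfolding * .
qed

lemma C1_slice:
  assumes h: "Ck_on (Suc 0) h (T \<times> U)" and t: "t \<in> T"
  shows "Ck_on (Suc 0) (\<lambda>u. h (t, u)) U"
    and "\<And>u v. u \<in> U \<Longrightarrow> ddir (\<lambda>u. h (t, u)) u v = ddir h (t, u) (0, v)"
proof -
  have D: "((\<lambda>u. h (t, u)) has_derivative (\<lambda>v. ddir h (t, u) (0, v))) (at u)" if "u \<in> U" for u
  proof (rule has_derivative_compose[where f = "\<lambda>u. (t, u)" and f' = "\<lambda>v. (0, v)" and g = h])
    show "((\<lambda>u. (t, u)) has_derivative (\<lambda>v. (0, v))) (at u)"
      by (intro has_derivative_Pair has_derivative_const has_derivative_ident)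
    show "(h has_derivative frechet_derivative h (at (t, u))) (at (t, u))"
      by (rule Ck_on_has_derivative[OF h]) (use t that in simp)
  qed
  show "Ck_on (Suc 0) (\<lambda>u. h (t, u)) U"
  proof (rule C1I[OF D])
    show "continuous_on U (\<lambda>u. ddir h (t, u) (0, v))" for v
    proof (rule continuous_on_compose2[of "T \<times> U" "\<lambda>z. ddir h z (0, v)" U "\<lambda>u. (t, u)"])
      show "continuous_on (T \<times> U) (\<lambda>z. ddir h z (0, v))" using h by simp
      show "continuous_on U (\<lambda>u. (t, u))" by (intro continuous_intros)
      show "(\<lambda>u. (t, u)) ` U \<subseteq> T \<times> U" using t by blast
    qed
  qed
  show "ddir (\<lambda>u. h (t, u)) u v = ddir h (t, u) (0, v)" if "u \<in> U" for u v
    using D[OF that] by (rule ddir_eq)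
qed

lemma C1_time_derivative:
  fixes h :: "real \<times> 'a::euclidean_space \<Rightarrow> real"
  assumes h: "Ck_on (Suc 0) h (T \<times> U)" and "t \<in> T" "u \<in> U"
  shows "((\<lambda>t. h (t, u)) has_real_derivative ddir h (t, u) (1, 0)) (at t)"
proof -
  have D: "(h has_derivative frechet_derivative h (at (t, u))) (at (t, u))"
    by (rule Ck_on_has_derivative[OF h]) (use assms in simp)
  have "((\<lambda>t. h (t, u)) has_derivative (\<lambda>s. ddir h (t, u) (s, 0))) (at t)"
    by (rule has_derivative_compose[where f = "\<lambda>t. (t, u)" and g = h, OF _ D])
      (intro has_derivative_Pair has_derivative_const has_derivative_ident)
  moreover have "(\<lambda>s. ddir h (t, u) (s, 0)) = (*) (ddir h (t, u) (1, 0))"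
  proof
    fix s
    have "(s, 0) = s *\<^sub>R (1, 0::'a)" by simp
    then have "ddir h (t, u) (s, 0) = ddir h (t, u) (s *\<^sub>R (1, 0))" by (rule arg_cong)
    also have "\<dots> = s *\<^sub>R ddir h (t, u) (1, 0)" by (rule linear_cmul[OF has_derivative_linear[OF D]])
    finally show "ddir h (t, u) (s, 0) = ddir h (t, u) (1, 0) * s" by (simp only: real_scaleR_def mult.commute)
  qed
  ultimately show ?thesis unfolding has_field_derivative_def by (simp only:)
qed

text \<open>The square of the positive part is the simplest function that is \<open>0\<close> on a half-line, positive
  beyond it, and continuously differentiable; one derivative is all that the partition of unity
  needs.\<close>

lemma square_pos_part_derivative:
  "((\<lambda>s::real. (max 0 s)\<^sup>2) has_real_derivative 2 * max 0 s) (at s)"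
proof (cases s "0::real" rule: linorder_cases)
  case less
  have "((\<lambda>s::real. (max 0 s)\<^sup>2) has_real_derivative 0) (at s)"
    by (rule has_field_derivative_transform_within_open[of "\<lambda>_. 0" _ _ "{..<0}"]) (use less in auto)
  with less show ?thesis by simp
next
  case greater
  have "((\<lambda>s::real. (max 0 s)\<^sup>2) has_real_derivative 2 * s) (at s)"
    by (rule has_field_derivative_transform_within_open[of "\<lambda>s. s\<^sup>2" _ _ "{0<..}"])
      (use greater in \<open>auto intro!: derivative_eq_intros\<close>)
  with greater show ?thesis by simp
next
  case equal
  have "(\<lambda>h::real. (max 0 h)\<^sup>2 / h) \<midarrow>0\<rightarrow> 0"
  proof (rule Lim_null_comparison[OF _ tendsto_norm_zero[OF tendsto_ident_at]])
    show "\<forall>\<^sub>F h::real in at 0. norm ((max 0 h)\<^sup>2 / h) \<le> norm h"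
      by (rule always_eventually) (auto simp: max_def power2_eq_square)
  qed
  with equal show ?thesis by (simp add: DERIV_def)
qed

lemma C1_bump:
  fixes \<phi> :: "'a::euclidean_space \<Rightarrow> 'b::euclidean_space"
  assumes \<phi>: "Ck_on (Suc 0) \<phi> U"
  shows "Ck_on (Suc 0) (\<lambda>u. (max 0 (\<rho>\<^sup>2 - (\<phi> u - w) \<bullet> (\<phi> u - w)))\<^sup>2) U"
proof (rule C1I)
  fix u assume u: "u \<in> U"
  have "((\<lambda>u. \<rho>\<^sup>2 - (\<phi> u - w) \<bullet> (\<phi> u - w)) has_derivative (\<lambda>v. - 2 * ((\<phi> u - w) \<bullet> ddir \<phi> u v))) (at u)"
    using Ck_on_has_derivative[OF \<phi> u] by (auto intro!: derivative_eq_intros simp: inner_commute)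
  from has_derivative_compose[OF this square_pos_part_derivative[unfolded has_field_derivative_def]]
  show "((\<lambda>u. (max 0 (\<rho>\<^sup>2 - (\<phi> u - w) \<bullet> (\<phi> u - w)))\<^sup>2) has_derivative
     (\<lambda>v. 2 * max 0 (\<rho>\<^sup>2 - (\<phi> u - w) \<bullet> (\<phi> u - w)) * (- 2 * ((\<phi> u - w) \<bullet> ddir \<phi> u v)))) (at u)" .
next
  fix v
  show "continuous_on U (\<lambda>u. 2 * max 0 (\<rho>\<^sup>2 - (\<phi> u - w) \<bullet> (\<phi> u - w)) * (- 2 * ((\<phi> u - w) \<bullet> ddir \<phi> u v)))"
    using Ck_on_continuous[OF \<phi>] \<phi> by (intro continuous_intros) simp_all
qed

text \<open>The sign of a continuous function without zeros is locally constant. This lets a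
  divergence be multiplied by the sign of the area form without producing new terms.\<close>

lemma C1_sgn_mult:
  assumes U: "open U" and w: "continuous_on U w" "\<And>u. u \<in> U \<Longrightarrow> w u \<noteq> (0::real)"
    and f: "Ck_on (Suc 0) f U"
  shows "Ck_on (Suc 0) (\<lambda>u. sgn (w u) * f u :: real) U"
    and "\<And>u v. u \<in> U \<Longrightarrow> ddir (\<lambda>u. sgn (w u) * f u) u v = sgn (w u) * ddir f u v"
proof -
  have loc: "\<exists>V. open V \<and> u \<in> V \<and> V \<subseteq> U \<and> (\<forall>x\<in>V. sgn (w x) = sgn (w u))" if u: "u \<in> U" for u
  proof (cases "w u > 0")
    case True
    have "open {x \<in> U. 0 < w x}"
      using continuous_open_preimage[OF w(1) U open_greaterThan, of 0] by (simp add: vimage_def Int_def)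
    with True u show ?thesis by (intro exI[of _ "{x \<in> U. 0 < w x}"]) auto
  next
    case False
    then have "w u < 0" using w(2)[OF u] by simp
    moreover have "open {x \<in> U. w x < 0}"
      using continuous_open_preimage[OF w(1) U open_lessThan, of 0] by (simp add: vimage_def Int_def)
    ultimately show ?thesis using u by (intro exI[of _ "{x \<in> U. w x < 0}"]) auto
  qed
  show "Ck_on (Suc 0) (\<lambda>u. sgn (w u) * f u) U"
  proof (rule Ck_on_local)
    fix u assume "u \<in> U"
    then obtain V where V: "open V" "u \<in> V" "V \<subseteq> U" "\<forall>x\<in>V. sgn (w x) = sgn (w u)" using loc by blast
    have "Ck_on (Suc 0) (\<lambda>x. sgn (w u) * f x) V"
      by (rule C1_mult[OF C1_const Ck_on_subset[OF f V(3)]])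
    moreover have "Ck_on (Suc 0) (\<lambda>x. sgn (w x) * f x) V \<longleftrightarrow> Ck_on (Suc 0) (\<lambda>x. sgn (w u) * f x) V"
      by (rule Ck_on_cong[OF V(1)]) (simp add: V(4)[rule_format])
    ultimately show "\<exists>V. open V \<and> u \<in> V \<and> Ck_on (Suc 0) (\<lambda>u. sgn (w u) * f u) V"
      using V(1,2) by blast
  qed
  show "ddir (\<lambda>u. sgn (w u) * f u) u v = sgn (w u) * ddir f u v" if u: "u \<in> U" for u v
  proof -
    obtain V where V: "open V" "u \<in> V" "V \<subseteq> U" "\<forall>x\<in>V. sgn (w x) = sgn (w u)" using loc u by blast
    have "frechet_derivative (\<lambda>x. sgn (w x) * f x) (at u) = frechet_derivative (\<lambda>x. sgn (w u) * f x) (at u)"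
      by (rule ddir_cong[OF V(1,2)]) (simp add: V(4)[rule_format])
    then show ?thesis
      by (simp only: ddir_bounded_linear[OF bounded_linear_mult_right Ck_on_differentiable[OF f u]])
  qed
qed

section \<open>The Kaehler form on the space of geodesics\<close>

text \<open>Metric and Kaehler form are both read off from one form, linear in the first argument and
  conjugate linear in the second. Only first coordinates of the first argument and second coordinates
  of the second enter, which makes it of rank one; that is what makes the determinant of the metric
  on a plane computable in \<open>det_gram_matrix\<close>.\<close>

definition zform :: "complex \<times> complex \<Rightarrow> complex \<times> complex \<Rightarrow> complex \<times> complex \<Rightarrow> complex" where
  "zform \<mu> v w = fst v * cnj (snd w) / (1 + fst \<mu> * cnj (snd \<mu>))\<^sup>2"

text \<open>The pull-back along \<open>f\<close>, at the point \<open>z\<close> of the parameter domain and evaluated on two of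
  its vectors.\<close>

definition pull :: "('a::euclidean_space \<Rightarrow> psphere \<times> psphere) \<Rightarrow> 'a \<Rightarrow> 'a \<Rightarrow> 'a \<Rightarrow> complex" where
  "pull f z v w = zform (coord (chart_at (f z)) (f z)) (differential f z v) (differential f z w)"

text \<open>The pull-back of the Kaehler form: replacing \<open>v\<close> by \<open>\<J> v\<close> in the formula for the metric
  multiplies \<open>zform \<mu> v w\<close> by \<open>\<i>\<close> and \<open>zform \<mu> w v\<close> by \<open>-\<i>\<close>, and the imaginary part of their sum
  becomes the real part of their difference.\<close>

definition omega :: "('a::euclidean_space \<Rightarrow> psphere \<times> psphere) \<Rightarrow> 'a \<Rightarrow> 'a \<Rightarrow> 'a \<Rightarrow> real" where
  "omega f z v w = Re (pull f z v w) - Re (pull f z w v)"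

lemma metric_form_zform: "metric_form \<mu> v w = Im (zform \<mu> v w) + Im (zform \<mu> w v)"
proof -
  define z where "z = (fst v * cnj (snd w) + cnj (snd v) * fst w) / 2
        / (1 + fst \<mu> * cnj (snd \<mu>))\<^sup>2"
  have "metric_form \<mu> v w = Re (- \<i> * (z - cnj z))"
    unfolding metric_form_def Let_def z_def by simp
  also have "\<dots> = Im (2 * z)" by simp
  also have "2 * z = zform \<mu> v w + zform \<mu> w v"
    unfolding z_def zform_def by (simp add: add_divide_distrib mult.commute)
  finally show ?thesis by simp
qed

text \<open>The components of a tangent vector in the two charts are related by the derivative of
  \<open>a \<mapsto> 1 / a\<close>; the inversions cancel against the change of the denominator.\<close>

lemma zform_recip:
  assumes "a \<noteq> 0" "b \<noteq> 0"
  shows "zform (inverse a, inverse b) (- (inverse a * v1 * inverse a), - (inverse b * v2 * inverse b))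
           (- (inverse a * w1 * inverse a), - (inverse b * w2 * inverse b))
       = zform (a, b) (v1, v2) (w1, w2)"
proof -
  have *: "1 + inverse a * cnj (inverse b) = (1 + a * cnj b) / (a * cnj b)"
    using assms by (simp add: field_simps)
  show ?thesis unfolding zform_def fst_conv snd_conv * using assms
    by (simp add: power2_eq_square field_simps)
qed

lemma zform_add_left: "zform \<mu> (v + v') w = zform \<mu> v w + zform \<mu> v' w"
  and zform_add_right: "zform \<mu> v (w + w') = zform \<mu> v w + zform \<mu> v w'"
  and zform_scale_left: "zform \<mu> (r *\<^sub>R v) w = r *\<^sub>R zform \<mu> v w"
  and zform_scale_right: "zform \<mu> v (r *\<^sub>R w) = r *\<^sub>R zform \<mu> v w"
  by (simp_all add: zform_def algebra_simps add_divide_distrib scaleR_conv_of_real)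

lemma coord_nondegenerate:
  "P \<in> chart_dom c \<Longrightarrow> 1 + fst (coord c P) * cnj (snd (coord c P)) \<noteq> 0"
proof (cases P)
  fix p q assume P: "P \<in> chart_dom c" "P = (p, q)"
  have *: "1 + a * cnj b \<noteq> 0" if "a * cnj b \<noteq> -1" for a b
    using that by (metis add.commute add_eq_0_iff)
  show ?thesis
  proof (cases c)
    case Mu
    with P obtain a b where "p = Fin a" "q = Fin b" by (cases p; cases q; auto)
    with P Mu * show ?thesis by (simp add: Fin_Fin_in_LH3_iff)
  next
    case Mu_Recip
    show ?thesis
    proof (cases "p = Infty \<or> q = Infty")
      case True
      with P Mu_Recip show ?thesis by auto
    next
      case False
      then obtain a b where ab: "p = Fin a" "q = Fin b" by (cases p; cases q; auto)
      with P Mu_Recip have "a \<noteq> 0" "b \<noteq> 0" "1 + a * cnj b \<noteq> 0"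
        using * by (auto simp: Fin_Fin_in_LH3_iff)
      then show ?thesis using P ab Mu_Recip by (simp add: field_simps)
    qed
  qed
qed

lemma chart_overlap:
  assumes "P \<in> chart_dom Mu" "P \<in> chart_dom Mu_Recip"
  shows "fst (coord Mu P) \<noteq> 0" "snd (coord Mu P) \<noteq> 0"
    "coord Mu_Recip P = (inverse (fst (coord Mu P)), inverse (snd (coord Mu P)))"
proof -
  obtain a b where "P = (Fin a, Fin b)" "a \<noteq> 0" "b \<noteq> 0"
    using assms by (cases P; cases "fst P"; cases "snd P"; auto)
  then show "fst (coord Mu P) \<noteq> 0" "snd (coord Mu P) \<noteq> 0"
    "coord Mu_Recip P = (inverse (fst (coord Mu P)), inverse (snd (coord Mu P)))"
    by (simp_all add: inverse_eq_divide)
qed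

lemma smooth_map_chart:
  assumes "smooth_map_LH3 U f"
  shows "open {u \<in> U. f u \<in> chart_dom c}" "Ck_on k (\<lambda>u. coord c (f u)) {u \<in> U. f u \<in> chart_dom c}"
  using assms by (auto simp: smooth_map_LH3_def smooth_on_def)

lemma smooth_map_in_chart:
  assumes "smooth_map_LH3 U f" "z \<in> U"
  shows "f z \<in> chart_dom (chart_at (f z))"
  using assms chart_at[of "f z"] unfolding smooth_map_LH3_def by blast

lemma smooth_map_open:
  assumes "smooth_map_LH3 U f"
  shows "open U"
proof -
  have "U = (\<Union>c. {u \<in> U. f u \<in> chart_dom c})"
    using smooth_map_in_chart[OF assms] by blast
  also have "open \<dots>" using smooth_map_chart(1)[OF assms] by blast
  finally show ?thesis .
qed

lemma smooth_map_coord_differentiable: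
  assumes "smooth_map_LH3 U f" "z \<in> U" "f z \<in> chart_dom c"
  shows "(\<lambda>u. coord c (f u)) differentiable at z"
  by (rule Ck_on_differentiable[OF smooth_map_chart(2)[OF assms(1), of "Suc 0" c]]) (use assms in simp)

lemma differential_has_derivative:
  assumes "smooth_map_LH3 U f" "z \<in> U"
  shows "((\<lambda>u. coord (chart_at (f z)) (f u)) has_derivative differential f z) (at z)"
  using smooth_map_coord_differentiable[OF assms smooth_map_in_chart[OF assms]]
  unfolding differential_def frechet_derivative_works .

lemma linear_differential:
  assumes "smooth_map_LH3 U f" "z \<in> U"
  shows "linear (differential f z)"
  using differential_has_derivative[OF assms] by (rule has_derivative_linear)

text \<open>The choice made in \<open>chart_at\<close> jumps along the points at infinity, so the definition of the
  pull-back is not visibly smooth in \<open>z\<close>. By the invariance under inversion any chart may be used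
  instead, in particular one that stays fixed near a given point.\<close>

lemma pull_chart:
  assumes f: "smooth_map_LH3 U f" and z: "z \<in> U" "f z \<in> chart_dom c"
  shows "pull f z v w = zform (coord c (f z)) (ddir (\<lambda>u. coord c (f u)) z v)
           (ddir (\<lambda>u. coord c (f u)) z w)"
proof (cases "chart_at (f z) = c")
  case True
  then show ?thesis by (simp add: pull_def differential_def)
next
  case False
  with z have c: "c = Mu_Recip" "chart_at (f z) = Mu"
    by (cases c; auto simp: chart_at_def split: if_splits)+
  define g where "g u = coord Mu (f u)" for u
  have zM: "f z \<in> chart_dom Mu" using smooth_map_in_chart[OF f z(1)] c by simp
  obtain g' where g': "(g has_derivative g') (at z)"
    using smooth_map_coord_differentiable[OF f z(1) zM] unfolding differentiable_def g_def by blast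
  define V where "V = {u \<in> U. f u \<in> chart_dom Mu} \<inter> {u \<in> U. f u \<in> chart_dom Mu_Recip}"
  have V: "open V" "z \<in> V" using open_Int[OF smooth_map_chart(1,1)[OF f]] z c zM unfolding V_def by blast+
  have eq: "coord Mu_Recip (f u) = (inverse (fst (g u)), inverse (snd (g u)))" if "u \<in> V" for u
    using chart_overlap(3) that unfolding g_def V_def by blast
  have nz: "fst (g z) \<noteq> 0" "snd (g z) \<noteq> 0"
    using chart_overlap(1,2)[of "f z"] V(2) unfolding g_def V_def by blast+
  have "((\<lambda>u. (inverse (fst (g u)), inverse (snd (g u)))) has_derivative
      (\<lambda>v. (- (inverse (fst (g z)) * fst (g' v) * inverse (fst (g z))),
            - (inverse (snd (g z)) * snd (g' v) * inverse (snd (g z)))))) (at z)"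
    by (intro has_derivative_Pair Deriv.has_derivative_inverse nz has_derivative_fst has_derivative_snd g')
  then have R: "((\<lambda>u. coord Mu_Recip (f u)) has_derivative
      (\<lambda>v. (- (inverse (fst (g z)) * fst (g' v) * inverse (fst (g z))),
            - (inverse (snd (g z)) * snd (g' v) * inverse (snd (g z)))))) (at z)"
    by (rule has_derivative_transform_within_open[OF _ V]) (simp add: eq)
  have M: "differential f z v = g' v" for v
    unfolding differential_def c using g' unfolding g_def by (rule ddir_eq)
  show ?thesis
    unfolding c ddir_eq[OF R] eq[OF V(2)] zform_recip[OF nz] pull_def M by (simp add: g_def)
qed

text \<open>Here \<open>a\<close> and \<open>b\<close> are \<open>\<mu>\<^sub>1\<close> and \<open>cnj \<mu>\<^sub>2\<close> in a chart around \<open>z\<close>: with the second coordinate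
  conjugated, the form becomes the complex bilinear \<open>da \<otimes> db / (1 + ab)\<^sup>2\<close>.\<close>

lemma pull_local:
  assumes f: "smooth_map_LH3 U f" and z: "z \<in> U"
  obtains V a b where "open V" "z \<in> V" "V \<subseteq> U" "Ck_on 2 a V" "Ck_on 2 b V"
    "\<forall>u\<in>V. 1 + a u * b u \<noteq> 0"
    "\<forall>u\<in>V. \<forall>v w. pull f u v w = ddir a u v * ddir b u w *
       (inverse (1 + a u * b u) * inverse (1 + a u * b u))"
proof -
  define c where "c = chart_at (f z)"
  define g where "g u = coord c (f u)" for u
  define V where "V = {u \<in> U. f u \<in> chart_dom c}"
  have V: "open V" "z \<in> V" "V \<subseteq> U"
    using smooth_map_chart(1)[OF f] smooth_map_in_chart[OF f z] z by (auto simp: V_def c_def)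
  have g: "Ck_on 2 g V" using smooth_map_chart(2)[OF f] unfolding g_def V_def .
  have L: "bounded_linear (\<lambda>x::complex \<times> complex. cnj (snd x))"
    by (rule bounded_linear_compose[OF bounded_linear_cnj bounded_linear_snd])
  have gd: "g differentiable at u" if "u \<in> V" for u
    using g that by (simp add: numeral_2_eq_2)
  show thesis
  proof (rule that[OF V])
    show "Ck_on 2 (\<lambda>u. fst (g u)) V" by (rule Ck_on_bounded_linear[OF V(1) bounded_linear_fst g])
    show "Ck_on 2 (\<lambda>u. cnj (snd (g u))) V" by (rule Ck_on_bounded_linear[OF V(1) L g])
    show "\<forall>u\<in>V. 1 + fst (g u) * cnj (snd (g u)) \<noteq> 0"
      using coord_nondegenerate by (simp add: V_def g_def)
    have "pull f u v w = ddir (\<lambda>u. fst (g u)) u v * ddir (\<lambda>u. cnj (snd (g u))) u w *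
       (inverse (1 + fst (g u) * cnj (snd (g u))) * inverse (1 + fst (g u) * cnj (snd (g u))))"
      if u: "u \<in> V" for u v w
    proof -
      have "pull f u v w = zform (g u) (ddir g u v) (ddir g u w)"
        using pull_chart[OF f] u unfolding V_def g_def[abs_def] by blast
      then show ?thesis
        unfolding ddir_bounded_linear[OF bounded_linear_fst gd[OF u]] ddir_bounded_linear[OF L gd[OF u]]
        by (simp add: zform_def divide_inverse power2_eq_square)
    qed
    then show "\<forall>u\<in>V. \<forall>v w. pull f u v w = ddir (\<lambda>u. fst (g u)) u v * ddir (\<lambda>u. cnj (snd (g u))) u w *
       (inverse (1 + fst (g u) * cnj (snd (g u))) * inverse (1 + fst (g u) * cnj (snd (g u))))" by blast
  qed
qed

lemma C2D:
  assumes "Ck_on 2 a V"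
  shows "Ck_on (Suc 0) a V" "Ck_on (Suc 0) (\<lambda>u. ddir a u v) V"
proof -
  have a: "Ck_on (Suc (Suc 0)) a V" using assms by (simp only: numeral_2_eq_2)
  show "Ck_on (Suc 0) a V" by (rule Ck_on_SucD[OF a])
  show "Ck_on (Suc 0) (\<lambda>u. ddir a u v) V" by (rule Ck_on_ddir[OF a])
qed

lemma pull_C1:
  assumes f: "smooth_map_LH3 U f"
  shows "Ck_on (Suc 0) (\<lambda>u. pull f u v w) U"
proof (rule Ck_on_local)
  fix z assume z: "z \<in> U"
  obtain V a b where V: "open V" "z \<in> V" "V \<subseteq> U" and ab: "Ck_on 2 a V" "Ck_on 2 b V"
    and nz: "\<forall>u\<in>V. 1 + a u * b u \<noteq> 0"
    and p: "\<forall>u\<in>V. \<forall>v w. pull f u v w = ddir a u v * ddir b u w *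
       (inverse (1 + a u * b u) * inverse (1 + a u * b u))"
    by (rule pull_local[OF f z])
  have "Ck_on (Suc 0) (\<lambda>u. ddir a u v * ddir b u w *
       (inverse (1 + a u * b u) * inverse (1 + a u * b u))) V"
    by (intro C1_mult C1_inverse C1_add C1_const C2D ab nz[rule_format])
  then have "Ck_on (Suc 0) (\<lambda>u. pull f u v w) V"
    by (subst Ck_on_cong[OF V(1)]) (use p in auto)
  with V show "\<exists>V. open V \<and> z \<in> V \<and> Ck_on (Suc 0) (\<lambda>u. pull f u v w) V" by blast
qed

lemma omega_C1:
  assumes f: "smooth_map_LH3 U f"
  shows "Ck_on (Suc 0) (\<lambda>u. omega f u v w) U"
  unfolding omega_def
  by (intro C1_diff Ck_on_bounded_linear[OF smooth_map_open[OF f] bounded_linear_Re] pull_C1[OF f])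

text \<open>The exterior derivative of the two-form, evaluated on constant vector fields, which is why no
  bracket terms appear. The derivative of \<open>1 / (1 + ab)\<^sup>2\<close> contributes multiples of \<open>da\<close> and \<open>db\<close>, which
  cancel against \<open>da \<and> db\<close> in the cyclic sum; the second derivatives cancel by their symmetry.\<close>

lemma omega_closed:
  assumes f: "smooth_map_LH3 U f" and z: "z \<in> U"
  shows "ddir (\<lambda>u. omega f u q r) z p + ddir (\<lambda>u. omega f u r p) z q + ddir (\<lambda>u. omega f u p q) z r = 0"
proof -
  obtain V a b where V: "open V" "z \<in> V" "V \<subseteq> U" and ab: "Ck_on 2 a V" "Ck_on 2 b V"
    and nz: "\<forall>u\<in>V. 1 + a u * b u \<noteq> 0"
    and pl: "\<forall>u\<in>V. \<forall>v w. pull f u v w = ddir a u v * ddir b u w *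
       (inverse (1 + a u * b u) * inverse (1 + a u * b u))"
    by (rule pull_local[OF f z])
  define i where "i u = inverse (1 + a u * b u)" for u
  define aa where "aa = frechet_derivative a (at z)"
  define bb where "bb = frechet_derivative b (at z)"
  define a2 where "a2 p = frechet_derivative (\<lambda>u. ddir a u p) (at z)" for p
  define b2 where "b2 p = frechet_derivative (\<lambda>u. ddir b u p) (at z)" for p
  define k where "k p = - (i z * (a z * bb p + aa p * b z) * i z)" for p
  have a2: "a2 p q = a2 q p" and b2: "b2 p q = b2 q p" for p q
    unfolding a2_def b2_def
    by (rule symmetric_second_derivative[OF ab(1) V(1,2)], rule symmetric_second_derivative[OF ab(2) V(1,2)])
  have da: "(a has_derivative aa) (at z)" "(b has_derivative bb) (at z)"
    unfolding aa_def bb_def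
    by (rule Ck_on_has_derivative[OF C2D(1)[OF ab(1)] V(2)], rule Ck_on_has_derivative[OF C2D(1)[OF ab(2)] V(2)])
  have da': "((\<lambda>u. ddir a u p) has_derivative a2 p) (at z)" "((\<lambda>u. ddir b u p) has_derivative b2 p) (at z)" for p
    unfolding a2_def b2_def
    by (rule Ck_on_has_derivative[OF C2D(2)[OF ab(1)] V(2)], rule Ck_on_has_derivative[OF C2D(2)[OF ab(2)] V(2)])
  have "(i has_derivative (\<lambda>p. - (i z * (0 + (a z * bb p + aa p * b z)) * i z))) (at z)"
    unfolding i_def using nz[rule_format, OF V(2)]
    by (intro Deriv.has_derivative_inverse has_derivative_add has_derivative_const has_derivative_mult da)
  then have di: "(i has_derivative k) (at z)" unfolding k_def by simp
  have D: "ddir (\<lambda>u. pull f u q r) z p =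
      aa q * bb r * (i z * k p + k p * i z) + (aa q * b2 r p + a2 q p * bb r) * (i z * i z)" for p q r
  proof -
    have "((\<lambda>u. ddir a u q * ddir b u r * (i u * i u)) has_derivative
      (\<lambda>p. ddir a z q * ddir b z r * (i z * k p + k p * i z) +
          (ddir a z q * b2 r p + a2 q p * ddir b z r) * (i z * i z))) (at z)"
      by (intro has_derivative_mult da' di)
    then have "((\<lambda>u. pull f u q r) has_derivative
      (\<lambda>p. ddir a z q * ddir b z r * (i z * k p + k p * i z) +
          (ddir a z q * b2 r p + a2 q p * ddir b z r) * (i z * i z))) (at z)"
      by (rule has_derivative_transform_within_open[OF _ V(1,2)]) (simp add: pl i_def)
    then show ?thesis unfolding aa_def bb_def by (rule ddir_eq)
  qed
  have pd: "(\<lambda>u. pull f u q r) differentiable at z" for q r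
    using Ck_on_differentiable[OF pull_C1[OF f] z] .
  have rd: "(\<lambda>u. Re (pull f u q r)) differentiable at z" for q r
    using bounded_linear.has_derivative[OF bounded_linear_Re pd[unfolded frechet_derivative_works]]
    by (rule differentiableI)
  have O: "ddir (\<lambda>u. omega f u q r) z p = Re (ddir (\<lambda>u. pull f u q r) z p - ddir (\<lambda>u. pull f u r q) z p)" for p q r
    unfolding omega_def ddir_diff[OF rd rd] ddir_bounded_linear[OF bounded_linear_Re pd] by simp
  have *: "(ddir (\<lambda>u. pull f u q r) z p - ddir (\<lambda>u. pull f u r q) z p)
     + (ddir (\<lambda>u. pull f u r p) z q - ddir (\<lambda>u. pull f u p r) z q)
     + (ddir (\<lambda>u. pull f u p q) z r - ddir (\<lambda>u. pull f u q p) z r) = 0"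
    unfolding D k_def a2[of r q] a2[of q p] a2[of r p] b2[of r q] b2[of q p] b2[of r p]
    by algebra
  show ?thesis unfolding O using arg_cong[OF *, of Re] by simp
qed

text \<open>Parameter changes, restrictions to a time slice and restrictions to the path of one point are
  all treated as compositions. The equation \<open>f = g \<circ> \<phi>\<close> is required near \<open>u\<close> only, since inverse
  chart maps are meaningful only on the image of the chart.\<close>

lemma differential_comp:
  assumes g: "smooth_map_LH3 U g" and \<phi>: "(\<phi> has_derivative \<phi>') (at u)" "\<phi> u \<in> U"
    and W: "open W" "u \<in> W" "\<And>x. x \<in> W \<Longrightarrow> f x = g (\<phi> x)"
  shows "differential f u v = differential g (\<phi> u) (\<phi>' v)"
proof -
  have "((\<lambda>x. coord (chart_at (g (\<phi> u))) (g (\<phi> x))) has_derivative (\<lambda>v. differential g (\<phi> u) (\<phi>' v))) (at u)"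
    using has_derivative_compose[OF \<phi>(1) differential_has_derivative[OF g \<phi>(2)]] .
  then have "((\<lambda>x. coord (chart_at (f u)) (f x)) has_derivative (\<lambda>v. differential g (\<phi> u) (\<phi>' v))) (at u)"
    unfolding W(3)[OF W(2)] by (rule has_derivative_transform_within_open[OF _ W(1,2)]) (simp only: W(3))
  then show ?thesis unfolding differential_def[of f] by (rule ddir_eq)
qed

lemma omega_antisym: "omega f z v w = - omega f z w v"
  by (simp add: omega_def)

lemma linear_omega:
  assumes "linear (differential f z)"
  shows "linear (omega f z v)"
  using assms
  by (intro linearI)
    (simp_all add: omega_def pull_def linear_add linear_cmul zform_add_left zform_add_right
      zform_scale_left zform_scale_right algebra_simps)

section \<open>The area density\<close>

lemma linear_real2:
  fixes L :: "real ^ 2 \<Rightarrow> 'b::real_vector"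
  assumes "linear L"
  shows "L x = x $ 1 *\<^sub>R L (axis 1 1) + x $ 2 *\<^sub>R L (axis 2 1)"
proof -
  have "x = x $ 1 *\<^sub>R axis 1 1 + x $ 2 *\<^sub>R axis 2 1"
    by (simp add: vec_eq_iff forall_2 axis_def)
  from arg_cong[OF this, of L] show ?thesis
    by (simp only: linear_add[OF assms] linear_cmul[OF assms])
qed

lemma det_matrix_real2:
  fixes L :: "real ^ 2 \<Rightarrow> real ^ 2"
  shows "det (matrix L) = L (axis 1 1) $ 1 * L (axis 2 1) $ 2 - L (axis 2 1) $ 1 * L (axis 1 1) $ 2"
  by (simp add: det_2 matrix_def)

text \<open>Two-forms on the plane are multiples of the determinant.\<close>

lemma alternating_linear_map:
  fixes L :: "real ^ 2 \<Rightarrow> real ^ 2" and w :: "real ^ 2 \<Rightarrow> real ^ 2 \<Rightarrow> real"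
  assumes "\<And>v. linear (w v)" "\<And>v v'. w v v' = - w v' v"
  shows "w (L (axis 1 1)) (L (axis 2 1)) = det (matrix L) * w (axis 1 1) (axis 2 1)"
proof -
  have z: "w v v = 0" for v using assms(2)[of v v] by simp
  have *: "w (L a) (axis i 1) = L a $ 1 * w (axis 1 1) (axis i 1) + L a $ 2 * w (axis 2 1) (axis i 1)" for i :: 2 and a
    using linear_real2[OF assms(1), of "axis i 1" "L a"] assms(2)[of "axis i 1"] by simp
  show ?thesis
    unfolding linear_real2[OF assms(1), of _ "L (axis 2 1)"] * det_matrix_real2
    using assms(2)[of "axis 2 1" "axis 1 1"] z by (simp add: algebra_simps)
qed

text \<open>How far the tangent plane is from being complex: the squared modulus of the complex determinant
  of two spanning vectors, with the scaling of the metric.\<close>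

definition defect :: "(real ^ 2 \<Rightarrow> psphere \<times> psphere) \<Rightarrow> real ^ 2 \<Rightarrow> real" where
  "defect f u = (let v = differential f u (axis 1 1); w = differential f u (axis 2 1);
      \<mu> = coord (chart_at (f u)) (f u)
    in (norm (fst v * snd w - snd v * fst w) / (norm (1 + fst \<mu> * cnj (snd \<mu>)))\<^sup>2)\<^sup>2)"

text \<open>Expanding the squared modulus. In this form the smooth dependence on parameters is visible.\<close>

lemma defect_pull:
  defines "e \<equiv> \<lambda>i. axis i (1::real) :: real ^ 2"
  shows "defect f u = (norm (pull f u (e 1) (e 2)))\<^sup>2 + (norm (pull f u (e 2) (e 1)))\<^sup>2
     - 2 * Re (pull f u (e 1) (e 1) * cnj (pull f u (e 2) (e 2)))"
proof -
  define v where "v = differential f u (e 1)"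
  define w where "w = differential f u (e 2)"
  define \<mu> where "\<mu> = coord (chart_at (f u)) (f u)"
  define m where "m = inverse (1 + fst \<mu> * cnj (snd \<mu>)) ^ 2"
  have z: "zform \<mu> x y = m * (fst x * cnj (snd y))" for x y
    by (simp add: zform_def m_def divide_inverse power_inverse)
  have 1: "defect f u = (norm m)\<^sup>2 * (norm (fst v * snd w - snd v * fst w))\<^sup>2"
    unfolding defect_def Let_def v_def w_def e_def \<mu>_def[symmetric] m_def
    by (simp add: divide_inverse power_mult_distrib norm_power norm_inverse power_inverse)
  have "complex_of_real (defect f u) = m * cnj m * ((fst v * snd w - snd v * fst w) * cnj (fst v * snd w - snd v * fst w))"
    unfolding 1 of_real_mult complex_norm_square ..
  also have "\<dots> = zform \<mu> v w * cnj (zform \<mu> v w) + zform \<mu> w v * cnj (zform \<mu> w v)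
     - (zform \<mu> v v * cnj (zform \<mu> w w) + cnj (zform \<mu> v v * cnj (zform \<mu> w w)))"
    unfolding z by (simp add: algebra_simps)
  also have "\<dots> = complex_of_real ((norm (zform \<mu> v w))\<^sup>2 + (norm (zform \<mu> w v))\<^sup>2
     - 2 * Re (zform \<mu> v v * cnj (zform \<mu> w w)))"
    unfolding complex_add_cnj of_real_add of_real_diff complex_norm_square ..
  finally show ?thesis
    unfolding of_real_eq_iff pull_def v_def[symmetric] w_def[symmetric] \<mu>_def[symmetric] .
qed

lemma defect_nonneg: "0 \<le> defect f u"
  by (simp add: defect_def Let_def)

text \<open>The real and imaginary parts of \<open>zform\<close> on two vectors give the Hermitian Gram matrix of the
  Kaehler structure, whose determinant is \<open>det (gram) - \<omega>\<^sup>2\<close>. It is negative or zero because the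
  Hermitian form on the two-dimensional tangent space has signature \<open>(1, 1)\<close>, hence negative
  determinant. The computation uses only that \<open>zform\<close> has rank one.\<close>

lemma det_gram_matrix:
  "det (gram_matrix f u) = (omega f u (axis 1 1) (axis 2 1))\<^sup>2 - defect f u"
proof -
  define z where "z i j = pull f u (axis i 1) (axis j 1)" for i j :: 2
  have g: "gram_matrix f u $ i $ j = Im (z i j) + Im (z j i)" for i j
    by (simp add: gram_matrix_def neutral_metric_def metric_form_zform z_def pull_def)
  have r: "z 1 1 * z 2 2 = z 1 2 * z 2 1"
    by (simp add: z_def pull_def zform_def)
  have r1: "Re (z 1 1) * Re (z 2 2) - Im (z 1 1) * Im (z 2 2) = Re (z 1 2) * Re (z 2 1) - Im (z 1 2) * Im (z 2 1)"
    using arg_cong[OF r, of Re] by simp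
  show ?thesis
    unfolding det_2 g defect_pull omega_def z_def[symmetric] cmod_power2 using r1
    by (simp add: power2_eq_square algebra_simps)
qed

lemma area_density_omega:
  "area_density f u = sqrt \<bar>(omega f u (axis 1 1) (axis 2 1))\<^sup>2 - defect f u\<bar>"
  by (simp add: area_density_def det_gram_matrix)

text \<open>A plane stable under multiplication by \<open>\<i>\<close> is a complex line, so any two of its vectors are
  complex multiples of each other.\<close>

lemma defect_complex_plane:
  assumes "linear (differential f u)" "inj (differential f u)"
    and J: "cplx_J ` range (differential f u) = range (differential f u)"
  shows "defect f u = 0"
proof -
  define v where "v = differential f u (axis 1 1)"
  define w where "w = differential f u (axis 2 1)"
  have ex: "differential f u x = x $ 1 *\<^sub>R v + x $ 2 *\<^sub>R w" for x
    unfolding v_def w_def by (rule linear_real2[OF assms(1)])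
  have "cplx_J v \<in> range (differential f u)" using J unfolding v_def by blast
  then obtain x :: "real ^ 2" where x: "cplx_J v = x $ 1 *\<^sub>R v + x $ 2 *\<^sub>R w"
    using ex by auto
  have v0: "v \<noteq> 0"
  proof
    assume "v = 0"
    then have "axis 1 (1::real) = (0 :: real ^ 2)"
      using injD[OF assms(2), of "axis 1 1" 0] linear_0[OF assms(1)] unfolding v_def by simp
    then show False by (simp add: axis_eq_0_iff)
  qed
  define a where "a = \<i> - of_real (x $ 1)"
  have a: "a \<noteq> 0" by (simp add: a_def complex_eq_iff)
  have 1: "a * fst v = of_real (x $ 2) * fst w" "a * snd v = of_real (x $ 2) * snd w"
    using x by (auto simp: cplx_J_def prod_eq_iff a_def scaleR_conv_of_real algebra_simps)
  have "x $ 2 \<noteq> 0" using 1 a v0 by (auto simp: prod_eq_iff)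
  have "a * of_real (x $ 2) * (fst v * snd w) = a * of_real (x $ 2) * (snd v * fst w)"
  proof -
    have "a * of_real (x $ 2) * (fst v * snd w) = (a * fst v) * (of_real (x $ 2) * snd w)" by simp
    also have "\<dots> = (of_real (x $ 2) * fst w) * (a * snd v)" unfolding 1 by simp
    finally show ?thesis by (simp add: mult_ac)
  qed
  then have "fst v * snd w - snd v * fst w = 0" using a \<open>x $ 2 \<noteq> 0\<close> by simp
  then show ?thesis unfolding defect_def Let_def v_def w_def by simp
qed

text \<open>A kernel vector of the Gram matrix would be the coordinates of a tangent vector orthogonal to
  the whole tangent plane.\<close>

lemma det_gram_nonzero:
  assumes "linear (differential f u)" "inj (differential f u)"
    and nd: "\<And>v. v \<in> range (differential f u) \<Longrightarrow>
      (\<And>w. w \<in> range (differential f u) \<Longrightarrow> neutral_metric (f u) v w = 0) \<Longrightarrow> v = 0"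
  shows "det (gram_matrix f u) \<noteq> 0"
proof
  assume "det (gram_matrix f u) = 0"
  then have "\<not> invertible (gram_matrix f u)" by (simp add: invertible_det_nz)
  then obtain x where x: "x \<noteq> 0" "gram_matrix f u *v x = 0"
    by (auto simp: invertible_left_inverse matrix_left_invertible_ker)
  define D where "D i = differential f u (axis i 1)" for i
  define G where "G = neutral_metric (f u)"
  have ex: "differential f u y = y $ 1 *\<^sub>R D 1 + y $ 2 *\<^sub>R D 2" for y
    unfolding D_def by (rule linear_real2[OF assms(1)])
  have bil: "G v w = Im (zform (coord (chart_at (f u)) (f u)) v w) + Im (zform (coord (chart_at (f u)) (f u)) w v)" for v w
    by (simp add: G_def neutral_metric_def metric_form_zform)
  have sym: "G v w = G w v" for v w unfolding bil by simp
  have lin: "G v (r *\<^sub>R w + s *\<^sub>R w') = r * G v w + s * G v w'" for v w w' r s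
    unfolding bil by (simp add: zform_add_left zform_add_right zform_scale_left zform_scale_right algebra_simps)
  have "G (D i) (D 1) * x $ 1 + G (D i) (D 2) * x $ 2 = 0" for i
    using arg_cong[OF x(2), of "\<lambda>y. y $ i"]
    by (simp add: matrix_vector_mult_def gram_matrix_def sum_2 G_def D_def)
  then have "G (D i) (differential f u x) = 0" for i
    unfolding ex lin by (simp add: mult.commute)
  then have "G (differential f u x) (differential f u y) = 0" for y
    by (simp add: ex[of y] lin sym[of "differential f u x"])
  then have "differential f u x = 0" using nd[of "differential f u x"] unfolding G_def by blast
  then have "x = 0" using injD[OF assms(2)] linear_0[OF assms(1)] by simp
  with x show False by simp
qed

lemma defect_linear:
  assumes eq: "f u = g z" "\<And>v. differential f u v = differential g z (L v)"
    and lin: "linear (differential g z)"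
  shows "defect f u = (det (matrix L))\<^sup>2 * defect g z"
proof -
  define D where "D i = differential g z (axis i 1)" for i
  have D: "differential g z (L (axis i 1)) = L (axis i 1) $ 1 *\<^sub>R D 1 + L (axis i 1) $ 2 *\<^sub>R D 2" for i
    unfolding D_def using linear_real2[OF lin, of "L (axis i 1)"] .
  have "fst (differential f u (axis 1 1)) * snd (differential f u (axis 2 1)) -
        snd (differential f u (axis 1 1)) * fst (differential f u (axis 2 1))
     = of_real (det (matrix L)) * (fst (D 1) * snd (D 2) - snd (D 1) * fst (D 2))"
    unfolding eq(2) D det_matrix_real2 by (simp add: scaleR_conv_of_real algebra_simps)
  then show ?thesis
    unfolding defect_def Let_def eq(1) D_def[symmetric]
    by (simp add: norm_mult power_mult_distrib power_divide)
qed

lemma omega_differential: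
  assumes "f u = g z" "\<And>v. differential f u v = differential g z (L v)"
  shows "omega f u v w = omega g z (L v) (L w)"
  unfolding omega_def pull_def assms ..

lemma omega_linear:
  fixes f g :: "real ^ 2 \<Rightarrow> psphere \<times> psphere"
  assumes eq: "f u = g z" "\<And>v. differential f u v = differential g z (L v)"
    and lin: "linear (differential g z)"
  shows "omega f u (axis 1 1) (axis 2 1) = det (matrix L) * omega g z (axis 1 1) (axis 2 1)"
  unfolding omega_differential[OF eq]
  by (rule alternating_linear_map[where w = "omega g z", OF linear_omega[OF lin]])
    (rule omega_antisym)

lemma area_density_linear:
  assumes eq: "f u = g z" "\<And>v. differential f u v = differential g z (L v)"
    and lin: "linear (differential g z)"
  shows "area_density f u = \<bar>det (matrix L)\<bar> * area_density g z"
proof -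
  have "(omega f u (axis 1 1) (axis 2 1))\<^sup>2 - defect f u
     = (det (matrix L))\<^sup>2 * ((omega g z (axis 1 1) (axis 2 1))\<^sup>2 - defect g z)"
    unfolding omega_linear[OF eq lin] defect_linear[OF eq lin] by (simp add: algebra_simps power_mult_distrib)
  then show ?thesis unfolding area_density_omega by (simp add: abs_mult real_sqrt_mult)
qed

section \<open>Integrals in Euclidean space\<close>

lemma set_integrable_continuous_compact:
  fixes f :: "'a::euclidean_space \<Rightarrow> real"
  assumes "compact C" "continuous_on C f" "B \<in> sets borel" "B \<subseteq> C"
  shows "set_integrable lborel B f"
  using borel_integrable_compact[OF assms(1,2)] assms(3,4)
  by (intro set_integrable_subset[of lborel C f B]) (simp_all add: set_integrable_def)

text \<open>The domain of integration is an arbitrary Borel piece, as in the definition of area. By the mean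
  value theorem and uniform continuity on the compact set the difference quotients converge uniformly,
  and the piece has finite measure.\<close>

lemma has_derivative_under_integral:
  fixes f f' :: "real \<Rightarrow> 'a::euclidean_space \<Rightarrow> real"
  assumes C: "compact C" and B: "B \<in> sets borel" "B \<subseteq> C" and \<delta>: "0 < \<delta>"
    and der: "\<And>t u. \<bar>t\<bar> \<le> \<delta> \<Longrightarrow> u \<in> C \<Longrightarrow> ((\<lambda>t. f t u) has_real_derivative f' t u) (at t)"
    and cont: "\<And>t. \<bar>t\<bar> \<le> \<delta> \<Longrightarrow> continuous_on C (f t)"
    and cont': "continuous_on ({-\<delta>..\<delta>} \<times> C) (\<lambda>(t, u). f' t u)"
  shows "((\<lambda>t. LINT u:B|lborel. f t u) has_real_derivative (LINT u:B|lborel. f' 0 u)) (at 0)"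
  unfolding has_field_derivative_def has_derivative_at_alt
proof (intro conjI allI impI)
  show "bounded_linear ((*) (LINT u:B|lborel. f' 0 u))" by (rule bounded_linear_mult_right)
  fix e :: real assume e: "0 < e"
  define m where "m = measure lborel C + 1"
  have m: "0 < m" by (simp add: m_def add_nonneg_pos)
  define e' where "e' = e / m"
  have e': "0 < e'" using e m by (simp add: e'_def)
  have "uniformly_continuous_on ({-\<delta>..\<delta>} \<times> C) (\<lambda>(t, u). f' t u)"
    by (rule compact_uniformly_continuous[OF cont']) (intro compact_Times compact_Icc C)
  then obtain d where d: "0 < d" and dd: "\<And>x x'. x \<in> {-\<delta>..\<delta>} \<times> C \<Longrightarrow> x' \<in> {-\<delta>..\<delta>} \<times> C \<Longrightarrow> dist x' x < d \<Longrightarrow>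
      dist ((\<lambda>(t, u). f' t u) x') ((\<lambda>(t, u). f' t u) x) < e'"
    unfolding uniformly_continuous_on_def using e' by meson
  have near: "\<bar>f' t u - f' 0 u\<bar> \<le> e'" if "\<bar>t\<bar> < d" "\<bar>t\<bar> \<le> \<delta>" "u \<in> C" for t u
  proof -
    have "dist (f' t u) (f' 0 u) < e'"
      using dd[of "(0, u)" "(t, u)"] that \<delta> by (simp add: dist_Pair_Pair abs_le_iff)
    then show ?thesis by (simp add: dist_real_def)
  qed
  have int0: "set_integrable lborel B (f' 0)"
  proof (rule set_integrable_continuous_compact[OF C _ B])
    have "continuous_on C ((\<lambda>(t, u). f' t u) \<circ> (\<lambda>u. (0, u)))"
      by (intro continuous_on_compose continuous_intros continuous_on_subset[OF cont']) (use \<delta> in auto)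
    then show "continuous_on C (f' 0)" by (simp add: o_def)
  qed
  have int: "set_integrable lborel B (f t)" if "\<bar>t\<bar> \<le> \<delta>" for t
    by (rule set_integrable_continuous_compact[OF C cont[OF that] B])
  have pt: "\<bar>f t u - f 0 u - f' 0 u * t\<bar> \<le> e' * \<bar>t\<bar>" if t: "\<bar>t\<bar> < min d \<delta>" and u: "u \<in> C" for t u
  proof -
    have "\<exists>\<xi>. \<bar>\<xi>\<bar> \<le> \<bar>t\<bar> \<and> f t u - f 0 u = t * f' \<xi> u"
    proof (cases t "0::real" rule: linorder_cases)
      case less
      have "\<exists>\<xi>>t. \<xi> < 0 \<and> f 0 u - f t u = (0 - t) * f' \<xi> u"
        by (rule MVT2[OF less]) (use t u in \<open>auto intro!: der\<close>)
      then obtain \<xi> where "t < \<xi>" "\<xi> < 0" "f 0 u - f t u = (0 - t) * f' \<xi> u" by blast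
      then show ?thesis by (intro exI[of _ \<xi>]) (auto simp: algebra_simps)
    next
      case greater
      have "\<exists>\<xi>>0. \<xi> < t \<and> f t u - f 0 u = (t - 0) * f' \<xi> u"
        by (rule MVT2[OF greater]) (use t u in \<open>auto intro!: der\<close>)
      then show ?thesis by (metis abs_of_pos diff_0_right greater less_imp_le)
    qed auto
    then obtain \<xi> where \<xi>: "\<bar>\<xi>\<bar> \<le> \<bar>t\<bar>" "f t u - f 0 u = t * f' \<xi> u" by blast
    have "f t u - f 0 u - f' 0 u * t = (f' \<xi> u - f' 0 u) * t" using \<xi>(2) by (simp add: algebra_simps)
    moreover have "\<bar>f' \<xi> u - f' 0 u\<bar> \<le> e'" using near[of \<xi> u] \<xi>(1) t u by auto
    ultimately show ?thesis by (simp add: abs_mult mult_right_mono)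
  qed
  have main: "\<bar>(LINT u:B|lborel. f t u) - (LINT u:B|lborel. f 0 u) - (LINT u:B|lborel. f' 0 u) * t\<bar> \<le> e * \<bar>t\<bar>"
    if t: "\<bar>t\<bar> < min d \<delta>" for t
  proof -
    have i1: "set_integrable lborel B (\<lambda>u. f t u - f 0 u)"
      by (rule set_integral_diff(1)[OF int int]) (use t \<delta> in auto)
    have i2: "set_integrable lborel B (\<lambda>u. f t u - f 0 u - f' 0 u * t)"
      by (rule set_integral_diff(1)[OF i1 set_integrable_mult_left]) (rule int0)
    have iC: "set_integrable lborel B (\<lambda>u. e' * \<bar>t\<bar>)"
      by (rule set_integrable_continuous_compact[OF C _ B]) simp
    have "(LINT u:B|lborel. f t u) - (LINT u:B|lborel. f 0 u) - (LINT u:B|lborel. f' 0 u) * t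
      = (LINT u:B|lborel. f t u - f 0 u - f' 0 u * t)"
      using t \<delta> int0 by (simp add: set_integral_diff(2)[OF i1 set_integrable_mult_left] set_integral_diff(2)[OF int int])
    also have "\<bar>\<dots>\<bar> \<le> (LINT u:B|lborel. \<bar>f t u - f 0 u - f' 0 u * t\<bar>)"
      using set_integral_norm_bound[OF i2] by simp
    also have "\<dots> \<le> (LINT u:B|lborel. e' * \<bar>t\<bar>)"
      by (rule set_integral_mono[OF set_integrable_abs[OF i2] iC]) (use pt t B(2) in blast)
    also have "\<dots> = measure lborel B * (e' * \<bar>t\<bar>)"
      using B(1) by (simp add: set_lebesgue_integral_def)
    also have "\<dots> \<le> m * (e' * \<bar>t\<bar>)"
    proof (rule mult_right_mono)
      have "measure lborel B \<le> measure lborel C"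
        using B C by (intro measure_mono_fmeasurable) (auto simp: fmeasurable_compact compact_imp_closed)
      then show "measure lborel B \<le> m" by (simp add: m_def)
    qed (use e' in simp)
    also have "\<dots> = e * \<bar>t\<bar>" using m by (simp add: e'_def)
    finally show ?thesis .
  qed
  show "\<exists>d>0. \<forall>y. norm (y - 0) < d \<longrightarrow>
      norm ((LINT u:B|lborel. f y u) - (LINT u:B|lborel. f 0 u) - (LINT u:B|lborel. f' 0 u) * (y - 0)) \<le> e * norm (y - 0)"
    by (intro exI[of _ "min d \<delta>"]) (use d \<delta> main in auto)
qed

text \<open>Extended by zero, \<open>\<beta>\<close> has an integral that is invariant under translation by \<open>t v\<close>.
  Differentiating at \<open>t = 0\<close> under the integral gives the claim without splitting the integral into
  iterated ones.\<close>

lemma integral_derivative_compact_support: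
  fixes \<beta> :: "'a::euclidean_space \<Rightarrow> real"
  assumes O: "open O'" and Q: "compact Q" "Q \<subseteq> O'" and \<beta>: "Ck_on (Suc 0) \<beta> O'"
    and supp: "\<And>u. u \<in> O' - Q \<Longrightarrow> \<beta> u = 0"
  shows "(LINT u:Q|lborel. ddir \<beta> u v) = 0"
proof -
  define b where "b u = (if u \<in> O' then \<beta> u else 0)" for u
  have oQ: "open (- Q)" using Q(1) by (simp add: compact_imp_closed open_Compl)
  have z: "b u = 0" if "u \<in> - Q" for u using that supp by (auto simp: b_def)
  have bO: "Ck_on (Suc 0) b O'"
    using \<beta> Ck_on_cong[OF O, of b \<beta>] by (simp add: b_def)
  have bQ: "Ck_on (Suc 0) b (- Q)"
    using Ck_on_cong[OF oQ, of b "\<lambda>u. 0", OF z] C1_const by blast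
  have b1: "Ck_on (Suc 0) b UNIV"
  proof (rule Ck_on_local)
    fix u :: 'a
    show "\<exists>V. open V \<and> u \<in> V \<and> Ck_on (Suc 0) b V"
      using O oQ bO bQ Q(2) by (cases "u \<in> O'") blast+
  qed
  have dz: "ddir b u v = 0" if "u \<in> - Q" for u
  proof -
    have "frechet_derivative b (at u) = frechet_derivative (\<lambda>u. 0) (at u)"
      by (rule ddir_cong[OF oQ that z])
    then show ?thesis by simp
  qed
  obtain R where R: "\<And>u. u \<in> Q \<Longrightarrow> norm u \<le> R" using compact_imp_bounded[OF Q(1)] unfolding bounded_iff by blast
  \<comment> \<open>large enough to contain the support of every translate by \<open>t v\<close> with \<open>\<bar>t\<bar> < 1\<close>\<close>
  define C where "C = cball (0::'a) (R + norm v)"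
  have C: "compact C" "C \<in> sets borel" by (simp_all add: C_def)
  have "((\<lambda>t. LINT u:C|lborel. b (u + t *\<^sub>R v)) has_real_derivative (LINT u:C|lborel. ddir b (u + 0 *\<^sub>R v) v)) (at 0)"
  proof (rule has_derivative_under_integral[OF C(1) C(2) subset_refl, of 1])
    fix t :: real and u
    have D: "(b has_derivative frechet_derivative b (at (u + t *\<^sub>R v))) (at (u + t *\<^sub>R v))"
      using Ck_on_has_derivative[OF b1] by simp
    have "((\<lambda>t. b (u + t *\<^sub>R v)) has_derivative (\<lambda>h. frechet_derivative b (at (u + t *\<^sub>R v)) (h *\<^sub>R v))) (at t)"
      by (rule has_derivative_compose[where f="\<lambda>t. u + t *\<^sub>R v", OF _ D]) (auto intro!: derivative_eq_intros)
    then show "((\<lambda>t. b (u + t *\<^sub>R v)) has_real_derivative ddir b (u + t *\<^sub>R v) v) (at t)"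
      unfolding has_field_derivative_def
      by (simp add: linear_cmul[OF has_derivative_linear[OF D]] mult_commute_abs)
  next
    have c: "continuous_on UNIV b" by (rule Ck_on_continuous[OF b1])
    show "continuous_on C (\<lambda>u. b (u + t *\<^sub>R v))" for t
      by (rule continuous_on_compose2[OF c]) (auto intro!: continuous_intros)
    have c': "continuous_on UNIV (\<lambda>u. ddir b u v)" using b1 by simp
    have "continuous_on ({-1..1} \<times> C) (\<lambda>p. ddir b (snd p + fst p *\<^sub>R v) v)"
      by (rule continuous_on_compose2[OF c']) (auto intro!: continuous_intros)
    then show "continuous_on ({-1..1} \<times> C) (\<lambda>(t, u). ddir b (u + t *\<^sub>R v) v)"
      by (simp add: case_prod_unfold)
  qed simp
  moreover have const: "(LINT u:C|lborel. b (u + t *\<^sub>R v)) = (LINT u|lborel. b u)" if "\<bar>t\<bar> < 1" for t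
  proof -
    have "b (u + t *\<^sub>R v) = indicator C u *\<^sub>R b (u + t *\<^sub>R v)" for u
    proof (cases "u \<in> C")
      case False
      have "norm u \<le> norm (u + t *\<^sub>R v) + norm (t *\<^sub>R v)" using norm_triangle_ineq4[of "u + t *\<^sub>R v" "t *\<^sub>R v"] by simp
      also have "norm (t *\<^sub>R v) \<le> 1 * norm v" unfolding norm_scaleR
          using that by (intro mult_right_mono) simp_all
      finally have "u + t *\<^sub>R v \<notin> Q" using False R[of "u + t *\<^sub>R v"] by (auto simp: C_def)
      then show ?thesis using z by simp
    qed simp
    then have "(LINT u:C|lborel. b (u + t *\<^sub>R v)) = (LINT u|lborel. b (u + t *\<^sub>R v))"
      unfolding set_lebesgue_integral_def by (intro Bochner_Integration.integral_cong) simp_all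
    also have "\<dots> = (LINT u|lborel. b (t *\<^sub>R v + u))" by (simp add: add.commute)
    also have "\<dots> = (LINT u|distr lborel borel ((+) (t *\<^sub>R v)). b u)"
      using borel_measurable_continuous_onI[OF Ck_on_continuous[OF b1]]
      by (subst integral_distr) simp_all
    finally show ?thesis by (simp add: lborel_distr_plus)
  qed
  have "((\<lambda>t. LINT u:C|lborel. b (u + t *\<^sub>R v)) has_real_derivative 0) (at 0)"
    by (rule has_field_derivative_transform_within[of "\<lambda>t. LINT u|lborel. b u" _ _ _ 1])
       (auto simp: const dist_real_def)
  ultimately have "(LINT u:C|lborel. ddir b u v) = 0"
    using DERIV_unique by fastforce
  moreover have "(LINT u:C|lborel. ddir b u v) = (LINT u:Q|lborel. ddir \<beta> u v)"
    unfolding set_lebesgue_integral_def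
  proof (rule Bochner_Integration.integral_cong[OF refl])
    fix u
    show "indicat_real C u *\<^sub>R ddir b u v = indicat_real Q u *\<^sub>R ddir \<beta> u v"
    proof (cases "u \<in> Q")
      case True
      have "u \<in> C" using R[OF True] norm_ge_zero[of v] by (simp add: C_def add_increasing2)
      moreover have "frechet_derivative b (at u) = frechet_derivative \<beta> (at u)"
        by (rule ddir_cong[OF O]) (use True Q in \<open>auto simp: b_def\<close>)
      ultimately show ?thesis using True by simp
    next
      case False
      then show ?thesis using dz by simp
    qed
  qed
  ultimately show ?thesis by simp
qed

lemma change_of_variables_set_integral:
  fixes r s :: "real ^ 'n::{finite, wellorder} \<Rightarrow> real" and \<phi> :: "real ^ 'n::_ \<Rightarrow> real ^ 'n::_"
  assumes B: "B \<in> sets borel" "\<phi> ` B \<in> sets borel" and inj: "inj_on \<phi> B"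
    and \<phi>: "\<And>u. u \<in> B \<Longrightarrow> (\<phi> has_derivative \<phi>' u) (at u)"
    and r: "(\<lambda>u. indicator (\<phi> ` B) u *\<^sub>R r u) \<in> borel_measurable borel"
    and s: "(\<lambda>u. indicator B u *\<^sub>R s u) \<in> borel_measurable borel"
    and eq: "\<And>u. u \<in> B \<Longrightarrow> s u = \<bar>det (matrix (\<phi>' u))\<bar> * r (\<phi> u)"
  shows "set_integrable lborel B s \<longleftrightarrow> set_integrable lborel (\<phi> ` B) r"
    and "(LINT u:B|lborel. s u) = (LINT u:\<phi> ` B|lborel. r u)"
proof -
  let ?v = "\<lambda>x. vec x :: real ^ 1"
  have main: "(\<lambda>x. \<bar>det (matrix (\<phi>' x))\<bar> *\<^sub>R ?v (r (\<phi> x))) absolutely_integrable_on B \<and>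
           integral B (\<lambda>x. \<bar>det (matrix (\<phi>' x))\<bar> *\<^sub>R ?v (r (\<phi> x))) = b
     \<longleftrightarrow> (\<lambda>x. ?v (r x)) absolutely_integrable_on (\<phi> ` B) \<and> integral (\<phi> ` B) (\<lambda>x. ?v (r x)) = b" for b
  proof (rule has_absolute_integral_change_of_variables[OF _ _ inj])
    show "B \<in> sets lebesgue" using B by simp
    show "(\<phi> has_derivative \<phi>' u) (at u within B)" if "u \<in> B" for u
      by (rule has_derivative_at_withinI[OF \<phi>[OF that]])
  qed
  have e1: "(\<lambda>x. \<bar>det (matrix (\<phi>' x))\<bar> *\<^sub>R ?v (r (\<phi> x))) absolutely_integrable_on B \<longleftrightarrow> s absolutely_integrable_on B"
    unfolding absolutely_integrable_on_1_iff by (rule set_integrable_cong) (simp_all add: eq)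
  have e2: "integral B (\<lambda>x. \<bar>det (matrix (\<phi>' x))\<bar> *\<^sub>R ?v (r (\<phi> x))) = ?v (integral B s)"
    unfolding integral_on_1_eq by (rule arg_cong[where f = vec], rule integral_cong) (simp add: eq)
  have e3: "(\<lambda>x. ?v (r x)) absolutely_integrable_on (\<phi> ` B) \<longleftrightarrow> r absolutely_integrable_on (\<phi> ` B)"
    unfolding absolutely_integrable_on_1_iff by simp
  have e4: "integral (\<phi> ` B) (\<lambda>x. ?v (r x)) = ?v (integral (\<phi> ` B) r)"
    unfolding integral_on_1_eq by simp
  have vec_inj: "?v x = ?v y \<longleftrightarrow> x = y" for x y by (simp add: vec_eq_iff)
  have *: "s absolutely_integrable_on B \<and> integral B s = b
     \<longleftrightarrow> r absolutely_integrable_on (\<phi> ` B) \<and> integral (\<phi> ` B) r = b" for b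
    using main[of "?v b"] unfolding e1 e2 e3 e4 vec_inj .
  have 1: "set_integrable lborel B s \<longleftrightarrow> s absolutely_integrable_on B"
    unfolding set_integrable_def by (rule integrable_completion[symmetric]) (use s in simp)
  have 2: "set_integrable lborel (\<phi> ` B) r \<longleftrightarrow> r absolutely_integrable_on (\<phi> ` B)"
    unfolding set_integrable_def by (rule integrable_completion[symmetric]) (use r in simp)
  show iff: "set_integrable lborel B s \<longleftrightarrow> set_integrable lborel (\<phi> ` B) r"
    unfolding 1 2 using * by blast
  show "(LINT u:B|lborel. s u) = (LINT u:\<phi> ` B|lborel. r u)"
  proof (cases "set_integrable lborel B s")
    case True
    then have ai: "s absolutely_integrable_on B" "r absolutely_integrable_on (\<phi> ` B)" using iff 1 2 by auto
    have "(LINT u:B|lborel. s u) = (LINT u:B|lebesgue. s u)"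
      unfolding set_lebesgue_integral_def by (rule integral_completion[symmetric]) (use s in simp)
    also have "\<dots> = integral B s" by (rule set_lebesgue_integral_eq_integral(2)[OF ai(1)])
    also have "\<dots> = integral (\<phi> ` B) r" using * ai by blast
    also have "\<dots> = (LINT u:\<phi> ` B|lebesgue. r u)" by (rule set_lebesgue_integral_eq_integral(2)[OF ai(2), symmetric])
    also have "\<dots> = (LINT u:\<phi> ` B|lborel. r u)"
      unfolding set_lebesgue_integral_def by (rule integral_completion) (use r in simp)
    finally show ?thesis .
  next
    case False
    with iff show ?thesis
      unfolding set_integrable_def set_lebesgue_integral_def by (simp add: not_integrable_integral_eq)
  qed
qed

text \<open>A nonnegative integrand that is not integrable has integral \<open>\<infinity>\<close>, so the equivalence of
  integrability on both sides covers the case of infinite area.\<close>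

lemma change_of_variables_nn_integral:
  fixes r s :: "real ^ 'n::{finite, wellorder} \<Rightarrow> real" and \<phi> :: "real ^ 'n::_ \<Rightarrow> real ^ 'n::_"
  assumes B: "B \<in> sets borel" "\<phi> ` B \<in> sets borel" and inj: "inj_on \<phi> B"
    and \<phi>: "\<And>u. u \<in> B \<Longrightarrow> (\<phi> has_derivative \<phi>' u) (at u)"
    and r: "(\<lambda>u. indicator (\<phi> ` B) u *\<^sub>R r u) \<in> borel_measurable borel"
    and s: "(\<lambda>u. indicator B u *\<^sub>R s u) \<in> borel_measurable borel"
    and eq: "\<And>u. u \<in> B \<Longrightarrow> s u = \<bar>det (matrix (\<phi>' u))\<bar> * r (\<phi> u)"
    and r0: "\<And>u. u \<in> \<phi> ` B \<Longrightarrow> 0 \<le> r u"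
  shows "(\<integral>\<^sup>+u\<in>B. ennreal (s u) \<partial>lborel) = (\<integral>\<^sup>+u\<in>\<phi> ` B. ennreal (r u) \<partial>lborel)"
proof -
  have cov1: "set_integrable lborel B s \<longleftrightarrow> set_integrable lborel (\<phi> ` B) r"
    by (rule change_of_variables_set_integral(1)[where \<phi>' = \<phi>']) fact+
  have cov2: "(LINT u:B|lborel. s u) = (LINT u:\<phi> ` B|lborel. r u)"
    by (rule change_of_variables_set_integral(2)[where \<phi>' = \<phi>']) fact+
  have s0: "0 \<le> s u" if "u \<in> B" for u using eq[OF that] r0 that by simp
  have gen: "(\<integral>\<^sup>+u\<in>X. ennreal (h u) \<partial>lborel) =
       (if set_integrable lborel X h then ennreal (LINT u:X|lborel. h u) else \<infinity>)"
    if X: "\<And>u. u \<in> X \<Longrightarrow> 0 \<le> h u" and m: "(\<lambda>u. indicator X u *\<^sub>R h u) \<in> borel_measurable borel"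
    for X and h :: "real ^ 'n::_ \<Rightarrow> real"
  proof -
    have 1: "(\<integral>\<^sup>+u\<in>X. ennreal (h u) \<partial>lborel) = (\<integral>\<^sup>+u. ennreal (indicator X u *\<^sub>R h u) \<partial>lborel)"
      by (rule nn_integral_cong) (simp split: split_indicator)
    have nn: "0 \<le> indicator X u *\<^sub>R h u" for u using X by (simp split: split_indicator)
    show ?thesis
    proof (cases "set_integrable lborel X h")
      case True
      then show ?thesis unfolding 1 set_lebesgue_integral_def using nn
        by (subst nn_integral_eq_integral) (auto simp: set_integrable_def)
    next
      case False
      then have "\<not> (\<integral>\<^sup>+u. ennreal (indicator X u *\<^sub>R h u) \<partial>lborel) < \<infinity>"
        using m nn unfolding set_integrable_def by (subst (asm) integrable_iff_bounded) simp
      then have "(\<integral>\<^sup>+u. ennreal (indicator X u *\<^sub>R h u) \<partial>lborel) = \<infinity>"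
        using top.not_eq_extremum[where 'a = ennreal] by (auto simp: infinity_ennreal_def)
      with False show ?thesis unfolding 1 by simp
    qed
  qed
  have "(\<integral>\<^sup>+u\<in>B. ennreal (s u) \<partial>lborel) =
       (if set_integrable lborel B s then ennreal (LINT u:B|lborel. s u) else \<infinity>)"
    by (rule gen[OF s0 s])
  also have "\<dots> = (if set_integrable lborel (\<phi> ` B) r then ennreal (LINT u:\<phi> ` B|lborel. r u) else \<infinity>)"
    by (simp only: cov1 cov2)
  also have "\<dots> = (\<integral>\<^sup>+u\<in>\<phi> ` B. ennreal (r u) \<partial>lborel)"
    by (rule gen[OF r0 r, symmetric])
  finally show ?thesis .
qed

section \<open>Densities on a surface\<close>

abbreviation cinv :: "'m chart \<Rightarrow> real ^ 2 \<Rightarrow> 'm" where "cinv c \<equiv> inv_into (fst c) (snd c)"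
abbreviation cimg :: "'m chart \<Rightarrow> (real ^ 2) set" where "cimg c \<equiv> snd c ` fst c"
abbreviation transition :: "'m chart \<Rightarrow> 'm chart \<Rightarrow> real ^ 2 \<Rightarrow> real ^ 2" where
  "transition c d \<equiv> snd d \<circ> cinv c"
abbreviation jacobian :: "'m chart \<Rightarrow> 'm chart \<Rightarrow> real ^ 2 \<Rightarrow> real ^ 2 \<Rightarrow> real ^ 2" where
  "jacobian c d u \<equiv> frechet_derivative (transition c d) (at u)"

locale surface =
  fixes S :: "'m::{t2_space, second_countable_topology} set" and A :: "'m chart set"
  assumes smooth: "smooth_surface S A"
begin

lemma chart_props:
  assumes "c \<in> A"
  shows chart_open: "openin (top_of_set S) (fst c)" and cimg_open: "open (cimg c)"
    and chart_homeo: "homeomorphism (fst c) (cimg c) (snd c) (cinv c)"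
proof -
  have "\<forall>c\<in>A. openin (top_of_set S) (fst c) \<and> open (cimg c) \<and> homeomorphism (fst c) (cimg c) (snd c) (cinv c)"
    using smooth unfolding smooth_surface_def by (simp add: case_prod_unfold)
  from bspec[OF this assms]
  show "openin (top_of_set S) (fst c)" "open (cimg c)" "homeomorphism (fst c) (cimg c) (snd c) (cinv c)"
    by simp_all
qed

lemma chart_cover: "p \<in> S \<Longrightarrow> \<exists>c\<in>A. p \<in> fst c"
proof -
  have "(\<Union>c\<in>A. fst c) = S" using smooth unfolding smooth_surface_def by (simp add: case_prod_unfold)
  then show "p \<in> S \<Longrightarrow> \<exists>c\<in>A. p \<in> fst c" by blast
qed

lemma chart_subset: "c \<in> A \<Longrightarrow> fst c \<subseteq> S"
  by (rule openin_imp_subset[OF chart_open])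

lemma cinv_chart: "c \<in> A \<Longrightarrow> p \<in> fst c \<Longrightarrow> cinv c (snd c p) = p"
  by (rule homeomorphism_apply1[OF chart_homeo])

lemma inj_chart: "c \<in> A \<Longrightarrow> inj_on (snd c) (fst c)"
  by (rule inj_on_inverseI[of _ "cinv c"]) (rule cinv_chart)

lemma chart_cinv: "u \<in> cimg c \<Longrightarrow> snd c (cinv c u) = u"
  by (simp add: f_inv_into_f)

lemma cinv_in: "u \<in> cimg c \<Longrightarrow> cinv c u \<in> fst c"
  by (simp add: inv_into_into)

lemma transition_smooth:
  assumes "c \<in> A" "d \<in> A"
  shows "Ck_on k (transition c d) (snd c ` (fst c \<inter> fst d))"
proof -
  have "\<forall>c\<in>A. \<forall>d\<in>A. smooth_on (snd d \<circ> cinv c) (snd c ` (fst c \<inter> fst d))"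
    using smooth unfolding smooth_surface_def by (simp add: case_prod_unfold)
  with assms show ?thesis by (simp add: smooth_on_def)
qed

lemma open_chart_preimage:
  assumes c: "c \<in> A" and W: "openin (top_of_set S) W"
  shows "open {u \<in> cimg c. cinv c u \<in> W}"
proof -
  obtain T where T: "open T" "W = S \<inter> T" using W by (auto simp: openin_open)
  have "continuous_on (cimg c) (cinv c)" using homeomorphism_cont2[OF chart_homeo[OF c]] .
  then have "open (cimg c \<inter> cinv c -` T)"
    by (rule continuous_open_preimage[OF _ cimg_open[OF c] T(1)])
  moreover have "{u \<in> cimg c. cinv c u \<in> W} = cimg c \<inter> cinv c -` T"
  proof -
    have "cinv c u \<in> S" if "u \<in> cimg c" for u using cinv_in[OF that] chart_subset[OF c] by blast
    then show ?thesis unfolding T(2) by auto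
  qed
  ultimately show ?thesis by simp
qed

lemma chart_image_eq:
  assumes "c \<in> A" "X \<subseteq> fst c"
  shows "snd c ` X = {u \<in> cimg c. cinv c u \<in> X}"
proof -
  have "u \<in> snd c ` X" if "u \<in> cimg c" "cinv c u \<in> X" for u
    using imageI[OF that(2), of "snd c"] chart_cinv[OF that(1)] by simp
  moreover have "snd c p \<in> cimg c \<and> cinv c (snd c p) \<in> X" if "p \<in> X" for p
    using that assms(2) cinv_chart[OF assms(1), of p] by auto
  ultimately show ?thesis by blast
qed

lemma open_overlap:
  assumes "c \<in> A" "d \<in> A"
  shows "open (snd c ` (fst c \<inter> fst d))"
proof -
  have "snd c ` (fst c \<inter> fst d) = {u \<in> cimg c. cinv c u \<in> fst d}"
    unfolding chart_image_eq[OF assms(1) Int_lower1] using cinv_in[of _ c] by blast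
  then show ?thesis using open_chart_preimage[OF assms(1) chart_open[OF assms(2)]] by simp
qed

lemma transition_has_derivative:
  assumes "c \<in> A" "d \<in> A" "p \<in> fst c" "p \<in> fst d"
  shows "(transition c d has_derivative jacobian c d (snd c p)) (at (snd c p))"
  by (rule Ck_on_has_derivative[OF transition_smooth[OF assms(1,2), of "Suc 0"]]) (use assms in blast)

lemma borel_chart_image:
  assumes c: "c \<in> A" and X: "X \<in> sets borel" "X \<subseteq> fst c"
  shows "snd c ` X \<in> sets borel"
proof -
  have "cinv c \<in> borel_measurable (restrict_space borel (cimg c))"
    by (rule borel_measurable_continuous_on_restrict[OF homeomorphism_cont2[OF chart_homeo[OF c]]])
  from measurable_sets[OF this X(1)]
  have "cinv c -` X \<inter> cimg c \<in> sets (restrict_space borel (cimg c))"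
    by (simp add: space_restrict_space)
  moreover have "cimg c \<in> sets borel" using cimg_open[OF c] by simp
  ultimately have "cinv c -` X \<inter> cimg c \<in> sets borel"
    by (subst (asm) sets_restrict_space_iff) auto
  moreover have "snd c ` X = cinv c -` X \<inter> cimg c" using chart_image_eq[OF c X(2)] by blast
  ultimately show ?thesis by simp
qed

text \<open>A density is given by one function for each chart, such that the integral over a small piece
  of the surface is the same in all charts that contain it. The area density is one, and so is its
  time derivative; without an orientation, two-forms are not.\<close>

definition is_density :: "('m chart \<Rightarrow> real ^ 2 \<Rightarrow> real) \<Rightarrow> bool" where
  "is_density r \<longleftrightarrow> (\<forall>c\<in>A. continuous_on (cimg c) (r c)) \<and>
     (\<forall>c\<in>A. \<forall>d\<in>A. \<forall>p\<in>fst c \<inter> fst d.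
        r c (snd c p) = \<bar>det (matrix (jacobian c d (snd c p)))\<bar> * r d (snd d p))"

lemma density_transfer:
  assumes r: "is_density r" and c: "c \<in> A" "d \<in> A"
    and X: "X \<in> sets borel" "X \<subseteq> fst c" "X \<subseteq> fst d"
  shows density_integrable_iff:
      "set_integrable lborel (snd c ` X) (r c) \<longleftrightarrow> set_integrable lborel (snd d ` X) (r d)"
    and density_integral_eq: "(LINT u:snd c ` X|lborel. r c u) = (LINT u:snd d ` X|lborel. r d u)"
    and density_nn_integral_eq: "(\<And>u. u \<in> cimg d \<Longrightarrow> 0 \<le> r d u) \<Longrightarrow>
      (\<integral>\<^sup>+u\<in>snd c ` X. ennreal (r c u) \<partial>lborel) = (\<integral>\<^sup>+u\<in>snd d ` X. ennreal (r d u) \<partial>lborel)"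
proof -
  let ?\<phi> = "transition c d"
  have im: "?\<phi> ` (snd c ` X) = snd d ` X"
    unfolding image_image by (rule image_cong[OF refl]) (use X cinv_chart[OF c(1)] in auto)
  have B: "snd c ` X \<in> sets borel" "?\<phi> ` snd c ` X \<in> sets borel"
    unfolding im using borel_chart_image c X by blast+
  have inj: "inj_on ?\<phi> (snd c ` X)"
  proof (rule inj_onI)
    fix u v assume "u \<in> snd c ` X" "v \<in> snd c ` X" and e: "?\<phi> u = ?\<phi> v"
    then obtain p q where pq: "p \<in> X" "u = snd c p" "q \<in> X" "v = snd c q" by blast
    have "p \<in> fst c" "q \<in> fst c" using pq X(2) by auto
    then have "snd d p = snd d q" using e pq cinv_chart[OF c(1)] by simp
    then have "p = q" using inj_onD[OF inj_chart[OF c(2)]] pq X(3) by blast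
    then show "u = v" using pq by simp
  qed
  have der: "(?\<phi> has_derivative jacobian c d u) (at u)" if "u \<in> snd c ` X" for u
    using that X transition_has_derivative[OF c] by blast
  have eq: "r c u = \<bar>det (matrix (jacobian c d u))\<bar> * r d (?\<phi> u)" if u: "u \<in> snd c ` X" for u
  proof -
    obtain p where p: "p \<in> X" "u = snd c p" using u by blast
    then have pcd: "p \<in> fst c \<inter> fst d" using X by blast
    then have "?\<phi> u = snd d p" using cinv_chart[OF c(1), of p] p by simp
    moreover have "r c (snd c p) = \<bar>det (matrix (jacobian c d (snd c p)))\<bar> * r d (snd d p)"
      using r c pcd unfolding is_density_def by blast
    ultimately show ?thesis using p by simp
  qed
  have meas: "(\<lambda>u. indicator (snd e ` X) u *\<^sub>R r e u) \<in> borel_measurable borel" if e: "e \<in> A" "X \<subseteq> fst e" for e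
  proof (rule borel_measurable_continuous_on_indicator)
    show "snd e ` X \<in> sets borel" using borel_chart_image e X by blast
    have "continuous_on (cimg e) (r e)" using r e unfolding is_density_def by blast
    then show "continuous_on (snd e ` X) (r e)" by (rule continuous_on_subset) (use e in blast)
  qed
  have m1: "(\<lambda>u. indicator (?\<phi> ` snd c ` X) u *\<^sub>R r d u) \<in> borel_measurable borel"
    unfolding im by (rule meas[OF c(2) X(3)])
  have m2: "(\<lambda>u. indicator (snd c ` X) u *\<^sub>R r c u) \<in> borel_measurable borel"
    by (rule meas[OF c(1) X(2)])
  show "set_integrable lborel (snd c ` X) (r c) \<longleftrightarrow> set_integrable lborel (snd d ` X) (r d)"
    unfolding im[symmetric]
    by (rule change_of_variables_set_integral(1)[where \<phi>' = "jacobian c d"]) (fact B inj der m1 m2 eq)+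
  show "(LINT u:snd c ` X|lborel. r c u) = (LINT u:snd d ` X|lborel. r d u)"
    unfolding im[symmetric]
    by (rule change_of_variables_set_integral(2)[where \<phi>' = "jacobian c d"]) (fact B inj der m1 m2 eq)+
  assume nn: "\<And>u. u \<in> cimg d \<Longrightarrow> 0 \<le> r d u"
  have nn': "0 \<le> r d u" if "u \<in> ?\<phi> ` snd c ` X" for u
    using that X(3) unfolding im by (intro nn) blast
  show "(\<integral>\<^sup>+u\<in>snd c ` X. ennreal (r c u) \<partial>lborel) = (\<integral>\<^sup>+u\<in>snd d ` X. ennreal (r d u) \<partial>lborel)"
    unfolding im[symmetric]
    by (rule change_of_variables_nn_integral[where \<phi>' = "jacobian c d"]) (fact B inj der m1 m2 eq nn')+
qed

definition pieces :: "'m set \<Rightarrow> 'm chart set \<Rightarrow> ('m chart \<Rightarrow> 'm set) \<Rightarrow> bool" where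
  "pieces K C B \<longleftrightarrow> finite C \<and> C \<subseteq> A \<and> disjoint_family_on B C \<and> (\<Union>c\<in>C. B c) = K \<and>
     (\<forall>c\<in>C. B c \<in> sets borel \<and> B c \<subseteq> fst c)"

lemma has_area_pieces:
  "has_area A G K a \<longleftrightarrow> (\<exists>C B. pieces K C B \<and>
     a = (\<Sum>c\<in>C. \<integral>\<^sup>+u\<in>snd c ` B c. ennreal (area_density (G \<circ> cinv c) u) \<partial>lborel))"
  unfolding has_area_def pieces_def by (simp add: case_prod_unfold conj_assoc)

lemma density_nn_integral_split:
  assumes r: "is_density r" and d: "d \<in> A"
    and X: "X \<in> sets borel" "X \<subseteq> fst d" and P: "pieces K C B" "X \<subseteq> K"
  shows "(\<integral>\<^sup>+u\<in>snd d ` X. ennreal (r d u) \<partial>lborel)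
       = (\<Sum>c\<in>C. \<integral>\<^sup>+u\<in>snd d ` (X \<inter> B c). ennreal (r d u) \<partial>lborel)"
proof -
  define h where "h u = ennreal (indicator (cimg d) u *\<^sub>R r d u)" for u
  have "continuous_on (cimg d) (r d)" using r d unfolding is_density_def by blast
  then have "(\<lambda>u. indicator (cimg d) u *\<^sub>R r d u) \<in> borel_measurable borel"
    by (intro borel_measurable_continuous_on_indicator) (use cimg_open[OF d] in simp_all)
  from measurable_compose[OF this measurable_ennreal]
  have h: "h \<in> borel_measurable lborel" unfolding h_def[abs_def] by simp
  have em: "emeasure (density lborel h) (snd d ` Y) = (\<integral>\<^sup>+u\<in>snd d ` Y. ennreal (r d u) \<partial>lborel)"
    if "Y \<in> sets borel" "Y \<subseteq> fst d" for Y
  proof -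
    have "emeasure (density lborel h) (snd d ` Y) = (\<integral>\<^sup>+u. h u * indicator (snd d ` Y) u \<partial>lborel)"
      by (rule emeasure_density[OF h]) (use borel_chart_image[OF d that] in simp)
    also have "\<dots> = (\<integral>\<^sup>+u\<in>snd d ` Y. ennreal (r d u) \<partial>lborel)"
      by (rule nn_integral_cong) (use that(2) in \<open>auto simp: h_def split: split_indicator\<close>)
    finally show ?thesis .
  qed
  have B: "X \<inter> B c \<in> sets borel" "X \<inter> B c \<subseteq> fst d" if "c \<in> C" for c
    using P X that unfolding pieces_def by auto
  have U: "snd d ` X = (\<Union>c\<in>C. snd d ` (X \<inter> B c))"
    using P unfolding pieces_def by blast
  have disj: "disjoint_family_on (\<lambda>c. snd d ` (X \<inter> B c)) C"
    unfolding disjoint_family_on_def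
  proof (intro ballI impI)
    fix a b assume "a \<in> C" "b \<in> C" "a \<noteq> b"
    then have "B a \<inter> B b = {}" using P unfolding pieces_def disjoint_family_on_def by blast
    then have "snd d ` ((X \<inter> B a) \<inter> (X \<inter> B b)) = {}" by blast
    moreover have "snd d ` ((X \<inter> B a) \<inter> (X \<inter> B b)) = snd d ` (X \<inter> B a) \<inter> snd d ` (X \<inter> B b)"
      by (rule inj_on_image_Int[OF inj_chart[OF d]]) (use X in auto)
    ultimately show "snd d ` (X \<inter> B a) \<inter> snd d ` (X \<inter> B b) = {}" by simp
  qed
  have "(\<integral>\<^sup>+u\<in>snd d ` X. ennreal (r d u) \<partial>lborel) = emeasure (density lborel h) (\<Union>c\<in>C. snd d ` (X \<inter> B c))"
    using em[OF X] U by simp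
  also have "\<dots> = (\<Sum>c\<in>C. emeasure (density lborel h) (snd d ` (X \<inter> B c)))"
    by (rule sum_emeasure[symmetric]) (use P B borel_chart_image[OF d] disj in \<open>auto simp: pieces_def\<close>)
  also have "\<dots> = (\<Sum>c\<in>C. \<integral>\<^sup>+u\<in>snd d ` (X \<inter> B c). ennreal (r d u) \<partial>lborel)"
    by (rule sum.cong[OF refl]) (rule em[OF B])
  finally show ?thesis .
qed

text \<open>Compare both decompositions with their common refinement, on which each piece may be moved
  from one chart to the other.\<close>

lemma density_pieces_independent:
  assumes r: "is_density r" "\<And>c u. c \<in> A \<Longrightarrow> u \<in> cimg c \<Longrightarrow> 0 \<le> r c u"
    and P: "pieces K C B" "pieces K C' B'"
  shows "(\<Sum>c\<in>C. \<integral>\<^sup>+u\<in>snd c ` B c. ennreal (r c u) \<partial>lborel)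
       = (\<Sum>d\<in>C'. \<integral>\<^sup>+u\<in>snd d ` B' d. ennreal (r d u) \<partial>lborel)"
proof -
  have CA: "c \<in> A" "B c \<in> sets borel" "B c \<subseteq> fst c" "B c \<subseteq> K" if "c \<in> C" for c
    using P(1) that unfolding pieces_def by blast+
  have DA: "c \<in> A" "B' c \<in> sets borel" "B' c \<subseteq> fst c" "B' c \<subseteq> K" if "c \<in> C'" for c
    using P(2) that unfolding pieces_def by blast+
  have "(\<Sum>c\<in>C. \<integral>\<^sup>+u\<in>snd c ` B c. ennreal (r c u) \<partial>lborel)
     = (\<Sum>c\<in>C. \<Sum>d\<in>C'. \<integral>\<^sup>+u\<in>snd c ` (B c \<inter> B' d). ennreal (r c u) \<partial>lborel)"
    by (rule sum.cong[OF refl], rule density_nn_integral_split[OF r(1) CA(1) CA(2) CA(3) P(2) CA(4)])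
  also have "\<dots> = (\<Sum>c\<in>C. \<Sum>d\<in>C'. \<integral>\<^sup>+u\<in>snd d ` (B' d \<inter> B c). ennreal (r d u) \<partial>lborel)"
  proof (intro sum.cong refl)
    fix c d assume cd: "c \<in> C" "d \<in> C'"
    show "(\<integral>\<^sup>+u\<in>snd c ` (B c \<inter> B' d). ennreal (r c u) \<partial>lborel) = (\<integral>\<^sup>+u\<in>snd d ` (B' d \<inter> B c). ennreal (r d u) \<partial>lborel)"
      unfolding Int_commute[of "B' d"]
    proof (rule density_nn_integral_eq[OF r(1) CA(1)[OF cd(1)] DA(1)[OF cd(2)]])
      show "B c \<inter> B' d \<in> sets borel" using CA(2)[OF cd(1)] DA(2)[OF cd(2)] by (rule sets.Int)
      show "B c \<inter> B' d \<subseteq> fst c" "B c \<inter> B' d \<subseteq> fst d" using CA(3)[OF cd(1)] DA(3)[OF cd(2)] by auto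
      show "0 \<le> r d u" if "u \<in> cimg d" for u by (rule r(2)[OF DA(1)[OF cd(2)] that])
    qed
  qed
  also have "\<dots> = (\<Sum>d\<in>C'. \<Sum>c\<in>C. \<integral>\<^sup>+u\<in>snd d ` (B' d \<inter> B c). ennreal (r d u) \<partial>lborel)"
    by (rule sum.swap)
  also have "\<dots> = (\<Sum>d\<in>C'. \<integral>\<^sup>+u\<in>snd d ` B' d. ennreal (r d u) \<partial>lborel)"
    by (rule sum.cong[OF refl],
        rule density_nn_integral_split[OF r(1) DA(1) DA(2) DA(3) P(1) DA(4), symmetric])
  finally show ?thesis .
qed

text \<open>The triples consist of a chart and the centre and radius of a disc in its image. The same cover
  serves to cut \<open>K\<close> into pieces with compact closure in a chart and to build a partition of unity.\<close>

lemma finite_ball_cover: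
  assumes K: "compact K" "K \<subseteq> S"
  obtains I where "finite I"
    "\<And>c w \<rho>. (c, w, \<rho>) \<in> I \<Longrightarrow> c \<in> A \<and> 0 < \<rho> \<and> cball w \<rho> \<subseteq> cimg c"
    "K \<subseteq> (\<Union>(c, w, \<rho>)\<in>I. {p \<in> fst c. snd c p \<in> ball w \<rho>})"
proof -
  define J :: "('m chart \<times> (real ^ 2) \<times> real) set" where "J = {(c, w, \<rho>). c \<in> A \<and> 0 < \<rho> \<and> cball w \<rho> \<subseteq> cimg c}"
  define V :: "'m chart \<times> (real ^ 2) \<times> real \<Rightarrow> 'm set" where "V = (\<lambda>(c, w, \<rho>). {p \<in> fst c. snd c p \<in> ball w \<rho>})"
  have "\<exists>T. open T \<and> V i = S \<inter> T" if "i \<in> J" for i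
  proof -
    obtain c w \<rho> where i: "i = (c, w, \<rho>)" "c \<in> A" using \<open>i \<in> J\<close> by (auto simp: J_def)
    have "openin (top_of_set (fst c)) (fst c \<inter> snd c -` ball w \<rho>)"
      by (rule continuous_openin_preimage_gen[OF homeomorphism_cont1[OF chart_homeo[OF i(2)]] open_ball])
    then have "openin (top_of_set S) (fst c \<inter> snd c -` ball w \<rho>)"
      using openin_trans chart_open[OF i(2)] by blast
    moreover have "V i = fst c \<inter> snd c -` ball w \<rho>" by (auto simp: V_def i)
    ultimately show ?thesis by (simp add: openin_open)
  qed
  then have "\<forall>i\<in>J. \<exists>T. open T \<and> V i = S \<inter> T" by blast
  from bchoice[OF this] obtain T where "\<forall>i\<in>J. open (T i) \<and> V i = S \<inter> T i" by blast
  then have T: "open (T i)" "V i = S \<inter> T i" if "i \<in> J" for i using that by simp_all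
  have cover: "K \<subseteq> (\<Union>i\<in>J. T i)"
  proof
    fix p assume "p \<in> K"
    then obtain c where c: "c \<in> A" "p \<in> fst c" using K chart_cover by blast
    then have "snd c p \<in> cimg c" by blast
    then obtain \<rho> where "0 < \<rho>" "cball (snd c p) \<rho> \<subseteq> cimg c"
      using open_contains_cball[THEN iffD1, OF cimg_open[OF c(1)]] by blast
    then have "(c, snd c p, \<rho>) \<in> J" "p \<in> V (c, snd c p, \<rho>)" using c by (auto simp: J_def V_def)
    then show "p \<in> (\<Union>i\<in>J. T i)" using T(2) by blast
  qed
  obtain I where I: "I \<subseteq> J" "finite I" "K \<subseteq> (\<Union>i\<in>I. T i)"
    by (rule compactE_image[OF K(1) T(1) cover])
  show thesis
  proof (rule that[OF I(2)])
    show "c \<in> A \<and> 0 < \<rho> \<and> cball w \<rho> \<subseteq> cimg c" if "(c, w, \<rho>) \<in> I" for c w \<rho>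
      using that I(1) by (auto simp: J_def)
    have "K \<subseteq> (\<Union>i\<in>I. V i)"
    proof
      fix p assume p: "p \<in> K"
      then obtain i where "i \<in> I" "p \<in> T i" using I(3) by blast
      then show "p \<in> (\<Union>i\<in>I. V i)" using T(2)[of i] I(1) K(2) p by blast
    qed
    then show "K \<subseteq> (\<Union>(c, w, \<rho>)\<in>I. {p \<in> fst c. snd c p \<in> ball w \<rho>})" by (simp add: V_def)
  qed
qed

lemma disjoint_borel_refinement:
  assumes "finite C" "\<And>c. c \<in> C \<Longrightarrow> V c \<in> sets borel"
  shows "\<exists>B. disjoint_family_on B C \<and> (\<Union>c\<in>C. B c) = (\<Union>c\<in>C. V c) \<and> (\<forall>c\<in>C. B c \<in> sets borel \<and> B c \<subseteq> V c)"
  using assms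
proof (induction C rule: finite_induct)
  case empty
  then show ?case by (simp add: disjoint_family_on_def)
next
  case (insert c C)
  from insert.IH insert.prems obtain B where B: "disjoint_family_on B C" "(\<Union>c\<in>C. B c) = (\<Union>c\<in>C. V c)"
    "\<forall>c\<in>C. B c \<in> sets borel \<and> B c \<subseteq> V c" by blast
  define B' where "B' = B(c := V c - (\<Union>c\<in>C. B c))"
  have B'C: "B' d = B d" if "d \<in> C" for d using that insert.hyps by (auto simp: B'_def)
  have B'c: "B' c = V c - (\<Union>c\<in>C. B c)" by (simp add: B'_def)
  have "disjoint_family_on B' (insert c C)"
    unfolding disjoint_family_on_def
  proof (intro ballI impI)
    fix a b assume ab: "a \<in> insert c C" "b \<in> insert c C" "a \<noteq> b"
    show "B' a \<inter> B' b = {}"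
    proof (cases "a \<in> C \<and> b \<in> C")
      case True
      then show ?thesis using B(1) ab(3) B'C unfolding disjoint_family_on_def by simp
    next
      case False
      then show ?thesis using ab B'C B'c by auto
    qed
  qed
  moreover have "(\<Union>c\<in>insert c C. B' c) = (\<Union>c\<in>insert c C. V c)"
    using B(2) B'C B'c by auto
  moreover have "B' d \<in> sets borel \<and> B' d \<subseteq> V d" if d: "d \<in> insert c C" for d
  proof (cases "d \<in> C")
    case True
    then show ?thesis using B(3) B'C by simp
  next
    case False
    with d have d: "d = c" by simp
    have "(\<Union>c\<in>C. B c) \<in> sets borel" using B(3) insert.hyps by (intro sets.finite_UN) auto
    then show ?thesis unfolding d B'c using insert.prems by auto
  qed
  ultimately show ?case by blast
qed

text \<open>The definition of area allows pieces that approach the boundary of their chart, where the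
  density may be unbounded. For pieces inside compact subsets of the chart images all integrals are
  finite and may be differentiated under the integral sign.\<close>

lemma compact_pieces:
  assumes K: "compact K" "K \<subseteq> S"
  obtains C B Q where "pieces K C B" "\<And>c. c \<in> C \<Longrightarrow> compact (Q c) \<and> Q c \<subseteq> cimg c \<and> snd c ` B c \<subseteq> Q c"
proof -
  obtain I where I: "finite I"
    "\<And>c w \<rho>. (c, w, \<rho>) \<in> I \<Longrightarrow> c \<in> A \<and> 0 < \<rho> \<and> cball w \<rho> \<subseteq> cimg c"
    "K \<subseteq> (\<Union>(c, w, \<rho>)\<in>I. {p \<in> fst c. snd c p \<in> ball w \<rho>})"
    using finite_ball_cover[OF K] by blast
  define C where "C = fst ` I"
  define Q where "Q c = (\<Union>(w, \<rho>)\<in>{wr. (c, wr) \<in> I}. cball w \<rho>)" for c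
  define V where "V c = {p \<in> fst c. snd c p \<in> Q c} \<inter> K" for c
  have fin: "finite {wr. (c, wr) \<in> I}" for c
    by (rule finite_subset[OF _ finite_imageI[OF I(1), of snd]]) force
  have C: "finite C" "C \<subseteq> A" using I(1,2) by (auto simp: C_def)
  have Q: "compact (Q c)" "Q c \<subseteq> cimg c" for c
  proof -
    show "compact (Q c)" unfolding Q_def by (rule compact_UN[OF fin]) (simp add: case_prod_unfold)
    show "Q c \<subseteq> cimg c" unfolding Q_def using I(2)[of c] by blast
  qed
  have V: "V c \<in> sets borel" if "c \<in> C" for c
  proof -
    have c: "c \<in> A" using that C by blast
    have "compact (cinv c ` Q c)"
      by (rule compact_continuous_image[OF continuous_on_subset[OF homeomorphism_cont2[OF chart_homeo[OF c]]] Q(1)])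
        (rule Q(2))
    moreover have "{p \<in> fst c. snd c p \<in> Q c} = cinv c ` Q c"
    proof
      show "{p \<in> fst c. snd c p \<in> Q c} \<subseteq> cinv c ` Q c" using cinv_chart[OF c] by force
      show "cinv c ` Q c \<subseteq> {p \<in> fst c. snd c p \<in> Q c}"
        using Q(2)[of c] chart_cinv[of _ c] cinv_in[of _ c] by auto
    qed
    ultimately show ?thesis using K(1) unfolding V_def
      by (intro borel_closed closed_Int compact_imp_closed) auto
  qed
  obtain B where B: "disjoint_family_on B C" "(\<Union>c\<in>C. B c) = (\<Union>c\<in>C. V c)"
    "\<forall>c\<in>C. B c \<in> sets borel \<and> B c \<subseteq> V c"
    using disjoint_borel_refinement[of C V, OF C(1) V] by blast
  have "(\<Union>c\<in>C. V c) = K"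
  proof
    show "K \<subseteq> (\<Union>c\<in>C. V c)"
    proof
      fix p assume p: "p \<in> K"
      then obtain c w \<rho> where i: "(c, w, \<rho>) \<in> I" "p \<in> fst c" "snd c p \<in> ball w \<rho>" using I(3) by blast
      then have "snd c p \<in> Q c" unfolding Q_def using ball_subset_cball by fastforce
      with i p show "p \<in> (\<Union>c\<in>C. V c)" unfolding V_def C_def by force
    qed
  qed (auto simp: V_def)
  with B C have "pieces K C B" unfolding pieces_def V_def by auto
  moreover have "compact (Q c) \<and> Q c \<subseteq> cimg c \<and> snd c ` B c \<subseteq> Q c" if "c \<in> C" for c
    using Q B(3) that unfolding V_def by blast
  ultimately show thesis using that by blast
qed

text \<open>A density supported in a single chart can be integrated there, whatever the pieces are.\<close>

lemma total_single_chart: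
  assumes r: "is_density r" and K: "compact K" "K \<subseteq> S" and P: "pieces K C B"
    and Q: "\<And>c. c \<in> C \<Longrightarrow> compact (Q c) \<and> Q c \<subseteq> cimg c \<and> snd c ` B c \<subseteq> Q c"
    and d: "d \<in> A" and Q': "Q' \<subseteq> cimg d"
    and supp: "\<And>e p. e \<in> A \<Longrightarrow> p \<in> fst e \<Longrightarrow> r e (snd e p) \<noteq> 0 \<Longrightarrow> p \<in> K \<and> p \<in> fst d \<and> snd d p \<in> Q'"
  shows "(\<Sum>c\<in>C. LINT u:snd c ` B c|lborel. r c u) = (LINT u:Q'|lborel. r d u)"
proof -
  have CA: "c \<in> A" "B c \<in> sets borel" "B c \<subseteq> fst c" "B c \<subseteq> K" if "c \<in> C" for c
    using P that unfolding pieces_def by blast+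
  obtain T where T: "open T" "fst d = S \<inter> T" using chart_open[OF d] by (auto simp: openin_open)
  define X where "X c = B c \<inter> fst d" for c
  have X: "X c \<in> sets borel" "X c \<subseteq> fst c" "X c \<subseteq> fst d" if "c \<in> C" for c
  proof -
    have "X c = B c \<inter> T" using T(2) CA(4)[OF that] K(2) unfolding X_def by blast
    then show "X c \<in> sets borel" using CA(2)[OF that] T(1) by simp
    show "X c \<subseteq> fst c" "X c \<subseteq> fst d" using CA(3)[OF that] unfolding X_def by auto
  qed
  have 1: "(LINT u:snd c ` B c|lborel. r c u) = (LINT u:snd c ` X c|lborel. r c u)" if c: "c \<in> C" for c
    unfolding set_lebesgue_integral_def
  proof (rule Bochner_Integration.integral_cong[OF refl])
    fix u
    show "indicat_real (snd c ` B c) u *\<^sub>R r c u = indicat_real (snd c ` X c) u *\<^sub>R r c u"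
    proof (cases "u \<in> snd c ` B c \<and> u \<notin> snd c ` X c")
      case True
      then obtain p where p: "p \<in> B c" "u = snd c p" "p \<notin> fst d" unfolding X_def by blast
      have "r c (snd c p) = 0" using supp[OF CA(1)[OF c], of p] p CA(3)[OF c] by blast
      then show ?thesis using p by simp
    next
      case False
      then show ?thesis unfolding X_def by (auto split: split_indicator)
    qed
  qed
  have int: "set_integrable lborel (snd d ` X c) (r d)" if c: "c \<in> C" for c
  proof -
    have "continuous_on (Q c) (r c)"
      using r CA(1)[OF c] Q[OF c] continuous_on_subset unfolding is_density_def by blast
    then have "set_integrable lborel (snd c ` X c) (r c)"
      using Q[OF c] borel_chart_image[OF CA(1)[OF c] X(1,2)[OF c]]
      by (intro set_integrable_continuous_compact[of "Q c"]) (auto simp: X_def)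
    then show ?thesis using density_integrable_iff[OF r CA(1)[OF c] d X[OF c]] by blast
  qed
  have disj: "disjoint_family_on (\<lambda>c. snd d ` X c) C"
    unfolding disjoint_family_on_def
  proof (intro ballI impI)
    fix a b assume ab: "a \<in> C" "b \<in> C" "a \<noteq> b"
    then have "X a \<inter> X b = {}" using P unfolding X_def pieces_def disjoint_family_on_def by blast
    then show "snd d ` X a \<inter> snd d ` X b = {}"
      using inj_on_image_Int[OF inj_chart[OF d] X(3)[OF ab(1)] X(3)[OF ab(2)]] by simp
  qed
  have "(\<Sum>c\<in>C. LINT u:snd c ` B c|lborel. r c u) = (\<Sum>c\<in>C. LINT u:snd d ` X c|lborel. r d u)"
    using 1 density_integral_eq[OF r CA(1) d X] by (intro sum.cong) simp_all
  also have "\<dots> = (LINT u:(\<Union>c\<in>C. snd d ` X c)|lborel. r d u)"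
    by (rule set_integral_finite_Union[symmetric])
      (use P disj int borel_chart_image[OF d] X in \<open>auto simp: pieces_def\<close>)
  also have "(\<Union>c\<in>C. snd d ` X c) = snd d ` (K \<inter> fst d)"
    using P unfolding X_def pieces_def by blast
  also have "(LINT u:snd d ` (K \<inter> fst d)|lborel. r d u) = (LINT u:Q'|lborel. r d u)"
    unfolding set_lebesgue_integral_def
  proof (rule Bochner_Integration.integral_cong[OF refl])
    fix u
    show "indicat_real (snd d ` (K \<inter> fst d)) u *\<^sub>R r d u = indicat_real Q' u *\<^sub>R r d u"
    proof (cases "u \<in> cimg d \<and> r d u \<noteq> 0")
      case True
      then obtain p where p: "p \<in> fst d" "u = snd d p" by blast
      then show ?thesis using supp[OF d p(1)] True by auto
    next
      case False
      then show ?thesis using Q' by (auto split: split_indicator)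
    qed
  qed
  finally show ?thesis .
qed

end

section \<open>Bump functions on a surface\<close>

context surface
begin

definition bump :: "'m chart \<times> (real ^ 2) \<times> real \<Rightarrow> 'm \<Rightarrow> real" where
  "bump = (\<lambda>(d, w, \<rho>) p. if p \<in> fst d then (max 0 (\<rho>\<^sup>2 - (snd d p - w) \<bullet> (snd d p - w)))\<^sup>2 else 0)"

lemma bump_nonneg: "0 \<le> bump i p"
  by (simp add: bump_def case_prod_unfold)

lemma bump_pos:
  assumes "p \<in> fst d" "snd d p \<in> ball w \<rho>"
  shows "0 < bump (d, w, \<rho>) p"
proof -
  have "norm (snd d p - w) < \<rho>" using assms(2) by (simp add: dist_norm norm_minus_commute)
  then have "(norm (snd d p - w))\<^sup>2 < \<rho>\<^sup>2" by (intro power_strict_mono) simp_all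
  then have "0 < \<rho>\<^sup>2 - (snd d p - w) \<bullet> (snd d p - w)" by (simp add: power2_norm_eq_inner)
  then show ?thesis using assms(1) by (simp add: bump_def)
qed

lemma bump_zero:
  assumes "0 < \<rho>" "\<not> (p \<in> fst d \<and> snd d p \<in> cball w \<rho>)"
  shows "bump (d, w, \<rho>) p = 0"
proof (cases "p \<in> fst d")
  case True
  then have "\<rho> \<le> norm (snd d p - w)" using assms(2) by (simp add: dist_norm norm_minus_commute)
  then have "\<rho>\<^sup>2 \<le> (norm (snd d p - w))\<^sup>2" using assms(1) by (intro power_mono) simp_all
  then have "\<rho>\<^sup>2 - (snd d p - w) \<bullet> (snd d p - w) \<le> 0" by (simp add: power2_norm_eq_inner)
  then show ?thesis by (simp add: bump_def)
qed (simp add: bump_def)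

text \<open>The disc is compact in the surface, hence closed, because the surface is Hausdorff; a bump
  function of one chart therefore extends by zero to all others.\<close>

lemma open_off_ball:
  assumes d: "d \<in> A" and b: "cball w \<rho> \<subseteq> cimg d"
  shows "openin (top_of_set S) {p \<in> S. \<not> (p \<in> fst d \<and> snd d p \<in> cball w \<rho>)}"
proof -
  have "compact (cinv d ` cball w \<rho>)"
    by (rule compact_continuous_image[OF continuous_on_subset[OF homeomorphism_cont2[OF chart_homeo[OF d]] b] compact_cball])
  then have cl: "closed (cinv d ` cball w \<rho>)" by (rule compact_imp_closed)
  have iff: "p \<in> fst d \<and> snd d p \<in> cball w \<rho> \<longleftrightarrow> p \<in> cinv d ` cball w \<rho>" for p
  proof
    assume p: "p \<in> fst d \<and> snd d p \<in> cball w \<rho>"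
    then have "cinv d (snd d p) \<in> cinv d ` cball w \<rho>" by blast
    then show "p \<in> cinv d ` cball w \<rho>" using cinv_chart[OF d, of p] p by simp
  next
    assume "p \<in> cinv d ` cball w \<rho>"
    then obtain u where u: "u \<in> cball w \<rho>" "p = cinv d u" by blast
    then have "u \<in> cimg d" using b by blast
    then show "p \<in> fst d \<and> snd d p \<in> cball w \<rho>"
      using cinv_in[of u d] chart_cinv[of u d] u by simp
  qed
  have "{p \<in> S. \<not> (p \<in> fst d \<and> snd d p \<in> cball w \<rho>)} = S \<inter> - (cinv d ` cball w \<rho>)"
    unfolding iff by blast
  moreover have "open (- (cinv d ` cball w \<rho>))" by (rule open_Compl[OF cl])
  ultimately show ?thesis by (simp add: openin_open_Int)
qed

lemma bump_C1:
  assumes c: "c \<in> A" and d: "d \<in> A" "0 < \<rho>" "cball w \<rho> \<subseteq> cimg d"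
  shows "Ck_on (Suc 0) (\<lambda>u. bump (d, w, \<rho>) (cinv c u)) (cimg c)"
proof (rule Ck_on_local)
  fix u assume u: "u \<in> cimg c"
  show "\<exists>V. open V \<and> u \<in> V \<and> Ck_on (Suc 0) (\<lambda>u. bump (d, w, \<rho>) (cinv c u)) V"
  proof (cases "cinv c u \<in> fst d")
    case True
    define V where "V = snd c ` (fst c \<inter> fst d)"
    have Veq: "V = {u \<in> cimg c. cinv c u \<in> fst c \<inter> fst d}"
      unfolding V_def by (rule chart_image_eq[OF c Int_lower1])
    have V: "open V" "u \<in> V"
      unfolding V_def by (rule open_overlap[OF c d(1)])
        (use u True cinv_in[OF u] in \<open>simp add: Veq[unfolded V_def]\<close>)
    have "Ck_on (Suc 0) (\<lambda>u. (max 0 (\<rho>\<^sup>2 - (transition c d u - w) \<bullet> (transition c d u - w)))\<^sup>2) V"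
      unfolding V_def by (rule C1_bump[OF transition_smooth[OF c d(1)]])
    moreover have "Ck_on (Suc 0) (\<lambda>u. bump (d, w, \<rho>) (cinv c u)) V \<longleftrightarrow>
       Ck_on (Suc 0) (\<lambda>u. (max 0 (\<rho>\<^sup>2 - (transition c d u - w) \<bullet> (transition c d u - w)))\<^sup>2) V"
      by (rule Ck_on_cong[OF V(1)]) (simp add: Veq bump_def)
    ultimately show ?thesis using V by blast
  next
    case False
    define V where "V = {u \<in> cimg c. cinv c u \<in> {p \<in> S. \<not> (p \<in> fst d \<and> snd d p \<in> cball w \<rho>)}}"
    have V: "open V" "u \<in> V"
      using open_chart_preimage[OF c open_off_ball[OF d(1,3)]] False u cinv_in[OF u] chart_subset[OF c]
      unfolding V_def by auto
    have "Ck_on (Suc 0) (\<lambda>u. bump (d, w, \<rho>) (cinv c u)) V \<longleftrightarrow> Ck_on (Suc 0) (\<lambda>u. 0::real) V"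
      by (rule Ck_on_cong[OF V(1)]) (rule bump_zero[OF d(2)], simp add: V_def)
    then show ?thesis using V C1_const by blast
  qed
qed

end

section \<open>Variations of a holomorphic curve\<close>

locale holomorphic_variation = surface S A
  for S :: "'m::{t2_space, second_countable_topology} set" and A :: "'m chart set" +
  fixes F :: "'m \<Rightarrow> psphere \<times> psphere" and K :: "'m set" and \<epsilon> :: real
    and H :: "real \<Rightarrow> 'm \<Rightarrow> psphere \<times> psphere"
  assumes holomorphic: "holomorphic_curve S A F"
    and nondegenerate: "nondegenerate_metric A F"
    and variation: "compact_variation S A F K \<epsilon> H"
begin

abbreviation J :: "real set" where "J \<equiv> {-\<epsilon><..<\<epsilon>}"

text \<open>The variation read in a chart, as one map in time and space. All forms are pulled back along
  this map; the surface at a fixed time and its velocity are obtained by evaluating them on vectors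
  tangent to the slice or on the time direction \<open>(1, 0)\<close>.\<close>

definition motion :: "'m chart \<Rightarrow> real \<times> (real ^ 2) \<Rightarrow> psphere \<times> psphere" where
  "motion c = (\<lambda>(t, u). H t (cinv c u))"

abbreviation E :: "2 \<Rightarrow> real \<times> (real ^ 2)" where "E i \<equiv> (0, axis i 1)"

lemma K: "compact K" "K \<subseteq> S" "closed K" and eps: "0 < \<epsilon>" and J0: "0 \<in> J"
  using variation compact_imp_closed unfolding compact_variation_def by auto

lemma open_off_K: "openin (top_of_set S) (S - K)"
  using K(3) by (simp add: Diff_eq openin_open_Int open_Compl)

lemma motion_smooth:
  assumes "c \<in> A" shows "smooth_map_LH3 (J \<times> cimg c) (motion c)"
proof -
  have "\<forall>c\<in>A. smooth_map_LH3 (J \<times> cimg c) (motion c)"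
    using variation unfolding compact_variation_def motion_def by (simp add: case_prod_unfold)
  then show ?thesis using assms by blast
qed

lemma H_initial: "p \<in> S \<Longrightarrow> H 0 p = F p"
  using variation unfolding compact_variation_def by blast

lemma H_fixed: "t \<in> J \<Longrightarrow> p \<in> S \<Longrightarrow> p \<notin> K \<Longrightarrow> H t p = F p"
  using variation unfolding compact_variation_def by blast

lemma differential_at_time:
  assumes c: "c \<in> A" and t: "t \<in> J" and u: "u \<in> cimg c"
  shows "differential (H t \<circ> cinv c) u v = differential (motion c) (t, u) (0, v)"
proof (rule differential_comp[where \<phi> = "\<lambda>u. (t, u)" and \<phi>' = "\<lambda>v. (0, v)" and W = UNIV, OF motion_smooth[OF c]])
  show "((\<lambda>u. (t, u)) has_derivative (\<lambda>v. (0, v))) (at u)"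
    by (intro has_derivative_Pair has_derivative_const has_derivative_ident)
qed (use t u in \<open>simp_all add: motion_def\<close>)

lemma linear_differential_at_time:
  assumes c: "c \<in> A" and t: "t \<in> J" and u: "u \<in> cimg c"
  shows "linear (differential (H t \<circ> cinv c) u)"
proof -
  have l: "linear (differential (motion c) (t, u))"
    by (rule linear_differential[OF motion_smooth[OF c]]) (use t u in simp)
  have "linear (\<lambda>v::real ^ 2. (0::real, v))" by (rule linearI) simp_all
  from linear_compose[OF this l] have "linear (\<lambda>v. differential (motion c) (t, u) (0, v))" by (simp add: o_def)
  moreover have "differential (H t \<circ> cinv c) u = (\<lambda>v. differential (motion c) (t, u) (0, v))"
    by (rule ext) (rule differential_at_time[OF assms])
  ultimately show ?thesis by simp
qed

lemma pull_at_time: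
  assumes c: "c \<in> A" and t: "t \<in> J" and u: "u \<in> cimg c"
  shows "pull (H t \<circ> cinv c) u v w = pull (motion c) (t, u) (0, v) (0, w)"
  unfolding pull_def differential_at_time[OF assms] by (simp add: motion_def)

lemma omega_at_time:
  assumes c: "c \<in> A" and t: "t \<in> J" and u: "u \<in> cimg c"
  shows "omega (H t \<circ> cinv c) u v w = omega (motion c) (t, u) (0, v) (0, w)"
  unfolding omega_def pull_at_time[OF assms] ..

lemma differential_transition:
  assumes c: "c \<in> A" "d \<in> A" and p: "p \<in> fst c" "p \<in> fst d" and t: "t \<in> J"
  shows "differential (motion c) (t, snd c p) (s, v) = differential (motion d) (t, snd d p) (s, jacobian c d (snd c p) v)"
proof -
  let ?\<phi> = "\<lambda>z. (fst z, transition c d (snd z))" and ?\<phi>' = "\<lambda>z. (fst z, jacobian c d (snd c p) (snd z))"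
  have T: "transition c d (snd c p) = snd d p" using cinv_chart[OF c(1) p(1)] by simp
  have "differential (motion c) (t, snd c p) (s, v) = differential (motion d) (?\<phi> (t, snd c p)) (?\<phi>' (s, v))"
  proof (rule differential_comp[where \<phi> = ?\<phi> and \<phi>' = ?\<phi>' and W = "J \<times> snd c ` (fst c \<inter> fst d)", OF motion_smooth[OF c(2)]])
    have D: "(transition c d has_derivative jacobian c d (snd c p)) (at (snd (t, snd c p)))"
      using transition_has_derivative[OF c p] by simp
    show "(?\<phi> has_derivative ?\<phi>') (at (t, snd c p))"
      by (intro has_derivative_Pair has_derivative_fst has_derivative_ident
            has_derivative_compose[where f = snd and g = "transition c d", OF has_derivative_snd[OF has_derivative_ident] D])
    show "?\<phi> (t, snd c p) \<in> J \<times> cimg d" using t p T by simp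
    show "open (J \<times> snd c ` (fst c \<inter> fst d))" by (intro open_Times open_overlap[OF c]) simp
    show "(t, snd c p) \<in> J \<times> snd c ` (fst c \<inter> fst d)" using t p by simp
    fix z assume "z \<in> J \<times> snd c ` (fst c \<inter> fst d)"
    then obtain r q where z: "z = (r, snd c q)" "q \<in> fst c" "q \<in> fst d" by blast
    then show "motion c z = motion d (?\<phi> z)"
      using cinv_chart[OF c(1), of q] cinv_chart[OF c(2), of q] by (simp add: motion_def)
  qed
  then show ?thesis using T by simp
qed

lemma omega_transition:
  assumes c: "c \<in> A" "d \<in> A" and p: "p \<in> fst c" "p \<in> fst d" and t: "t \<in> J"
  shows "omega (motion c) (t, snd c p) (s, v) (s', w) =
     omega (motion d) (t, snd d p) (s, jacobian c d (snd c p) v) (s', jacobian c d (snd c p) w)"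
proof -
  have "motion c (t, snd c p) = motion d (t, snd d p)"
    using cinv_chart[OF c(1) p(1)] cinv_chart[OF c(2) p(2)] by (simp add: motion_def)
  then show ?thesis unfolding omega_def pull_def differential_transition[OF assms] by simp
qed

definition defect_form :: "'m chart \<Rightarrow> real \<times> (real ^ 2) \<Rightarrow> real" where
  "defect_form c z = Re (pull (motion c) z (E 1) (E 2) * cnj (pull (motion c) z (E 1) (E 2)) + pull (motion c) z (E 2) (E 1) * cnj (pull (motion c) z (E 2) (E 1))
     - 2 * (pull (motion c) z (E 1) (E 1) * cnj (pull (motion c) z (E 2) (E 2))))"

definition gram_det :: "'m chart \<Rightarrow> real \<times> (real ^ 2) \<Rightarrow> real" where
  "gram_det c z = omega (motion c) z (E 1) (E 2) * omega (motion c) z (E 1) (E 2) -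
     defect_form c z"

lemma defect_at_time:
  assumes "c \<in> A" "t \<in> J" "u \<in> cimg c"
  shows "defect (H t \<circ> cinv c) u = defect_form c (t, u)"
  unfolding defect_pull pull_at_time[OF assms] cmod_power2 defect_form_def
  by (simp add: power2_eq_square)

lemma area_density_at_time:
  assumes "c \<in> A" "t \<in> J" "u \<in> cimg c"
  shows "area_density (H t \<circ> cinv c) u = sqrt \<bar>gram_det c (t, u)\<bar>"
  unfolding area_density_omega omega_at_time[OF assms] defect_at_time[OF assms] gram_det_def
  by (simp add: power2_eq_square)

lemma open_JU: "c \<in> A \<Longrightarrow> open (J \<times> cimg c)"
  by (rule smooth_map_open[OF motion_smooth])

lemma omega_motion_C1: "c \<in> A \<Longrightarrow> Ck_on (Suc 0) (\<lambda>z. omega (motion c) z v w) (J \<times> cimg c)"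
  by (rule omega_C1[OF motion_smooth])

lemma defect_form_C1:
  assumes c: "c \<in> A"
  shows "Ck_on (Suc 0) (defect_form c) (J \<times> cimg c)"
  unfolding defect_form_def[abs_def]
  by (intro Ck_on_bounded_linear[OF open_JU[OF c] bounded_linear_Re] C1_diff C1_add C1_mult C1_const
      Ck_on_bounded_linear[OF open_JU[OF c] bounded_linear_cnj] pull_C1[OF motion_smooth[OF c]])

lemma gram_det_C1:
  assumes c: "c \<in> A"
  shows "Ck_on (Suc 0) (gram_det c) (J \<times> cimg c)"
  unfolding gram_det_def[abs_def]
  by (rule C1_diff[OF C1_mult[OF omega_motion_C1[OF c] omega_motion_C1[OF c]] defect_form_C1[OF c]])

lemma area_density_is_density:
  assumes t: "t \<in> J"
  shows "is_density (\<lambda>c. area_density (H t \<circ> cinv c))"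
  unfolding is_density_def
proof (intro conjI ballI)
  fix c assume c: "c \<in> A"
  have "continuous_on (cimg c) (\<lambda>u. gram_det c (t, u))"
    by (rule Ck_on_continuous[OF C1_slice(1)[OF gram_det_C1[OF c] t]])
  then have "continuous_on (cimg c) (\<lambda>u. sqrt \<bar>gram_det c (t, u)\<bar>)" by (intro continuous_intros)
  then show "continuous_on (cimg c) (area_density (H t \<circ> cinv c))"
    by (rule continuous_on_eq) (rule area_density_at_time[OF c t, symmetric])
next
  fix c d p assume c: "c \<in> A" "d \<in> A" and p: "p \<in> fst c \<inter> fst d"
  then have pc: "snd c p \<in> cimg c" "snd d p \<in> cimg d" by auto
  show "area_density (H t \<circ> cinv c) (snd c p) =
     \<bar>det (matrix (jacobian c d (snd c p)))\<bar> * area_density (H t \<circ> cinv d) (snd d p)"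
  proof (rule area_density_linear)
    show "(H t \<circ> cinv c) (snd c p) = (H t \<circ> cinv d) (snd d p)"
      using cinv_chart[OF c(1), of p] cinv_chart[OF c(2), of p] p by simp
    show "differential (H t \<circ> cinv c) (snd c p) v = differential (H t \<circ> cinv d) (snd d p) (jacobian c d (snd c p) v)" for v
      unfolding differential_at_time[OF c(1) t pc(1)] differential_at_time[OF c(2) t pc(2)]
      by (rule differential_transition[OF c _ _ t]) (use p in auto)
    show "linear (differential (H t \<circ> cinv d) (snd d p))"
      by (rule linear_differential_at_time[OF c(2) t pc(2)])
  qed
qed

text \<open>The density of the pulled-back Kaehler form at time \<open>0\<close>. It is the area density up to sign.\<close>

definition area_form :: "'m chart \<Rightarrow> real ^ 2 \<Rightarrow> real" where
  "area_form c u = omega (motion c) (0, u) (E 1) (E 2)"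

lemma initial_differential:
  assumes c: "c \<in> A" and u: "u \<in> cimg c"
  shows "differential (F \<circ> cinv c) u v = differential (H 0 \<circ> cinv c) u v"
proof -
  have eq: "(F \<circ> cinv c) x = (H 0 \<circ> cinv c) x" if "x \<in> cimg c" for x
    using H_initial[of "cinv c x"] chart_subset[OF c] cinv_in[OF that] by auto
  have "frechet_derivative (\<lambda>x. coord (chart_at ((F \<circ> cinv c) u)) ((F \<circ> cinv c) x)) (at u)
      = frechet_derivative (\<lambda>x. coord (chart_at ((H 0 \<circ> cinv c) u)) ((H 0 \<circ> cinv c) x)) (at u)"
    by (rule ddir_cong[OF cimg_open[OF c] u]) (simp only: eq u)
  then show ?thesis unfolding differential_def by (rule fun_cong)
qed

text \<open>The only place where holomorphy and non-degeneracy are used: the first makes the defect vanish,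
  and then the Gram determinant is the square of the area form, which the second makes nonzero.\<close>

lemma initial_defect:
  assumes c: "c \<in> A" and u: "u \<in> cimg c"
  shows "defect (H 0 \<circ> cinv c) u = 0"
    and "area_form c u \<noteq> 0"
proof -
  define p where "p = cinv c u"
  have p: "p \<in> fst c" "snd c p = u" using cinv_in[OF u] chart_cinv[OF u] by (simp_all add: p_def)
  have D: "differential (F \<circ> cinv c) u = differential (H 0 \<circ> cinv c) u"
    by (rule ext) (rule initial_differential[OF c u])
  have Hp: "(H 0 \<circ> cinv c) u = F p"
    using H_initial[of p] p chart_subset[OF c] p_def by auto
  have tp: "tangent_plane c F p = range (differential (H 0 \<circ> cinv c) u)"
    unfolding D[symmetric] by (simp add: tangent_plane_def case_prod_unfold p)
  have imm: "immersed_surface S A F" using holomorphic unfolding holomorphic_curve_def by blast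
  then have "\<forall>c\<in>A. \<forall>u\<in>cimg c. inj (differential (F \<circ> cinv c) u)"
    unfolding immersed_surface_def by (simp add: case_prod_unfold)
  then have inj: "inj (differential (H 0 \<circ> cinv c) u)" using c u unfolding D[symmetric] by blast
  have lin: "linear (differential (H 0 \<circ> cinv c) u)" by (rule linear_differential_at_time[OF c J0 u])
  have "cplx_J ` tangent_plane c F p = tangent_plane c F p"
    using holomorphic c p unfolding holomorphic_curve_def by blast
  then show d0: "defect (H 0 \<circ> cinv c) u = 0"
    unfolding tp by (rule defect_complex_plane[OF lin inj])
  have "det (gram_matrix (H 0 \<circ> cinv c) u) \<noteq> 0"
  proof (rule det_gram_nonzero[OF lin inj])
    fix v assume "v \<in> range (differential (H 0 \<circ> cinv c) u)"
      "\<And>w. w \<in> range (differential (H 0 \<circ> cinv c) u) \<Longrightarrow> neutral_metric ((H 0 \<circ> cinv c) u) v w = 0"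
    then show "v = 0" using nondegenerate c p unfolding nondegenerate_metric_def tp[symmetric] Hp by blast
  qed
  then show "area_form c u \<noteq> 0"
    unfolding det_gram_matrix d0 omega_at_time[OF c J0 u] area_form_def by simp
qed

lemma area_form_C1: "c \<in> A \<Longrightarrow> Ck_on (Suc 0) (area_form c) (cimg c)"
  unfolding area_form_def[abs_def] by (rule C1_slice(1)[OF omega_motion_C1 J0])

lemma area_form_transition:
  assumes c: "c \<in> A" "d \<in> A" and p: "p \<in> fst c" "p \<in> fst d"
  shows "area_form c (snd c p) = det (matrix (jacobian c d (snd c p))) * area_form d (snd d p)"
  unfolding area_form_def omega_transition[OF c p J0]
proof (rule alternating_linear_map[where w = "\<lambda>v w. omega (motion d) (0, snd d p) (0, v) (0, w)"])
  have pd: "snd d p \<in> cimg d" using p by blast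
  have "(\<lambda>w. omega (motion d) (0, snd d p) (0, v) (0, w)) = omega (H 0 \<circ> cinv d) (snd d p) v" for v
    by (rule ext) (rule omega_at_time[OF c(2) J0 pd, symmetric])
  then show "linear (\<lambda>w. omega (motion d) (0, snd d p) (0, v) (0, w))" for v
    using linear_omega[OF linear_differential_at_time[OF c(2) J0 pd]] by simp
qed (rule omega_antisym)

text \<open>The contraction of the Kaehler form with the velocity, evaluated on \<open>v\<close>.\<close>

definition alpha :: "'m chart \<Rightarrow> real ^ 2 \<Rightarrow> real ^ 2 \<Rightarrow> real" where
  "alpha c v u = omega (motion c) (0, u) (1, 0) (0, v)"

lemma alpha_C1: "c \<in> A \<Longrightarrow> Ck_on (Suc 0) (alpha c v) (cimg c)"
  unfolding alpha_def[abs_def] by (rule C1_slice(1)[OF omega_motion_C1 J0])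

lemma alpha_transition:
  assumes c: "c \<in> A" "d \<in> A" and p: "p \<in> fst c" "p \<in> fst d"
  shows "alpha c v (snd c p) = alpha d (jacobian c d (snd c p) v) (snd d p)"
proof -
  have "jacobian c d (snd c p) 0 = 0"
    by (rule linear_0[OF has_derivative_linear[OF transition_has_derivative[OF c p]]])
  then show ?thesis unfolding alpha_def omega_transition[OF c p J0] by simp
qed

lemma linear_alpha:
  assumes c: "c \<in> A" and u: "u \<in> cimg c"
  shows "linear (\<lambda>v. alpha c v u)"
proof -
  have l: "linear (omega (motion c) (0, u) (1, 0))"
    by (rule linear_omega[OF linear_differential[OF motion_smooth[OF c]]]) (use J0 u in simp)
  have "linear (\<lambda>v::real ^ 2. (0::real, v))" by (rule linearI) simp_all
  from linear_compose[OF this l] show ?thesis unfolding alpha_def by (simp add: o_def)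
qed

lemma alpha_off_K:
  assumes c: "c \<in> A" and u: "u \<in> cimg c" and "cinv c u \<notin> K"
  shows "alpha c v u = 0"
proof -
  define f where "f t = motion c (t, u)" for t
  have const: "f t = F (cinv c u)" if "t \<in> J" for t
    unfolding f_def motion_def using H_fixed[OF that] assms cinv_in[OF u] chart_subset[OF c] by auto
  have "differential f 0 1 = differential (motion c) (0, u) (1, 0)"
  proof (rule differential_comp[where \<phi> = "\<lambda>t. (t, u)" and \<phi>' = "\<lambda>s. (s, 0)" and W = UNIV, OF motion_smooth[OF c]])
    show "((\<lambda>t. (t, u)) has_derivative (\<lambda>s. (s, 0))) (at 0)"
      by (intro has_derivative_Pair has_derivative_const has_derivative_ident)
  qed (use J0 u in \<open>simp_all add: f_def\<close>)
  moreover have "differential f 0 1 = 0"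
  proof -
    have "frechet_derivative (\<lambda>t. coord (chart_at (f 0)) (f t)) (at 0)
       = frechet_derivative (\<lambda>t. coord (chart_at (f 0)) (F (cinv c u))) (at 0)"
      by (rule ddir_cong[of J]) (use J0 const in simp_all)
    then show ?thesis unfolding differential_def by simp
  qed
  ultimately have "differential (motion c) (0, u) (1, 0) = 0" by simp
  then show ?thesis by (simp add: alpha_def omega_def pull_def zform_def)
qed

text \<open>The coefficient of the exterior derivative of the one-form \<open>alpha\<close>.\<close>

definition dalpha :: "'m chart \<Rightarrow> real ^ 2 \<Rightarrow> real" where
  "dalpha c u = ddir (alpha c (axis 2 1)) u (axis 1 1) - ddir (alpha c (axis 1 1)) u (axis 2 1)"

text \<open>Cartan's formula for a closed form, in coordinates: the closedness relation on space-time is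
  applied to the time direction and the two coordinate directions.\<close>

lemma area_form_derivative:
  assumes c: "c \<in> A" and u: "u \<in> cimg c"
  shows "ddir (\<lambda>z. omega (motion c) z (E 1) (E 2)) (0, u) (1, 0) = dalpha c u"
proof -
  have z: "(0, u) \<in> J \<times> cimg c" using J0 u by simp
  have m: "ddir (\<lambda>z. omega (motion c) z (E 2) (1, 0)) (0, u) v = - ddir (\<lambda>z. omega (motion c) z (1, 0) (E 2)) (0, u) v" for v
    unfolding omega_antisym[of _ _ "E 2"]
    by (rule ddir_bounded_linear[OF bounded_linear_minus[OF bounded_linear_ident] Ck_on_differentiable[OF omega_motion_C1[OF c] z]])
  have a: "ddir (alpha c v) u w = ddir (\<lambda>z. omega (motion c) z (1, 0) (0, v)) (0, u) (0, w)" for v w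
    unfolding alpha_def[abs_def] by (rule C1_slice(2)[OF omega_motion_C1[OF c] J0 u])
  show ?thesis
    using omega_closed[OF motion_smooth[OF c] z, of "E 1" "E 2" "(1, 0)"] unfolding m dalpha_def a by simp
qed

definition area_variation :: "'m chart \<Rightarrow> real ^ 2 \<Rightarrow> real" where
  "area_variation c u = sgn (area_form c u) * dalpha c u"

section \<open>First variation of the area\<close>

lemma gram_det_initial:
  assumes c: "c \<in> A" and u: "u \<in> cimg c"
  shows "gram_det c (0, u) = (area_form c u)\<^sup>2"
  using initial_defect(1)[OF c u, unfolded defect_at_time[OF c J0 u]]
  by (simp only: gram_det_def area_form_def power2_eq_square diff_0_right)

text \<open>The defect is nonnegative and vanishes at time \<open>0\<close>, so its time derivative vanishes there, and
  only the square of the Kaehler form contributes.\<close>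

lemma gram_det_derivative:
  assumes c: "c \<in> A" and u: "u \<in> cimg c"
  shows "ddir (gram_det c) (0, u) (1, 0) = 2 * area_form c u * dalpha c u"
proof -
  define N where "N = defect_form c"
  define w where "w z = omega (motion c) z (E 1) (E 2)" for z
  have gd: "gram_det c = (\<lambda>z. w z * w z - N z)"
    unfolding gram_det_def[abs_def] N_def w_def ..
  have z: "(0, u) \<in> J \<times> cimg c" using J0 u by simp
  have NC: "Ck_on (Suc 0) N (J \<times> cimg c)" unfolding N_def by (rule defect_form_C1[OF c])
  have wC: "Ck_on (Suc 0) w (J \<times> cimg c)" unfolding w_def[abs_def] by (rule omega_motion_C1[OF c])
  have N: "N (t, u) = defect (H t \<circ> cinv c) u" if "t \<in> J" for t
    unfolding N_def by (rule defect_at_time[OF c that u, symmetric])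
  have N': "ddir N (0, u) (1, 0) = 0"
  proof (rule DERIV_local_min[OF C1_time_derivative[OF NC J0 u] eps])
    show "\<forall>y. \<bar>0 - y\<bar> < \<epsilon> \<longrightarrow> N (0, u) \<le> N (y, u)"
    proof (intro allI impI)
      fix y :: real assume "\<bar>0 - y\<bar> < \<epsilon>"
      then have y: "y \<in> J" by auto
      show "N (0, u) \<le> N (y, u)" unfolding N[OF J0] N[OF y] initial_defect(1)[OF c u] by (rule defect_nonneg)
    qed
  qed
  note dw = Ck_on_differentiable[OF wC z] and dN = Ck_on_differentiable[OF NC z]
  have dww: "(\<lambda>z. w z * w z) differentiable at (0, u)"
    by (rule Ck_on_differentiable[OF C1_mult[OF wC wC] z])
  have "ddir w (0, u) (1, 0) = dalpha c u"
    unfolding w_def[abs_def] by (rule area_form_derivative[OF c u])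
  moreover have "w (0, u) = area_form c u" by (simp add: w_def area_form_def)
  ultimately show ?thesis unfolding gd ddir_diff[OF dww dN] ddir_mult[OF dw dw] N' by simp
qed

lemma sqrt_gram_det_derivative:
  assumes c: "c \<in> A" and u: "u \<in> cimg c" and t: "t \<in> J" and pos: "0 < gram_det c (t, u)"
  shows "((\<lambda>t. sqrt (gram_det c (t, u))) has_real_derivative
     ddir (gram_det c) (t, u) (1, 0) / (2 * sqrt (gram_det c (t, u)))) (at t)"
proof -
  have "((\<lambda>t. sqrt (gram_det c (t, u))) has_real_derivative
     (inverse (sqrt (gram_det c (t, u))) / 2) * ddir (gram_det c) (t, u) (1, 0)) (at t)"
    by (rule DERIV_chain2[where f = sqrt, OF DERIV_real_sqrt[OF pos] C1_time_derivative[OF gram_det_C1[OF c] t u]])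
  then show ?thesis by (simp add: field_simps)
qed

lemma initial_sqrt_derivative:
  assumes c: "c \<in> A" and u: "u \<in> cimg c"
  shows "ddir (gram_det c) (0, u) (1, 0) / (2 * sqrt (gram_det c (0, u))) = area_variation c u"
  unfolding gram_det_derivative[OF c u] gram_det_initial[OF c u] area_variation_def sgn_if
  using initial_defect(2)[OF c u] by (auto simp: abs_if)

text \<open>The Gram determinant is positive near time \<open>0\<close>, so the absolute value in the area density
  disappears there.\<close>

lemma area_density_derivative:
  assumes c: "c \<in> A" and u: "u \<in> cimg c"
  shows "((\<lambda>t. area_density (H t \<circ> cinv c) u) has_real_derivative area_variation c u) (at 0)"
proof -
  have pos: "0 < gram_det c (0, u)"
    using initial_defect(2)[OF c u] unfolding gram_det_initial[OF c u] by simp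
  have cont: "isCont (\<lambda>t. gram_det c (t, u)) 0"
    by (rule DERIV_isCont[OF C1_time_derivative[OF gram_det_C1[OF c] J0 u]])
  have ev: "\<forall>\<^sub>F t in nhds 0. 0 < gram_det c (t, u) \<and> t \<in> J"
  proof (rule eventually_conj)
    show "\<forall>\<^sub>F t in nhds 0. 0 < gram_det c (t, u)"
      using order_tendstoD(1)[OF cont[unfolded isCont_def] pos] pos by (simp add: eventually_nhds_conv_at)
    show "\<forall>\<^sub>F t in nhds 0. t \<in> J" using J0 by (intro eventually_nhds_in_open) simp_all
  qed
  have ev': "\<forall>\<^sub>F t in nhds 0. area_density (H t \<circ> cinv c) u = sqrt (gram_det c (t, u))"
    using ev by (rule eventually_mono) (simp add: area_density_at_time[OF c _ u])
  show ?thesis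
    using sqrt_gram_det_derivative[OF c u J0 pos]
    unfolding initial_sqrt_derivative[OF c u] DERIV_cong_ev[OF refl ev' refl] .
qed

text \<open>Away from time \<open>0\<close> the surfaces need be neither complex nor non-degenerate; compactness gives a
  common time interval on which the root in the area density stays differentiable.\<close>

lemma gram_det_positive:
  assumes c: "c \<in> A" and Q: "compact Q" "Q \<subseteq> cimg c"
  obtains \<delta> where "0 < \<delta>" "\<delta> < \<epsilon>" "\<And>t u. \<bar>t\<bar> \<le> \<delta> \<Longrightarrow> u \<in> Q \<Longrightarrow> 0 < gram_det c (t, u)"
proof -
  define W where "W = {z \<in> J \<times> cimg c. 0 < gram_det c z}"
  have "open W"
    using continuous_open_preimage[OF Ck_on_continuous[OF gram_det_C1[OF c]] open_JU[OF c] open_greaterThan, of 0]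
    by (simp add: W_def vimage_def Int_def)
  moreover have "compact ({0} \<times> Q)" using Q by (intro compact_Times) simp_all
  moreover have "{0} \<times> Q \<subseteq> W"
  proof
    fix z :: "real \<times> (real ^ 2)" assume "z \<in> {0} \<times> Q"
    then obtain u where u: "u \<in> Q" "z = (0, u)" by blast
    then have uc: "u \<in> cimg c" using Q by blast
    then show "z \<in> W" unfolding W_def u(2) using J0 initial_defect(2)[OF c uc] gram_det_initial[OF c uc] by simp
  qed
  ultimately obtain e where e: "0 < e" "(\<Union>x\<in>{0} \<times> Q. ball x e) \<subseteq> W"
    using compact_subset_open_imp_ball_epsilon_subset by blast
  show thesis
  proof (rule that[of "min (e / 2) (\<epsilon> / 2)"])
    show "0 < min (e / 2) (\<epsilon> / 2)" "min (e / 2) (\<epsilon> / 2) < \<epsilon>" using e eps by auto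
    fix t u assume "\<bar>t\<bar> \<le> min (e / 2) (\<epsilon> / 2)" "u \<in> Q"
    then have "(t, u) \<in> ball (0, u) e" "(0, u) \<in> {0} \<times> Q" using e by (auto simp: dist_Pair_Pair)
    then have "(t, u) \<in> W" using e(2) by blast
    then show "0 < gram_det c (t, u)" by (simp add: W_def)
  qed
qed

lemma piece_area_derivative:
  assumes c: "c \<in> A" and Q: "compact Q" "Q \<subseteq> cimg c" and B: "B \<in> sets borel" "B \<subseteq> Q"
  shows "((\<lambda>t. LINT u:B|lborel. area_density (H t \<circ> cinv c) u) has_real_derivative
           (LINT u:B|lborel. area_variation c u)) (at 0)"
proof -
  obtain \<delta> where \<delta>: "0 < \<delta>" "\<delta> < \<epsilon>" and pos: "\<And>t u. \<bar>t\<bar> \<le> \<delta> \<Longrightarrow> u \<in> Q \<Longrightarrow> 0 < gram_det c (t, u)"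
    using gram_det_positive[OF c Q] by blast
  have tJ: "t \<in> J" if "\<bar>t\<bar> \<le> \<delta>" for t using that \<delta> by auto
  have sub: "{-\<delta>..\<delta>} \<times> Q \<subseteq> J \<times> cimg c" using \<delta> Q by auto
  have cg: "continuous_on ({-\<delta>..\<delta>} \<times> Q) (gram_det c)"
    by (rule continuous_on_subset[OF Ck_on_continuous[OF gram_det_C1[OF c]] sub])
  have cd: "continuous_on ({-\<delta>..\<delta>} \<times> Q) (\<lambda>z. ddir (gram_det c) z (1, 0))"
    by (rule continuous_on_subset[OF Ck_on_continuous[OF Ck_on_ddir[OF gram_det_C1[OF c]]] sub])
  have nz: "\<forall>z\<in>{-\<delta>..\<delta>} \<times> Q. 2 * sqrt (gram_det c z) \<noteq> 0"
  proof
    fix z assume "z \<in> {-\<delta>..\<delta>} \<times> Q"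
    then obtain t u where z: "z = (t, u)" "\<bar>t\<bar> \<le> \<delta>" "u \<in> Q" by (auto simp: abs_le_iff)
    show "2 * sqrt (gram_det c z) \<noteq> 0" using pos[OF z(2,3)] z(1) by simp
  qed
  have "((\<lambda>t. LINT u:B|lborel. sqrt (gram_det c (t, u))) has_real_derivative
      (LINT u:B|lborel. ddir (gram_det c) (0, u) (1, 0) / (2 * sqrt (gram_det c (0, u))))) (at 0)"
  proof (rule has_derivative_under_integral[OF Q(1) B \<delta>(1)])
    show "((\<lambda>t. sqrt (gram_det c (t, u))) has_real_derivative
       ddir (gram_det c) (t, u) (1, 0) / (2 * sqrt (gram_det c (t, u)))) (at t)"
      if t: "\<bar>t\<bar> \<le> \<delta>" and u: "u \<in> Q" for t u
      by (rule sqrt_gram_det_derivative[OF c _ tJ[OF t] pos[OF t u]]) (use u Q in blast)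
    show "continuous_on Q (\<lambda>u. sqrt (gram_det c (t, u)))" if t: "\<bar>t\<bar> \<le> \<delta>" for t
      by (intro continuous_on_real_sqrt continuous_on_subset[OF Ck_on_continuous[OF C1_slice(1)[OF gram_det_C1[OF c] tJ[OF t]]] Q(2)])
    have "continuous_on ({-\<delta>..\<delta>} \<times> Q) (\<lambda>z. ddir (gram_det c) z (1, 0) / (2 * sqrt (gram_det c z)))"
      by (intro continuous_on_divide[OF cd _ nz] continuous_on_mult continuous_on_const continuous_on_real_sqrt cg)
    then show "continuous_on ({-\<delta>..\<delta>} \<times> Q) (\<lambda>(t, u). ddir (gram_det c) (t, u) (1, 0) / (2 * sqrt (gram_det c (t, u))))"
      by (simp add: case_prod_unfold)
  qed
  moreover have "(LINT u:B|lborel. ddir (gram_det c) (0, u) (1, 0) / (2 * sqrt (gram_det c (0, u))))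
     = (LINT u:B|lborel. area_variation c u)"
    by (rule set_lebesgue_integral_cong) (use B Q initial_sqrt_derivative[OF c] in auto)
  moreover have "(LINT u:B|lborel. sqrt (gram_det c (t, u))) = (LINT u:B|lborel. area_density (H t \<circ> cinv c) u)"
    if t: "\<bar>t\<bar> < \<delta>" for t
  proof (rule set_lebesgue_integral_cong)
    show "B \<in> sets lborel" using B by simp
    show "\<forall>u. u \<in> B \<longrightarrow> sqrt (gram_det c (t, u)) = area_density (H t \<circ> cinv c) u"
    proof (intro allI impI)
      fix u assume "u \<in> B"
      then have u: "u \<in> Q" "u \<in> cimg c" using B Q by auto
      have t': "\<bar>t\<bar> \<le> \<delta>" using t by simp
      show "sqrt (gram_det c (t, u)) = area_density (H t \<circ> cinv c) u"
        unfolding area_density_at_time[OF c tJ[OF t'] u(2)] using pos[OF t' u(1)] by simp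
    qed
  qed
  ultimately show ?thesis
    using has_field_derivative_transform_within[of "\<lambda>t. LINT u:B|lborel. sqrt (gram_det c (t, u))" _ 0 UNIV \<delta>
        "\<lambda>t. LINT u:B|lborel. area_density (H t \<circ> cinv c) u"] \<delta>(1)
    by (simp add: dist_real_def)
qed

lemma surface_area_eq:
  assumes t: "t \<in> J" and P: "pieces K C B"
    and Q: "\<And>c. c \<in> C \<Longrightarrow> compact (Q c) \<and> Q c \<subseteq> cimg c \<and> snd c ` B c \<subseteq> Q c"
  shows "surface_area A (H t) K = (\<Sum>c\<in>C. LINT u:snd c ` B c|lborel. area_density (H t \<circ> cinv c) u)"
proof -
  have CA: "c \<in> A" "B c \<in> sets borel" "B c \<subseteq> fst c" if "c \<in> C" for c
    using P that unfolding pieces_def by blast+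
  have nn: "0 \<le> area_density (H t \<circ> cinv c) u" for c u by (simp add: area_density_def)
  let ?a = "\<Sum>c\<in>C. \<integral>\<^sup>+u\<in>snd c ` B c. ennreal (area_density (H t \<circ> cinv c) u) \<partial>lborel"
  have "has_area A (H t) K a \<longleftrightarrow> a = ?a" for a
  proof
    assume "has_area A (H t) K a"
    then obtain C' B' where P': "pieces K C' B'"
      and a: "a = (\<Sum>c\<in>C'. \<integral>\<^sup>+u\<in>snd c ` B' c. ennreal (area_density (H t \<circ> cinv c) u) \<partial>lborel)"
      unfolding has_area_pieces by blast
    show "a = ?a"
      unfolding a by (rule density_pieces_independent[OF area_density_is_density[OF t] nn P' P])
  next
    assume "a = ?a"
    then show "has_area A (H t) K a" unfolding has_area_pieces using P by blast
  qed
  then have "has_area A (H t) K = (\<lambda>a. a = ?a)" by (rule ext)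
  then have "surface_area A (H t) K = enn2real ?a" unfolding surface_area_def by simp
  also have "?a = (\<Sum>c\<in>C. ennreal (LINT u:snd c ` B c|lborel. area_density (H t \<circ> cinv c) u))"
  proof (rule sum.cong[OF refl])
    fix c assume c: "c \<in> C"
    have "continuous_on (cimg c) (area_density (H t \<circ> cinv c))"
      using area_density_is_density[OF t] CA(1)[OF c] unfolding is_density_def by blast
    then have "continuous_on (Q c) (area_density (H t \<circ> cinv c))"
      using Q[OF c] continuous_on_subset by blast
    then have int: "set_integrable lborel (snd c ` B c) (area_density (H t \<circ> cinv c))"
      using Q[OF c] borel_chart_image[OF CA[OF c]] by (intro set_integrable_continuous_compact[of "Q c"]) auto
    have "(\<integral>\<^sup>+u\<in>snd c ` B c. ennreal (area_density (H t \<circ> cinv c) u) \<partial>lborel)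
        = (\<integral>\<^sup>+u. ennreal (indicator (snd c ` B c) u *\<^sub>R area_density (H t \<circ> cinv c) u) \<partial>lborel)"
      by (rule nn_integral_cong) (simp split: split_indicator)
    also have "\<dots> = ennreal (LINT u:snd c ` B c|lborel. area_density (H t \<circ> cinv c) u)"
      unfolding set_lebesgue_integral_def
      by (rule nn_integral_eq_integral[OF int[unfolded set_integrable_def]]) (simp add: nn)
    finally show "(\<integral>\<^sup>+u\<in>snd c ` B c. ennreal (area_density (H t \<circ> cinv c) u) \<partial>lborel)
        = ennreal (LINT u:snd c ` B c|lborel. area_density (H t \<circ> cinv c) u)" .
  qed
  also have "\<dots> = ennreal (\<Sum>c\<in>C. LINT u:snd c ` B c|lborel. area_density (H t \<circ> cinv c) u)"
    by (rule sum_ennreal) (simp add: set_lebesgue_integral_def nn)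
  also have "enn2real \<dots> = (\<Sum>c\<in>C. LINT u:snd c ` B c|lborel. area_density (H t \<circ> cinv c) u)"
    by (rule enn2real_ennreal) (intro sum_nonneg, simp add: set_lebesgue_integral_def nn)
  finally show ?thesis .
qed

text \<open>The transformation law is inherited from the area density by differentiating in time; this
  replaces a computation with second derivatives of the coordinate change.\<close>

lemma area_variation_is_density: "is_density area_variation"
  unfolding is_density_def
proof (intro conjI ballI)
  fix c assume c: "c \<in> A"
  have ne: "area_form c u \<noteq> 0" if "u \<in> cimg c" for u by (rule initial_defect(2)[OF c that])
  note s = C1_sgn_mult[OF cimg_open[OF c] Ck_on_continuous[OF area_form_C1[OF c]] ne alpha_C1[OF c]]
  have "continuous_on (cimg c) (\<lambda>u. ddir (\<lambda>u. sgn (area_form c u) * alpha c (axis 2 1) u) u (axis 1 1)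
     - ddir (\<lambda>u. sgn (area_form c u) * alpha c (axis 1 1) u) u (axis 2 1))"
    by (intro continuous_on_diff Ck_on_continuous[OF Ck_on_ddir[OF s(1)]])
  then show "continuous_on (cimg c) (area_variation c)"
    by (rule continuous_on_eq) (simp add: s(2) area_variation_def dalpha_def right_diff_distrib)
next
  fix c d p assume c: "c \<in> A" "d \<in> A" and p: "p \<in> fst c \<inter> fst d"
  then have pc: "snd c p \<in> cimg c" "snd d p \<in> cimg d" by auto
  let ?j = "\<bar>det (matrix (jacobian c d (snd c p)))\<bar>"
  have D: "((\<lambda>t. ?j * area_density (H t \<circ> cinv d) (snd d p)) has_real_derivative ?j * area_variation d (snd d p)) (at 0)"
    by (rule DERIV_cmult[OF area_density_derivative[OF c(2) pc(2)]])
  have eq: "?j * area_density (H t \<circ> cinv d) (snd d p) = area_density (H t \<circ> cinv c) (snd c p)" if "t \<in> J" for t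
  proof -
    have "area_density (H t \<circ> cinv c) (snd c p) = ?j * area_density (H t \<circ> cinv d) (snd d p)"
      using area_density_is_density[OF that] c p unfolding is_density_def by blast
    then show ?thesis by (rule sym)
  qed
  have "((\<lambda>t. area_density (H t \<circ> cinv c) (snd c p)) has_real_derivative ?j * area_variation d (snd d p)) (at 0)"
    by (rule has_field_derivative_transform_within_open[OF D open_real_greaterThanLessThan J0 eq])
  then show "area_variation c (snd c p) = ?j * area_variation d (snd d p)"
    by (rule DERIV_unique[OF area_density_derivative[OF c(1) pc(1)]])
qed

section \<open>Vanishing of the first variation\<close>

text \<open>For a cover of \<open>K\<close> by discs, the bump functions divided by their sum form a partition of unity
  near \<open>K\<close>. Where the sum vanishes the quotient is \<open>0\<close> by convention and need not be continuous, but
  there \<open>alpha\<close> is locally \<open>0\<close>, so that the products with \<open>alpha\<close> are continuously differentiable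
  everywhere.\<close>

context
  fixes I
  assumes fin: "finite I"
    and I: "\<And>c w \<rho>. (c, w, \<rho>) \<in> I \<Longrightarrow> c \<in> A \<and> 0 < \<rho> \<and> cball w \<rho> \<subseteq> cimg c"
    and cover: "K \<subseteq> (\<Union>(c, w, \<rho>)\<in>I. {p \<in> fst c. snd c p \<in> ball w \<rho>})"
begin

definition total_bump :: "'m \<Rightarrow> real" where "total_bump p = (\<Sum>i\<in>I. bump i p)"
definition weight :: "'m chart \<times> (real ^ 2) \<times> real \<Rightarrow> 'm \<Rightarrow> real" where
  "weight i p = bump i p * inverse (total_bump p)"
definition cut_alpha :: "'m chart \<times> (real ^ 2) \<times> real \<Rightarrow> 'm chart \<Rightarrow> real ^ 2 \<Rightarrow> real ^ 2 \<Rightarrow> real" where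
  "cut_alpha i c v u = weight i (cinv c u) * alpha c v u"
definition cut_variation :: "'m chart \<times> (real ^ 2) \<times> real \<Rightarrow> 'm chart \<Rightarrow> real ^ 2 \<Rightarrow> real" where
  "cut_variation i c u = sgn (area_form c u) *
     (ddir (cut_alpha i c (axis 2 1)) u (axis 1 1) - ddir (cut_alpha i c (axis 1 1)) u (axis 2 1))"

lemma bump_chart_C1: "i \<in> I \<Longrightarrow> c \<in> A \<Longrightarrow> Ck_on (Suc 0) (\<lambda>u. bump i (cinv c u)) (cimg c)"
proof -
  assume i: "i \<in> I" and c: "c \<in> A"
  obtain d w \<rho> where dw: "i = (d, w, \<rho>)" by (cases i)
  show "Ck_on (Suc 0) (\<lambda>u. bump i (cinv c u)) (cimg c)"
    unfolding dw by (rule bump_C1[OF c]) (use I[OF i[unfolded dw]] in simp_all)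
qed

lemma total_bump_C1: "c \<in> A \<Longrightarrow> Ck_on (Suc 0) (\<lambda>u. total_bump (cinv c u)) (cimg c)"
  unfolding total_bump_def by (rule C1_sum) (rule bump_chart_C1)

lemma total_bump_pos:
  assumes "p \<in> K" shows "0 < total_bump p"
proof -
  obtain c w \<rho> where i: "(c, w, \<rho>) \<in> I" "p \<in> fst c" "snd c p \<in> ball w \<rho>" using subsetD[OF cover assms] by blast
  show ?thesis unfolding total_bump_def
    by (rule sum_pos2[where f = "\<lambda>i. bump i p", OF fin i(1) bump_pos[OF i(2,3)] bump_nonneg])
qed

lemma open_near_K:
  assumes c: "c \<in> A"
  shows "open {u \<in> cimg c. 0 < total_bump (cinv c u)}" (is "open ?V")
    and "i \<in> I \<Longrightarrow> Ck_on (Suc 0) (\<lambda>u. weight i (cinv c u)) {u \<in> cimg c. 0 < total_bump (cinv c u)}"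
proof -
  show "open ?V"
    using continuous_open_preimage[OF Ck_on_continuous[OF total_bump_C1[OF c]] cimg_open[OF c] open_greaterThan, of 0]
    by (simp add: vimage_def Int_def)
  have sub: "?V \<subseteq> cimg c" by blast
  show "Ck_on (Suc 0) (\<lambda>u. weight i (cinv c u)) ?V" if i: "i \<in> I"
    unfolding weight_def
    by (rule C1_mult[OF Ck_on_subset[OF bump_chart_C1[OF i c] sub] C1_inverse[OF Ck_on_subset[OF total_bump_C1[OF c] sub]]]) simp
qed

lemma open_off_K_chart:
  assumes c: "c \<in> A"
  shows "open {u \<in> cimg c. cinv c u \<in> S - K}"
  by (rule open_chart_preimage[OF c open_off_K])

lemma off_K_cases:
  assumes c: "c \<in> A" and u: "u \<in> cimg c"
  obtains "cinv c u \<in> K" "u \<in> {u \<in> cimg c. 0 < total_bump (cinv c u)}"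
    | "cinv c u \<notin> K" "u \<in> {u \<in> cimg c. cinv c u \<in> S - K}"
proof (cases "cinv c u \<in> K")
  case True
  then show ?thesis by (intro that(1)) (simp_all add: u total_bump_pos)
next
  case False
  moreover have "cinv c u \<in> S" using cinv_in[OF u] chart_subset[OF c] by blast
  ultimately show ?thesis by (intro that(2)) (simp_all add: u)
qed

lemma cut_alpha_C1:
  assumes i: "i \<in> I" and c: "c \<in> A"
  shows "Ck_on (Suc 0) (cut_alpha i c v) (cimg c)"
proof (rule Ck_on_local)
  fix u assume u: "u \<in> cimg c"
  show "\<exists>V. open V \<and> u \<in> V \<and> Ck_on (Suc 0) (cut_alpha i c v) V"
  proof (rule off_K_cases[OF c u])
    let ?V = "{u \<in> cimg c. 0 < total_bump (cinv c u)}"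
    assume u: "u \<in> ?V"
    have "Ck_on (Suc 0) (cut_alpha i c v) ?V"
      unfolding cut_alpha_def[abs_def]
      by (rule C1_mult[OF open_near_K(2)[OF c i] Ck_on_subset[OF alpha_C1[OF c]]]) blast
    with u open_near_K(1)[OF c] show ?thesis by (intro exI[of _ ?V]) (intro conjI)
  next
    let ?V = "{u \<in> cimg c. cinv c u \<in> S - K}"
    assume u: "u \<in> ?V"
    have "Ck_on (Suc 0) (cut_alpha i c v) ?V \<longleftrightarrow> Ck_on (Suc 0) (\<lambda>u. 0::real) ?V"
      by (rule Ck_on_cong[OF open_off_K_chart[OF c]]) (simp add: cut_alpha_def alpha_off_K[OF c])
    then have "Ck_on (Suc 0) (cut_alpha i c v) ?V" using C1_const by (rule iffD2)
    with u open_off_K_chart[OF c] show ?thesis by (intro exI[of _ ?V]) (intro conjI)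
  qed
qed

lemma cut_variation_zero:
  assumes c: "c \<in> A" and V: "open V" "u \<in> V" "\<And>x v. x \<in> V \<Longrightarrow> cut_alpha i c v x = 0"
  shows "cut_variation i c u = 0"
proof -
  have "frechet_derivative (cut_alpha i c v) (at u) = frechet_derivative (\<lambda>x. 0) (at u)" for v
    by (rule ddir_cong[OF V(1,2)]) (rule V(3))
  then show ?thesis by (simp add: cut_variation_def)
qed

lemma cut_variation_off_K:
  assumes c: "c \<in> A" and u: "u \<in> cimg c" "cinv c u \<notin> K"
  shows "cut_variation i c u = 0"
proof (rule cut_variation_zero[OF c open_off_K_chart[OF c]])
  show "u \<in> {u \<in> cimg c. cinv c u \<in> S - K}" using u cinv_in[OF u(1)] chart_subset[OF c] by blast
qed (simp add: cut_alpha_def alpha_off_K[OF c])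

lemma area_variation_off_K:
  assumes c: "c \<in> A" and u: "u \<in> cimg c" "cinv c u \<notin> K"
  shows "area_variation c u = 0"
proof -
  have "frechet_derivative (alpha c v) (at u) = frechet_derivative (\<lambda>x. 0) (at u)" for v
  proof (rule ddir_cong[OF open_off_K_chart[OF c]])
    show "u \<in> {u \<in> cimg c. cinv c u \<in> S - K}" using u cinv_in[OF u(1)] chart_subset[OF c] by blast
  qed (simp add: alpha_off_K[OF c])
  then show ?thesis by (simp add: area_variation_def dalpha_def)
qed

text \<open>The product rule separates the variation of the cut-off form into a multiple of a known density
  and a term in which only first derivatives occur.\<close>

lemma cut_variation_product:
  assumes i: "i \<in> I" and c: "c \<in> A" and u: "u \<in> cimg c" "cinv c u \<in> K"
  shows "cut_variation i c u = weight i (cinv c u) * area_variation c u + sgn (area_form c u) *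
     (ddir (\<lambda>u. weight i (cinv c u)) u (axis 1 1) * alpha c (axis 2 1) u
      - ddir (\<lambda>u. weight i (cinv c u)) u (axis 2 1) * alpha c (axis 1 1) u)"
proof -
  have uV: "u \<in> {u \<in> cimg c. 0 < total_bump (cinv c u)}" using u total_bump_pos by blast
  have w: "(\<lambda>u. weight i (cinv c u)) differentiable at u"
    by (rule Ck_on_differentiable[OF open_near_K(2)[OF c i] uV])
  have a: "alpha c v differentiable at u" for v
    by (rule Ck_on_differentiable[OF alpha_C1[OF c] u(1)])
  show ?thesis
    unfolding cut_variation_def cut_alpha_def[abs_def] ddir_mult[OF w a] area_variation_def dalpha_def
    by (simp add: algebra_simps)
qed

text \<open>The second summand in the product rule is the wedge of the differential of the weight and
  \<open>alpha\<close>, which transforms with the Jacobian determinant; the sign of the area form turns this into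
  the absolute value of the determinant.\<close>

lemma cut_variation_is_density:
  assumes i: "i \<in> I"
  shows "is_density (cut_variation i)"
  unfolding is_density_def
proof (intro conjI ballI)
  fix c assume c: "c \<in> A"
  have ne: "area_form c u \<noteq> 0" if "u \<in> cimg c" for u by (rule initial_defect(2)[OF c that])
  note s = C1_sgn_mult[OF cimg_open[OF c] Ck_on_continuous[OF area_form_C1[OF c]] ne cut_alpha_C1[OF i c]]
  have "continuous_on (cimg c) (\<lambda>u. ddir (\<lambda>u. sgn (area_form c u) * cut_alpha i c (axis 2 1) u) u (axis 1 1)
     - ddir (\<lambda>u. sgn (area_form c u) * cut_alpha i c (axis 1 1) u) u (axis 2 1))"
    by (intro continuous_on_diff Ck_on_continuous[OF Ck_on_ddir[OF s(1)]])
  then show "continuous_on (cimg c) (cut_variation i c)"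
    by (rule continuous_on_eq) (simp add: s(2) cut_variation_def right_diff_distrib)
next
  fix c d p assume c: "c \<in> A" "d \<in> A" and p': "p \<in> fst c \<inter> fst d"
  then have p: "p \<in> fst c" "p \<in> fst d" and pc: "snd c p \<in> cimg c" "snd d p \<in> cimg d" by auto
  have ci: "cinv c (snd c p) = p" "cinv d (snd d p) = p" using cinv_chart c p by auto
  let ?L = "jacobian c d (snd c p)"
  show "cut_variation i c (snd c p) = \<bar>det (matrix ?L)\<bar> * cut_variation i d (snd d p)"
  proof (cases "p \<in> K")
    case False
    then show ?thesis using cut_variation_off_K[OF c(1) pc(1)] cut_variation_off_K[OF c(2) pc(2)] ci by simp
  next
    case True
    define W where "W v = ddir (\<lambda>u. weight i (cinv d u)) (snd d p) v" for v
    have dW: "((\<lambda>u. weight i (cinv d u)) has_derivative W) (at (snd d p))"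
      unfolding W_def
      by (rule Ck_on_has_derivative[OF open_near_K(2)[OF c(2) i]]) (use pc total_bump_pos[OF True] ci in simp)
    have Wc: "ddir (\<lambda>u. weight i (cinv c u)) (snd c p) v = W (?L v)" for v
    proof (rule ddir_eq)
      have T: "transition c d (snd c p) = snd d p" using ci by simp
      have "((\<lambda>u. weight i (cinv d (transition c d u))) has_derivative (\<lambda>v. W (?L v))) (at (snd c p))"
        by (rule has_derivative_compose[where f = "transition c d" and g = "\<lambda>u. weight i (cinv d u)",
              OF transition_has_derivative[OF c p]]) (simp only: T dW)
      then show "((\<lambda>u. weight i (cinv c u)) has_derivative (\<lambda>v. W (?L v))) (at (snd c p))"
      proof (rule has_derivative_transform_within_open[OF _ open_overlap[OF c]])
        show "snd c p \<in> snd c ` (fst c \<inter> fst d)" using p' by blast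
        fix u assume "u \<in> snd c ` (fst c \<inter> fst d)"
        then obtain q where "u = snd c q" "q \<in> fst c" "q \<in> fst d" by blast
        then show "weight i (cinv d (transition c d u)) = weight i (cinv c u)"
          using cinv_chart[OF c(1), of q] cinv_chart[OF c(2), of q] by simp
      qed
    qed
    define w where "w a b = W a * alpha d b (snd d p) - W b * alpha d a (snd d p)" for a b
    have "w (?L (axis 1 1)) (?L (axis 2 1)) = det (matrix ?L) * w (axis 1 1) (axis 2 1)"
    proof (rule alternating_linear_map)
      have la: "linear (\<lambda>b. alpha d b (snd d p))" by (rule linear_alpha[OF c(2) pc(2)])
      have lW: "linear W" by (rule has_derivative_linear[OF dW])
      show "linear (w v)" for v
        by (rule linearI) (simp_all add: w_def linear_add[OF la] linear_cmul[OF la] linear_add[OF lW] linear_cmul[OF lW] algebra_simps)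
      show "w v v' = - w v' v" for v v' by (simp add: w_def)
    qed
    moreover have "sgn (area_form c (snd c p)) * det (matrix ?L) = \<bar>det (matrix ?L)\<bar> * sgn (area_form d (snd d p))"
      unfolding area_form_transition[OF c p] sgn_mult using mult_sgn_abs[of "det (matrix ?L)"]
      by (simp add: sgn_if abs_if)
    moreover have "area_variation c (snd c p) = \<bar>det (matrix ?L)\<bar> * area_variation d (snd d p)"
      using area_variation_is_density c p' unfolding is_density_def by blast
    moreover have "cut_variation i c (snd c p) = weight i p * area_variation c (snd c p) +
        sgn (area_form c (snd c p)) * w (?L (axis 1 1)) (?L (axis 2 1))"
      using cut_variation_product[OF i c(1) pc(1)] True
      by (simp only: ci Wc alpha_transition[OF c p] w_def)
    moreover have "cut_variation i d (snd d p) = weight i p * area_variation d (snd d p) +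
        sgn (area_form d (snd d p)) * w (axis 1 1) (axis 2 1)"
      using cut_variation_product[OF i c(2) pc(2)] True
      by (simp only: ci W_def[symmetric] w_def)
    ultimately show ?thesis by (simp add: algebra_simps)
  qed
qed

lemma sum_cut_variation:
  assumes c: "c \<in> A" and u: "u \<in> cimg c"
  shows "(\<Sum>i\<in>I. cut_variation i c u) = area_variation c u"
proof (rule off_K_cases[OF c u])
  assume "cinv c u \<notin> K"
  then show ?thesis using cut_variation_off_K[OF c u] area_variation_off_K[OF c u] by simp
next
  let ?V = "{u \<in> cimg c. 0 < total_bump (cinv c u)}"
  assume uV: "u \<in> ?V"
  have d: "cut_alpha i c v differentiable at u" if "i \<in> I" for i v
    by (rule Ck_on_differentiable[OF cut_alpha_C1[OF that c] u])
  have "(\<Sum>i\<in>I. ddir (cut_alpha i c v) u w) = ddir (alpha c v) u w" for v w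
  proof -
    have "(\<Sum>i\<in>I. ddir (cut_alpha i c v) u w) = ddir (\<lambda>u. \<Sum>i\<in>I. cut_alpha i c v u) u w"
      by (rule ddir_sum[symmetric]) (rule d)
    also have "frechet_derivative (\<lambda>u. \<Sum>i\<in>I. cut_alpha i c v u) (at u) = frechet_derivative (alpha c v) (at u)"
    proof (rule ddir_cong[OF open_near_K(1)[OF c] uV])
      fix x assume x: "x \<in> ?V"
      have "(\<Sum>i\<in>I. cut_alpha i c v x) = total_bump (cinv c x) * inverse (total_bump (cinv c x)) * alpha c v x"
        by (simp add: cut_alpha_def weight_def total_bump_def sum_distrib_right)
      then show "(\<Sum>i\<in>I. cut_alpha i c v x) = alpha c v x" using x by simp
    qed
    finally show ?thesis .
  qed
  then show ?thesis
    by (simp add: cut_variation_def area_variation_def dalpha_def sum_distrib_left[symmetric] sum_subtractf)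
qed

text \<open>The cut-off form lives in one disc, where its signed exterior derivative is a difference of
  derivatives of compactly supported functions.\<close>

lemma total_cut_variation:
  assumes i: "i \<in> I" and P: "pieces K C B"
    and Q: "\<And>c. c \<in> C \<Longrightarrow> compact (Q c) \<and> Q c \<subseteq> cimg c \<and> snd c ` B c \<subseteq> Q c"
  shows "(\<Sum>c\<in>C. LINT u:snd c ` B c|lborel. cut_variation i c u) = 0"
proof -
  obtain d w \<rho> where dw: "i = (d, w, \<rho>)" by (cases i)
  then have d: "d \<in> A" "0 < \<rho>" "cball w \<rho> \<subseteq> cimg d" using I i by blast+
  have off: "cut_alpha i c v x = 0"
    if "\<not> (cinv c x \<in> fst d \<and> snd d (cinv c x) \<in> cball w \<rho>)" for c v x
    using bump_zero[OF d(2) that] by (simp add: cut_alpha_def weight_def dw)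
  have "(\<Sum>c\<in>C. LINT u:snd c ` B c|lborel. cut_variation i c u) = (LINT u:cball w \<rho>|lborel. cut_variation i d u)"
  proof (rule total_single_chart[OF cut_variation_is_density[OF i] K(1,2) P Q d(1,3)])
    fix e p assume e: "e \<in> A" "p \<in> fst e" and nz: "cut_variation i e (snd e p) \<noteq> 0"
    have pe: "snd e p \<in> cimg e" "cinv e (snd e p) = p" using e cinv_chart by auto
    have "p \<in> K" using cut_variation_off_K[OF e(1) pe(1), of i] nz unfolding pe(2) by blast
    moreover have "p \<in> fst d \<and> snd d p \<in> cball w \<rho>"
    proof (rule ccontr)
      assume n: "\<not> (p \<in> fst d \<and> snd d p \<in> cball w \<rho>)"
      have "cut_variation i e (snd e p) = 0"
      proof (rule cut_variation_zero[OF e(1) open_chart_preimage[OF e(1) open_off_ball[OF d(1,3)]]])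
        show "snd e p \<in> {u \<in> cimg e. cinv e u \<in> {p \<in> S. \<not> (p \<in> fst d \<and> snd d p \<in> cball w \<rho>)}}"
          using pe n e chart_subset[OF e(1)] by auto
      qed (rule off, blast)
      with nz show False by simp
    qed
    ultimately show "p \<in> K \<and> p \<in> fst d \<and> snd d p \<in> cball w \<rho>" by blast
  qed
  also have "\<dots> = 0"
  proof -
    have ne: "area_form d u \<noteq> 0" if "u \<in> cimg d" for u by (rule initial_defect(2)[OF d(1) that])
    define b where "b v u = sgn (area_form d u) * cut_alpha i d v u" for v u
    note s = C1_sgn_mult[OF cimg_open[OF d(1)] Ck_on_continuous[OF area_form_C1[OF d(1)]] ne cut_alpha_C1[OF i d(1)], folded b_def]
    have zero: "(LINT u:cball w \<rho>|lborel. ddir (b v) u v') = 0" for v v'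
    proof (rule integral_derivative_compact_support[OF cimg_open[OF d(1)] compact_cball d(3) s(1)])
      fix u assume u: "u \<in> cimg d - cball w \<rho>"
      then have "snd d (cinv d u) \<notin> cball w \<rho>" using chart_cinv[of u d] by simp
      then show "b v u = 0" using off[of d u v] by (simp add: b_def)
    qed
    have int: "set_integrable lborel (cball w \<rho>) (\<lambda>u. ddir (b v) u v')" for v v'
      by (rule set_integrable_continuous_compact[OF compact_cball _ borel_closed[OF closed_cball] subset_refl])
        (rule continuous_on_subset[OF Ck_on_continuous[OF Ck_on_ddir[OF s(1)]] d(3)])
    have "(LINT u:cball w \<rho>|lborel. cut_variation i d u)
      = (LINT u:cball w \<rho>|lborel. ddir (b (axis 2 1)) u (axis 1 1) - ddir (b (axis 1 1)) u (axis 2 1))"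
    proof (rule set_lebesgue_integral_cong)
      show "\<forall>u. u \<in> cball w \<rho> \<longrightarrow> cut_variation i d u = ddir (b (axis 2 1)) u (axis 1 1) - ddir (b (axis 1 1)) u (axis 2 1)"
        using d(3) s(2) by (auto simp: cut_variation_def right_diff_distrib subset_eq)
    qed simp
    also have "\<dots> = 0" unfolding set_integral_diff(2)[OF int int] zero by simp
    finally show ?thesis .
  qed
  finally show ?thesis .
qed

end

lemma total_area_variation:
  assumes P: "pieces K C B"
    and Q: "\<And>c. c \<in> C \<Longrightarrow> compact (Q c) \<and> Q c \<subseteq> cimg c \<and> snd c ` B c \<subseteq> Q c"
  shows "(\<Sum>c\<in>C. LINT u:snd c ` B c|lborel. area_variation c u) = 0"
proof -
  obtain I where I: "finite I"
    "\<And>c w \<rho>. (c, w, \<rho>) \<in> I \<Longrightarrow> c \<in> A \<and> 0 < \<rho> \<and> cball w \<rho> \<subseteq> cimg c"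
    "K \<subseteq> (\<Union>(c, w, \<rho>)\<in>I. {p \<in> fst c. snd c p \<in> ball w \<rho>})"
    using finite_ball_cover[OF K(1,2)] by blast
  have CA: "c \<in> A" "B c \<in> sets borel" "B c \<subseteq> fst c" if "c \<in> C" for c
    using P that unfolding pieces_def by blast+
  have "(LINT u:snd c ` B c|lborel. area_variation c u) = (\<Sum>i\<in>I. LINT u:snd c ` B c|lborel. cut_variation I i c u)"
    if c: "c \<in> C" for c
  proof -
    have int: "set_integrable lborel (snd c ` B c) (cut_variation I i c)" if i: "i \<in> I" for i
    proof -
      have "continuous_on (cimg c) (cut_variation I i c)"
        using cut_variation_is_density[OF I i] CA(1)[OF c] unfolding is_density_def by blast
      then have "continuous_on (Q c) (cut_variation I i c)" using Q[OF c] continuous_on_subset by blast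
      then show ?thesis
        using Q[OF c] borel_chart_image[OF CA[OF c]] by (intro set_integrable_continuous_compact[of "Q c"]) auto
    qed
    have "(LINT u:snd c ` B c|lborel. area_variation c u) = (LINT u:snd c ` B c|lborel. \<Sum>i\<in>I. cut_variation I i c u)"
    proof (rule set_lebesgue_integral_cong)
      show "\<forall>u. u \<in> snd c ` B c \<longrightarrow> area_variation c u = (\<Sum>i\<in>I. cut_variation I i c u)"
        using sum_cut_variation[OF I CA(1)[OF c]] CA(3)[OF c] by auto
    qed (use borel_chart_image[OF CA[OF c]] in simp)
    also have "\<dots> = (\<Sum>i\<in>I. LINT u:snd c ` B c|lborel. cut_variation I i c u)"
      using int unfolding set_lebesgue_integral_def set_integrable_def scaleR_sum_right
      by (rule Bochner_Integration.integral_sum)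
    finally show ?thesis .
  qed
  then have "(\<Sum>c\<in>C. LINT u:snd c ` B c|lborel. area_variation c u)
     = (\<Sum>c\<in>C. \<Sum>i\<in>I. LINT u:snd c ` B c|lborel. cut_variation I i c u)" by simp
  also have "\<dots> = (\<Sum>i\<in>I. \<Sum>c\<in>C. LINT u:snd c ` B c|lborel. cut_variation I i c u)" by (rule sum.swap)
  also have "\<dots> = 0" using total_cut_variation[OF I _ P Q] by simp
  finally show ?thesis .
qed

lemma surface_area_stationary: "((\<lambda>t. surface_area A (H t) K) has_real_derivative 0) (at 0)"
proof -
  obtain C B Q where P: "pieces K C B"
    and Q: "\<And>c. c \<in> C \<Longrightarrow> compact (Q c) \<and> Q c \<subseteq> cimg c \<and> snd c ` B c \<subseteq> Q c"
    using compact_pieces[OF K(1,2)] by blast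
  have CA: "c \<in> A" "B c \<in> sets borel" "B c \<subseteq> fst c" if "c \<in> C" for c
    using P that unfolding pieces_def by blast+
  have total: "(\<Sum>c\<in>C. LINT u:snd c ` B c|lborel. area_variation c u) = 0"
    by (rule total_area_variation[OF P Q])
  have "((\<lambda>t. \<Sum>c\<in>C. LINT u:snd c ` B c|lborel. area_density (H t \<circ> cinv c) u) has_real_derivative
      (\<Sum>c\<in>C. LINT u:snd c ` B c|lborel. area_variation c u)) (at 0)"
  proof (rule DERIV_sum)
    fix c assume c: "c \<in> C"
    show "((\<lambda>t. LINT u:snd c ` B c|lborel. area_density (H t \<circ> cinv c) u) has_real_derivative
      (LINT u:snd c ` B c|lborel. area_variation c u)) (at 0)"
      by (rule piece_area_derivative[OF CA(1)[OF c], of "Q c"])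
        (use Q[OF c] borel_chart_image[OF CA[OF c]] in auto)
  qed
  then have "((\<lambda>t. \<Sum>c\<in>C. LINT u:snd c ` B c|lborel. area_density (H t \<circ> cinv c) u) has_real_derivative 0) (at 0)"
    unfolding total .
  then show ?thesis
  proof (rule has_field_derivative_transform_within_open[OF _ open_real_greaterThanLessThan J0])
    fix t assume t: "t \<in> J"
    show "(\<Sum>c\<in>C. LINT u:snd c ` B c|lborel. area_density (H t \<circ> cinv c) u) = surface_area A (H t) K"
      by (rule surface_area_eq[OF t P Q, symmetric])
  qed
qed

end

section \<open>Holomorphic curves are maximal\<close>

theorem proposition7:
  fixes S :: "'m::{t2_space, second_countable_topology} set"
    and A :: "'m chart set"
    and F :: "'m \<Rightarrow> psphere \<times> psphere"
  assumes "holomorphic_curve S A F"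
    and "nondegenerate_metric A F"
  shows "maximal_surface S A F"
  unfolding maximal_surface_def
proof (intro allI impI)
  fix K \<epsilon> H assume "compact_variation S A F K \<epsilon> H"
  moreover have "smooth_surface S A"
    using assms(1) unfolding holomorphic_curve_def immersed_surface_def by blast
  ultimately interpret holomorphic_variation S A F K \<epsilon> H
    using assms by unfold_locales
  show "((\<lambda>t. surface_area A (H t) K) has_real_derivative 0) (at 0)"
    by (rule surface_area_stationary)
qed

end
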